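(* Let $\kappa$ be a field, let $S, S_1, S_2$ be affine semigroups with injective homomorphisms $S\to S_1$ and $S\to S_2$, and put $R=\kappa[S]$, $R_1=\kappa[\mathbf{u}^{S_1}]$, $R_2=\kappa[\mathbf{v}^{S_2}]$, where $R_1$ and $R_2$ are regarded as $R$-algebras via the given homomorphisms. If $S_2$ is positive, $R_2$ is flat over $R$, and $\mathrm{Grp}(S_1)\cap\mathrm{Grp}(S_2)=\mathrm{Grp}(S)$ in $\mathrm{Grp}(S_1\,\widetilde{\oplus}_S\,S_2)$, then $$\kappa[\mathbf{w}^{S_1\widetilde{\oplus}_S S_2}]\simeq R_1\otimes_R R_2$$ as $R$-algebras.
   Context: Monoids are commutative, written additively with identity $0$; homomorphisms preserve $+$ and $0$. An affine semigroup is a finitely generated, cancellative, torsion-free monoid (torsion free: $ns_1=ns_2$ for some positive integer $n$ implies $s_1=s_2$). It is positive if $0$ is its only invertible element. $\mathrm{Grp}(S)=\{s-t: s,t\in S\}$ is the group of differences of a cancellative monoid $S$. $\kappa[\mathbf{u}^{S}]$ denotes the monoid ring with $\kappa$-basis the symbols $\mathbf{u}^s$, $s\in S$, and $\mathbf{u}^s\mathbf{u}^t=\mathbf{u}^{s+t}$ (the letters $\mathbf{u},\mathbf{v},\mathbf{w}$ are just different names for the symbol). For homomorphisms $S\to S_1$, $S\to S_2$ of cancellative monoids, $S_1\oplus_S S_2$ denotes the image of the composite $S_1\oplus S_2\to\mathrm{Grp}(S_1)\oplus\mathrm{Grp}(S_2)\to(\mathrm{Grp}(S_1)\oplus\mathrm{Grp}(S_2))/\{(s,-s):s\in\mathrm{Grp}(S)\}$,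 where elements of $\mathrm{Grp}(S)$ are identified with their images. On a monoid, $x\sim_{\mathrm{tor}}y$ means $nx=ny$ for some positive integer $n$. For affine semigroups, $S_1\,\widetilde{\oplus}_S\,S_2:=(S_1\oplus_S S_2)/\!\sim_{\mathrm{tor}}$, which is an affine semigroup. When $S\to S_1$ and $S\to S_2$ are injective, the canonical maps from $S_1$, $S_2$, $S$ to $S_1\,\widetilde{\oplus}_S\,S_2$ are injective, and $S_1,S_2,S$ are regarded as submonoids of it, so $\mathrm{Grp}(S_1),\mathrm{Grp}(S_2),\mathrm{Grp}(S)$ are subgroups of $\mathrm{Grp}(S_1\,\widetilde{\oplus}_S\,S_2)$. *)

theory Defs
  imports "HOL-Algebra.Module" "HOL-Algebra.QuotRing" "HOL-Algebra.Divisibility"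
begin

text \<open>Commutative monoids are HOL-Algebra monoids, hence written multiplicatively:
  \<open>\<otimes>\<close> is the sum, \<open>\<one>\<close> the element 0 and \<open>x [^] n\<close> the multiple \<open>n x\<close>.\<close>

section \<open>Affine semigroups\<close>

definition fin_gen_monoid :: "('a, 'm) monoid_scheme \<Rightarrow> bool" where
  "fin_gen_monoid M \<longleftrightarrow>
     (\<exists>A. finite A \<and> A \<subseteq> carrier M \<and> \<Inter>{H. submonoid H M \<and> A \<subseteq> H} = carrier M)"

definition torsion_free_monoid :: "('a, 'm) monoid_scheme \<Rightarrow> bool" where
  "torsion_free_monoid M \<longleftrightarrow>
     (\<forall>x\<in>carrier M. \<forall>y\<in>carrier M. \<forall>n::nat. n > 0 \<and> x [^]\<^bsub>M\<^esub> n = y [^]\<^bsub>M\<^esub> n \<longrightarrow> x = y)"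

definition affine_semigroup :: "('a, 'm) monoid_scheme \<Rightarrow> bool" where
  "affine_semigroup M \<longleftrightarrow> comm_monoid_cancel M \<and> fin_gen_monoid M \<and> torsion_free_monoid M"

definition positive_monoid :: "('a, 'm) monoid_scheme \<Rightarrow> bool" where
  "positive_monoid M \<longleftrightarrow> Units M = {\<one>\<^bsub>M\<^esub>}"

definition monoid_hom :: "('a, 'm) monoid_scheme \<Rightarrow> ('b, 'n) monoid_scheme \<Rightarrow> ('a \<Rightarrow> 'b) set" where
  "monoid_hom M N = {f \<in> hom M N. f \<one>\<^bsub>M\<^esub> = \<one>\<^bsub>N\<^esub>}"


section \<open>The group of differences\<close>

text \<open>The formal difference \<open>s - t\<close>: the class of \<open>(s, t)\<close> for the relation
  \<open>(a, b) \<sim> (s, t) \<longleftrightarrow> a + t = s + b\<close>.\<close>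
definition diff_class :: "('a, 'm) monoid_scheme \<Rightarrow> 'a \<Rightarrow> 'a \<Rightarrow> ('a \<times> 'a) set" where
  "diff_class M s t = {(a, b) \<in> carrier M \<times> carrier M. a \<otimes>\<^bsub>M\<^esub> t = s \<otimes>\<^bsub>M\<^esub> b}"

text \<open>In this definition, and in the similar ones below, the unions run over all representatives;
  they return the common value of the class on the right.\<close>
definition Grp :: "('a, 'm) monoid_scheme \<Rightarrow> ('a \<times> 'a) set monoid" where
  "Grp M = \<lparr>carrier = {diff_class M s t | s t. s \<in> carrier M \<and> t \<in> carrier M},
     monoid.mult = (\<lambda>X Y. \<Union>p\<in>X. \<Union>q\<in>Y. diff_class M (fst p \<otimes>\<^bsub>M\<^esub> fst q) (snd p \<otimes>\<^bsub>M\<^esub> snd q)),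
     one = diff_class M \<one>\<^bsub>M\<^esub> \<one>\<^bsub>M\<^esub>\<rparr>"

definition to_Grp :: "('a, 'm) monoid_scheme \<Rightarrow> 'a \<Rightarrow> ('a \<times> 'a) set" where
  "to_Grp M s = diff_class M s \<one>\<^bsub>M\<^esub>"

text \<open>The homomorphism \<open>s - t \<mapsto> f s - f t\<close> into \<open>Grp N\<close> induced by a homomorphism \<open>f\<close>
  into \<open>N\<close>.\<close>
definition Grp_map :: "('b, 'n) monoid_scheme \<Rightarrow> ('a \<Rightarrow> 'b) \<Rightarrow> ('a \<times> 'a) set \<Rightarrow> ('b \<times> 'b) set" where
  "Grp_map N f X = (\<Union>p\<in>X. diff_class N (f (fst p)) (f (snd p)))"


section \<open>Amalgamated sums\<close>

text \<open>The subgroup \<open>{(s, -s) : s \<in> Grp S}\<close> of \<open>Grp S1 \<oplus> Grp S2\<close>.\<close>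
definition antidiagonal ::
  "('a, 'l) monoid_scheme \<Rightarrow> ('b, 'm) monoid_scheme \<Rightarrow> ('c, 'n) monoid_scheme \<Rightarrow>
   ('a \<Rightarrow> 'b) \<Rightarrow> ('a \<Rightarrow> 'c) \<Rightarrow> (('b \<times> 'b) set \<times> ('c \<times> 'c) set) set" where
  "antidiagonal S S1 S2 \<phi>1 \<phi>2 =
     (\<lambda>g. (Grp_map S1 \<phi>1 g, inv\<^bsub>Grp S2\<^esub> (Grp_map S2 \<phi>2 g))) ` carrier (Grp S)"

definition amalg_map ::
  "('a, 'l) monoid_scheme \<Rightarrow> ('b, 'm) monoid_scheme \<Rightarrow> ('c, 'n) monoid_scheme \<Rightarrow>
   ('a \<Rightarrow> 'b) \<Rightarrow> ('a \<Rightarrow> 'c) \<Rightarrow> 'b \<times> 'c \<Rightarrow> (('b \<times> 'b) set \<times> ('c \<times> 'c) set) set" where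
  "amalg_map S S1 S2 \<phi>1 \<phi>2 =
     (\<lambda>(x, y). antidiagonal S S1 S2 \<phi>1 \<phi>2 #>\<^bsub>Grp S1 \<times>\<times> Grp S2\<^esub> (to_Grp S1 x, to_Grp S2 y))"

definition amalg_sum ::
  "('a, 'l) monoid_scheme \<Rightarrow> ('b, 'm) monoid_scheme \<Rightarrow> ('c, 'n) monoid_scheme \<Rightarrow>
   ('a \<Rightarrow> 'b) \<Rightarrow> ('a \<Rightarrow> 'c) \<Rightarrow> (('b \<times> 'b) set \<times> ('c \<times> 'c) set) set monoid" where
  "amalg_sum S S1 S2 \<phi>1 \<phi>2 =
     ((Grp S1 \<times>\<times> Grp S2) Mod antidiagonal S S1 S2 \<phi>1 \<phi>2)
       \<lparr>carrier := amalg_map S S1 S2 \<phi>1 \<phi>2 ` (carrier S1 \<times> carrier S2)\<rparr>"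

definition tor_class :: "('a, 'm) monoid_scheme \<Rightarrow> 'a \<Rightarrow> 'a set" where
  "tor_class M x = {y \<in> carrier M. \<exists>n::nat. n > 0 \<and> x [^]\<^bsub>M\<^esub> n = y [^]\<^bsub>M\<^esub> n}"

definition tor_quot :: "('a, 'm) monoid_scheme \<Rightarrow> 'a set monoid" where
  "tor_quot M = \<lparr>carrier = tor_class M ` carrier M,
     monoid.mult = (\<lambda>X Y. \<Union>x\<in>X. \<Union>y\<in>Y. tor_class M (x \<otimes>\<^bsub>M\<^esub> y)),
     one = tor_class M \<one>\<^bsub>M\<^esub>\<rparr>"

definition tf_amalg_sum ::
  "('a, 'l) monoid_scheme \<Rightarrow> ('b, 'm) monoid_scheme \<Rightarrow> ('c, 'n) monoid_scheme \<Rightarrow>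
   ('a \<Rightarrow> 'b) \<Rightarrow> ('a \<Rightarrow> 'c) \<Rightarrow> (('b \<times> 'b) set \<times> ('c \<times> 'c) set) set set monoid" where
  "tf_amalg_sum S S1 S2 \<phi>1 \<phi>2 = tor_quot (amalg_sum S S1 S2 \<phi>1 \<phi>2)"

definition tf_amalg_in1 ::
  "('a, 'l) monoid_scheme \<Rightarrow> ('b, 'm) monoid_scheme \<Rightarrow> ('c, 'n) monoid_scheme \<Rightarrow>
   ('a \<Rightarrow> 'b) \<Rightarrow> ('a \<Rightarrow> 'c) \<Rightarrow> 'b \<Rightarrow> (('b \<times> 'b) set \<times> ('c \<times> 'c) set) set set" where
  "tf_amalg_in1 S S1 S2 \<phi>1 \<phi>2 x =
     tor_class (amalg_sum S S1 S2 \<phi>1 \<phi>2) (amalg_map S S1 S2 \<phi>1 \<phi>2 (x, \<one>\<^bsub>S2\<^esub>))"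

definition tf_amalg_in2 ::
  "('a, 'l) monoid_scheme \<Rightarrow> ('b, 'm) monoid_scheme \<Rightarrow> ('c, 'n) monoid_scheme \<Rightarrow>
   ('a \<Rightarrow> 'b) \<Rightarrow> ('a \<Rightarrow> 'c) \<Rightarrow> 'c \<Rightarrow> (('b \<times> 'b) set \<times> ('c \<times> 'c) set) set set" where
  "tf_amalg_in2 S S1 S2 \<phi>1 \<phi>2 y =
     tor_class (amalg_sum S S1 S2 \<phi>1 \<phi>2) (amalg_map S S1 S2 \<phi>1 \<phi>2 (\<one>\<^bsub>S1\<^esub>, y))"

text \<open>The canonical map from \<open>S\<close>; going through \<open>\<phi>2\<close> gives the same map.\<close>
definition tf_amalg_in ::
  "('a, 'l) monoid_scheme \<Rightarrow> ('b, 'm) monoid_scheme \<Rightarrow> ('c, 'n) monoid_scheme \<Rightarrow>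
   ('a \<Rightarrow> 'b) \<Rightarrow> ('a \<Rightarrow> 'c) \<Rightarrow> 'a \<Rightarrow> (('b \<times> 'b) set \<times> ('c \<times> 'c) set) set set" where
  "tf_amalg_in S S1 S2 \<phi>1 \<phi>2 s = tf_amalg_in1 S S1 S2 \<phi>1 \<phi>2 (\<phi>1 s)"


section \<open>Monoid rings\<close>

text \<open>An element is a finitely supported coefficient function, equal to \<open>\<zero>\<close> outside
  \<open>carrier M\<close>; the product is convolution.\<close>
definition monoid_algebra ::
  "('k, 'l) ring_scheme \<Rightarrow> ('a, 'm) monoid_scheme \<Rightarrow> ('k, 'a \<Rightarrow> 'k) module" where
  "monoid_algebra K M =
     \<lparr>carrier = {f. finite {x. f x \<noteq> \<zero>\<^bsub>K\<^esub>} \<and> {x. f x \<noteq> \<zero>\<^bsub>K\<^esub>} \<subseteq> carrier M \<and> range f \<subseteq> carrier K},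
      monoid.mult = (\<lambda>f g z. finsum K (\<lambda>(x, y). f x \<otimes>\<^bsub>K\<^esub> g y)
                        {(x, y). f x \<noteq> \<zero>\<^bsub>K\<^esub> \<and> g y \<noteq> \<zero>\<^bsub>K\<^esub> \<and> x \<otimes>\<^bsub>M\<^esub> y = z}),
      one = (\<lambda>x. if x = \<one>\<^bsub>M\<^esub> then \<one>\<^bsub>K\<^esub> else \<zero>\<^bsub>K\<^esub>),
      zero = (\<lambda>x. \<zero>\<^bsub>K\<^esub>),
      add = (\<lambda>f g x. f x \<oplus>\<^bsub>K\<^esub> g x),
      smult = (\<lambda>a f x. a \<otimes>\<^bsub>K\<^esub> f x)\<rparr>"

definition basis_elem :: "('k, 'l) ring_scheme \<Rightarrow> 'a \<Rightarrow> 'a \<Rightarrow> 'k" where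
  "basis_elem K x = (\<lambda>y. if y = x then \<one>\<^bsub>K\<^esub> else \<zero>\<^bsub>K\<^esub>)"

text \<open>The linear extension of a map \<open>h\<close> between the bases.\<close>
definition push_forward ::
  "('k, 'l) ring_scheme \<Rightarrow> ('a \<Rightarrow> 'b) \<Rightarrow> ('a \<Rightarrow> 'k) \<Rightarrow> 'b \<Rightarrow> 'k" where
  "push_forward K h f = (\<lambda>y. finsum K f {x. f x \<noteq> \<zero>\<^bsub>K\<^esub> \<and> h x = y})"

text \<open>The ring \<open>A\<close> as an algebra over the domain of a ring homomorphism \<open>h\<close> into \<open>A\<close>.\<close>
definition algebra_via ::
  "('r \<Rightarrow> 'a) \<Rightarrow> ('a, 'm) ring_scheme \<Rightarrow> ('r, 'a) module" where
  "algebra_via h A = \<lparr>carrier = carrier A, monoid.mult = monoid.mult A, one = one A, zero = zero A, add = add A,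
     smult = (\<lambda>r x. h r \<otimes>\<^bsub>A\<^esub> x)\<rparr>"

text \<open>\<open>K[N]\<close> as a \<open>K[M]\<close>-algebra, for a monoid homomorphism \<open>\<phi>\<close> from \<open>M\<close> to \<open>N\<close>.\<close>
definition monoid_algebra_via ::
  "('k, 'l) ring_scheme \<Rightarrow> ('a \<Rightarrow> 'b) \<Rightarrow> ('b, 'm) monoid_scheme \<Rightarrow> ('a \<Rightarrow> 'k, 'b \<Rightarrow> 'k) module" where
  "monoid_algebra_via K \<phi> N = algebra_via (push_forward K \<phi>) (monoid_algebra K N)"

definition is_algebra_iso ::
  "('r, 'l) ring_scheme \<Rightarrow> ('r, 'a, 'm) module_scheme \<Rightarrow> ('r, 'b, 'n) module_scheme \<Rightarrow> bool" where
  "is_algebra_iso R A B \<longleftrightarrow>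
     (\<exists>h\<in>ring_iso A B. \<forall>r\<in>carrier R. \<forall>a\<in>carrier A. h (r \<odot>\<^bsub>A\<^esub> a) = r \<odot>\<^bsub>B\<^esub> h a)"


section \<open>Tensor products and flatness\<close>

text \<open>The free \<open>R\<close>-module on \<open>carrier M \<times> carrier N\<close>, with the multiplication extending
  \<open>(m, n) (m', n') = (m m', n n')\<close>.\<close>
definition tensor_free ::
  "('r, 'l) ring_scheme \<Rightarrow> ('r, 'a, 'm) module_scheme \<Rightarrow> ('r, 'b, 'n) module_scheme \<Rightarrow>
   ('r, 'a \<times> 'b \<Rightarrow> 'r) module" where
  "tensor_free R M N = monoid_algebra R (M \<times>\<times> N)"

definition bilinear_relations ::
  "('r, 'l) ring_scheme \<Rightarrow> ('r, 'a, 'm) module_scheme \<Rightarrow> ('r, 'b, 'n) module_scheme \<Rightarrow>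
   ('a \<times> 'b \<Rightarrow> 'r) set" where
  "bilinear_relations R M N =
     (let F = tensor_free R M N; e = (\<lambda>m n. basis_elem R (m, n)) in
      {e (m \<oplus>\<^bsub>M\<^esub> m') n \<ominus>\<^bsub>F\<^esub> (e m n \<oplus>\<^bsub>F\<^esub> e m' n) | m m' n.
         m \<in> carrier M \<and> m' \<in> carrier M \<and> n \<in> carrier N} \<union>
      {e m (n \<oplus>\<^bsub>N\<^esub> n') \<ominus>\<^bsub>F\<^esub> (e m n \<oplus>\<^bsub>F\<^esub> e m n') | m n n'.
         m \<in> carrier M \<and> n \<in> carrier N \<and> n' \<in> carrier N} \<union>
      {e (r \<odot>\<^bsub>M\<^esub> m) n \<ominus>\<^bsub>F\<^esub> (r \<odot>\<^bsub>F\<^esub> e m n) | r m n.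
         r \<in> carrier R \<and> m \<in> carrier M \<and> n \<in> carrier N} \<union>
      {e m (r \<odot>\<^bsub>N\<^esub> n) \<ominus>\<^bsub>F\<^esub> (r \<odot>\<^bsub>F\<^esub> e m n) | r m n.
         r \<in> carrier R \<and> m \<in> carrier M \<and> n \<in> carrier N})"

definition tensor_kernel ::
  "('r, 'l) ring_scheme \<Rightarrow> ('r, 'a, 'm) module_scheme \<Rightarrow> ('r, 'b, 'n) module_scheme \<Rightarrow>
   ('a \<times> 'b \<Rightarrow> 'r) set" where
  "tensor_kernel R M N = \<Inter>{H. submodule H R (tensor_free R M N) \<and> bilinear_relations R M N \<subseteq> H}"

text \<open>For \<open>R\<close>-algebras this is the tensor product algebra.  If \<open>M\<close> and \<open>N\<close> are merely modules,
  their fields \<open>mult\<close> and \<open>one\<close> are arbitrary and so are those of the result; its module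
  structure does not depend on them.\<close>
definition tensor_prod ::
  "('r, 'l) ring_scheme \<Rightarrow> ('r, 'a, 'm) module_scheme \<Rightarrow> ('r, 'b, 'n) module_scheme \<Rightarrow>
   ('r, ('a \<times> 'b \<Rightarrow> 'r) set) module" where
  "tensor_prod R M N =
     (let F = tensor_free R M N; I = tensor_kernel R M N in
      \<lparr>carrier = a_rcosets\<^bsub>F\<^esub> I, monoid.mult = rcoset_mult F I, one = I +>\<^bsub>F\<^esub> \<one>\<^bsub>F\<^esub>,
       zero = I, add = set_add F,
       smult = (\<lambda>r X. \<Union>x\<in>X. I +>\<^bsub>F\<^esub> (r \<odot>\<^bsub>F\<^esub> x))\<rparr>)"

definition linear_maps ::
  "('r, 'l) ring_scheme \<Rightarrow> ('r, 'a, 'm) module_scheme \<Rightarrow> ('r, 'b, 'n) module_scheme \<Rightarrow>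
   ('a \<Rightarrow> 'b) set" where
  "linear_maps R M N = {f \<in> hom (add_monoid M) (add_monoid N).
     \<forall>r\<in>carrier R. \<forall>x\<in>carrier M. f (r \<odot>\<^bsub>M\<^esub> x) = r \<odot>\<^bsub>N\<^esub> f x}"

text \<open>The map \<open>f \<otimes> id\<close> into \<open>N \<otimes> P\<close> induced by a linear map \<open>f\<close> into \<open>N\<close>.\<close>
definition tensor_map ::
  "('r, 'l) ring_scheme \<Rightarrow> ('r, 'b, 'm) module_scheme \<Rightarrow> ('r, 'c, 'n) module_scheme \<Rightarrow>
   ('a \<Rightarrow> 'b) \<Rightarrow> ('a \<times> 'c \<Rightarrow> 'r) set \<Rightarrow> ('b \<times> 'c \<Rightarrow> 'r) set" where
  "tensor_map R N P f X =
     (\<Union>x\<in>X. tensor_kernel R N P +>\<^bsub>tensor_free R N P\<^esub> push_forward R (map_prod f id) x)"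

text \<open>Flatness: tensoring with \<open>P\<close> preserves injectivity of linear maps.  HOL cannot quantify
  over the types of the test modules \<open>M\<close>, \<open>N\<close> inside a formula, so a universe has to be fixed.
  The type \<open>(nat \<Rightarrow> 'r) set\<close> contains an isomorphic copy of every quotient of every \<open>R\<^sup>n\<close> (its
  elements being cosets of sequences vanishing from \<open>n\<close> on), i.e.\ of every finitely generated
  module.  As tensor products commute with directed unions, preserving injections between
  such modules is preserving all injections.\<close>
definition flat_module ::
  "('r, 'l) ring_scheme \<Rightarrow> ('r, 'c, 'n) module_scheme \<Rightarrow> bool" where
  "flat_module R P \<longleftrightarrow> module R P \<and>
     (\<forall>(M :: ('r, (nat \<Rightarrow> 'r) set) module) (N :: ('r, (nat \<Rightarrow> 'r) set) module) f.
        module R M \<and> module R N \<and> f \<in> linear_maps R M N \<and> inj_on f (carrier M) \<longrightarrow>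
        inj_on (tensor_map R N P f) (carrier (tensor_prod R M P)))"

end

theory Submission
  imports Defs
begin


text \<open>
  Write \<open>T\<close> for the torsion-free amalgamated sum and \<open>x + y\<close> for the image in \<open>T\<close> of a pair
  \<open>(x, y) \<in> S1 \<times> S2\<close>. Both algebras are spanned over \<open>K\<close> by such pairs: \<open>K[T]\<close> has the basis
  \<open>w\<^bsup>x + y\<^esup>\<close>, and the tensor product is spanned by the elements \<open>u\<^bsup>x\<^esup> \<otimes> v\<^bsup>y\<^esup>\<close>. The multiplication
  map \<open>u\<^bsup>x\<^esup> \<otimes> v\<^bsup>y\<^esup> \<mapsto> w\<^bsup>x + y\<^esup>\<close> is a surjective homomorphism of algebras, and it has an inverse as soon
  as \<open>u\<^bsup>x\<^esup> \<otimes> v\<^bsup>y\<^esup>\<close> depends on \<open>x + y\<close> only (\<open>amalgam_algebra_iso\<close>).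

  So let \<open>x + y = x' + y'\<close> in \<open>T\<close>. Then \<open>x - x' = y' - y\<close> lies in \<open>Grp S1\<close> and in \<open>Grp S2\<close>, hence equals
  \<open>s - t\<close> for some \<open>s\<close>, \<open>t\<close> in \<open>S\<close>. Since \<open>S1\<close> and \<open>S2\<close> embed into \<open>T\<close>, this means \<open>x + t = x' + s\<close> in \<open>S1\<close> and
  \<open>y + s = y' + t\<close> in \<open>S2\<close> (\<open>j_eq_imp_amalg_rel\<close>). Flatness turns the second equation into a common
  refinement: \<open>y = a + z\<close>, \<open>y' = b + z\<close> and \<open>s + a = t + b\<close> with \<open>a\<close>, \<open>b\<close> in \<open>S\<close> and \<open>z\<close> in \<open>S2\<close>
  (\<open>common_refinement\<close>). Cancellation in \<open>S1\<close> gives \<open>x + a = x' + b\<close>, and moving \<open>a\<close> and \<open>b\<close>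
  across the tensor sign yields
  \<open>u\<^bsup>x\<^esup> \<otimes> v\<^bsup>a + z\<^esup> = u\<^bsup>x + a\<^esup> \<otimes> v\<^bsup>z\<^esup> = u\<^bsup>x' + b\<^esup> \<otimes> v\<^bsup>z\<^esup> = u\<^bsup>x'\<^esup> \<otimes> v\<^bsup>b + z\<^esup>\<close>.

  The refinement is the equational criterion of flatness for a binomial relation. Let \<open>I\<close> be the
  ideal of \<open>K[S]\<close> generated by the monomials \<open>u\<^bsup>s\<^esup>\<close> and \<open>u\<^bsup>t\<^esup>\<close>. The elements \<open>u\<^bsup>s\<^esup> \<otimes> v\<^bsup>y\<^esup>\<close> and \<open>u\<^bsup>t\<^esup> \<otimes> v\<^bsup>y'\<^esup>\<close> of
  \<open>I \<otimes> K[S2]\<close> become equal in \<open>K[S] \<otimes> K[S2]\<close>, so by flatness they are equal in \<open>I \<otimes> K[S2]\<close>. If there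
  were no refinement, a balanced form would separate them: the coefficient of
  \<open>v\<^bsup>s + y\<^esup>\<close> in \<open>m' n\<close>, where \<open>m'\<close> is the part of \<open>m \<in> I\<close> supported on \<open>s + S\<close>.
\<close>

section \<open>Additive maps, submodules and algebras\<close>

lemma (in abelian_group) add_homI:
  assumes "abelian_group H" and "\<And>x. x \<in> carrier G \<Longrightarrow> h x \<in> carrier H"
    and "\<And>x y. x \<in> carrier G \<Longrightarrow> y \<in> carrier G \<Longrightarrow> h (x \<oplus> y) = h x \<oplus>\<^bsub>H\<^esub> h y"
  shows "abelian_group_hom G H h"
proof -
  interpret H: abelian_group H by fact
  show ?thesis
    by (rule abelian_group_homI)
      (auto intro!: group_hom.intro group_hom_axioms.intro homI abelian_group_axioms
        H.abelian_group_axioms add.is_group H.add.is_group assms)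
qed

lemma abelian_group_hom_comp:
  assumes "abelian_group_hom G H f" and "abelian_group_hom H L g"
  shows "abelian_group_hom G L (\<lambda>x. g (f x))"
proof -
  interpret f: abelian_group_hom G H f by fact
  interpret g: abelian_group_hom H L g by fact
  show ?thesis by (rule f.G.add_homI) (auto intro: g.H.abelian_group_axioms)
qed

lemma (in abelian_group) minus_eq_zero_iff:
  assumes "x \<in> carrier G" and "y \<in> carrier G"
  shows "x \<ominus> y = \<zero> \<longleftrightarrow> x = y"
  using assms by (metis a_minus_def add.inv_closed local.minus_minus minus_equality r_neg)

lemma comm_monoid_image:
  assumes "comm_monoid M" and carrier: "carrier N = h ` carrier M" and one: "\<one>\<^bsub>N\<^esub> = h \<one>\<^bsub>M\<^esub>"
    and mult: "\<And>x y. x \<in> carrier M \<Longrightarrow> y \<in> carrier M \<Longrightarrow> h x \<otimes>\<^bsub>N\<^esub> h y = h (x \<otimes>\<^bsub>M\<^esub> y)"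
  shows "comm_monoid N"
proof -
  interpret M: comm_monoid M by fact
  show ?thesis
    by (rule comm_monoidI) (auto simp: carrier one mult M.m_assoc intro!: arg_cong[of _ _ h] M.m_comm)
qed

lemma DirProd_comm_monoid:
  assumes "comm_monoid M" and "comm_monoid N"
  shows "comm_monoid (M \<times>\<times> N)"
proof -
  interpret M: comm_monoid M by fact
  interpret N: comm_monoid N by fact
  show ?thesis by (rule comm_monoidI) (auto simp: M.m_ac N.m_ac)
qed

lemma (in group) rcoset_eq_iff:
  assumes "subgroup H G" and "x \<in> carrier G" and "y \<in> carrier G"
  shows "H #> x = H #> y \<longleftrightarrow> (\<exists>h\<in>H. x = h \<otimes> y)"
proof
  assume "H #> x = H #> y"
  then have "x \<in> H #> y" using rcos_self[OF assms(2,1)] by simp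
  then show "\<exists>h\<in>H. x = h \<otimes> y" by (auto simp: r_coset_def)
next
  assume "\<exists>h\<in>H. x = h \<otimes> y"
  then have "x \<in> H #> y" by (auto simp: r_coset_def)
  then show "H #> x = H #> y" by (rule repr_independence[symmetric]) (use assms in auto)
qed

lemma (in cring) ideal_of_cringI:
  assumes "J \<subseteq> carrier R" and "\<zero> \<in> J" and "\<And>a b. a \<in> J \<Longrightarrow> b \<in> J \<Longrightarrow> a \<oplus> b \<in> J"
    and mult: "\<And>r a. r \<in> carrier R \<Longrightarrow> a \<in> J \<Longrightarrow> r \<otimes> a \<in> J"
  shows "ideal J R"
proof (rule idealI[OF ring_axioms])
  have "\<ominus> a \<in> J" if "a \<in> J" for a
    using mult[OF _ that, of "\<ominus> \<one>"] assms(1) that by (simp add: l_minus subset_iff)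
  then show "subgroup J (add_monoid R)"
    using assms by (intro add.subgroupI) (auto simp: a_inv_def)
  show "r \<otimes> a \<in> J" "a \<otimes> r \<in> J" if "a \<in> J" "r \<in> carrier R" for a r
    using mult[OF that(2,1)] m_comm[of a r] that assms(1) by auto
qed

lemma (in module) Inter_submodules:
  assumes "\<H> \<noteq> {}" and sub: "\<And>H. H \<in> \<H> \<Longrightarrow> submodule H R M"
  shows "submodule (\<Inter>\<H>) R M"
proof (rule submoduleI)
  note H = submoduleE[OF sub]
  show "\<Inter>\<H> \<subseteq> carrier M" using assms(1) H(1) by blast
  show "\<zero>\<^bsub>M\<^esub> \<in> \<Inter>\<H>"
    using subgroup.one_closed[OF submodule.axioms(1)[OF sub]] by simp
qed (use submoduleE[OF sub] in auto)

lemma algebra_via_cring: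
  assumes "cring A"
  shows "cring (algebra_via h A)"
proof -
  interpret A: cring A by fact
  show ?thesis
  proof (rule cringI)
    show "abelian_group (algebra_via h A)"
      by (rule abelian_groupI) (auto simp: algebra_via_def A.a_ac intro: A.add.l_inv_ex)
    show "comm_monoid (algebra_via h A)"
      by (rule comm_monoidI) (auto simp: algebra_via_def A.m_ac)
  qed (auto simp: algebra_via_def A.l_distr)
qed

lemma (in cring) algebra_via_module:
  assumes "cring A" and "h \<in> ring_hom R A"
  shows "module R (algebra_via h A)"
proof -
  interpret A: cring A by fact
  interpret h: ring_hom_cring R A h
    using assms(2) by (simp add: ring_hom_cring_def ring_hom_cring_axioms_def A.is_cring is_cring)
  interpret V: cring "algebra_via h A" by (rule algebra_via_cring) fact
  show ?thesis
    by (rule moduleI[OF is_cring V.abelian_group_axioms]) (auto simp: algebra_via_def A.l_distr A.r_distr A.m_assoc)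
qed

section \<open>Monoid rings\<close>

definition monomial :: "('k, 'l) ring_scheme \<Rightarrow> 'k \<Rightarrow> 'a \<Rightarrow> 'a \<Rightarrow> 'k" where
  "monomial K c x = (\<lambda>y. if y = x then c else \<zero>\<^bsub>K\<^esub>)"

lemma basis_elem_monomial: "basis_elem K x = monomial K \<one>\<^bsub>K\<^esub> x"
  by (simp add: basis_elem_def monomial_def)

lemma monoid_algebra_simps:
  "\<zero>\<^bsub>monoid_algebra K M\<^esub> = (\<lambda>x. \<zero>\<^bsub>K\<^esub>)"
  "f \<oplus>\<^bsub>monoid_algebra K M\<^esub> g = (\<lambda>x. f x \<oplus>\<^bsub>K\<^esub> g x)"
  "a \<odot>\<^bsub>monoid_algebra K M\<^esub> f = (\<lambda>x. a \<otimes>\<^bsub>K\<^esub> f x)"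
  "\<one>\<^bsub>monoid_algebra K M\<^esub> = monomial K \<one>\<^bsub>K\<^esub> \<one>\<^bsub>M\<^esub>"
  by (simp_all add: monoid_algebra_def monomial_def)

lemma monoid_algebra_carrier:
  "f \<in> carrier (monoid_algebra K M) \<longleftrightarrow>
     finite {x. f x \<noteq> \<zero>\<^bsub>K\<^esub>} \<and> {x. f x \<noteq> \<zero>\<^bsub>K\<^esub>} \<subseteq> carrier M \<and> (\<forall>x. f x \<in> carrier K)"
  by (auto simp: monoid_algebra_def)

lemma monoid_algebra_carrier_mono:
  assumes "f \<in> carrier (monoid_algebra K M)" and "carrier M \<subseteq> carrier N"
  shows "f \<in> carrier (monoid_algebra K N)"
  using assms unfolding monoid_algebra_carrier by (elim conjE) (intro conjI, assumption, erule order_trans)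

context cring
begin

lemma monomial_closed [simp]:
  "c \<in> carrier R \<Longrightarrow> x \<in> carrier M \<Longrightarrow> monomial R c x \<in> carrier (monoid_algebra R M)"
  by (auto simp: monoid_algebra_carrier monomial_def)

lemma coeff_closed [simp]: "f \<in> carrier (monoid_algebra R M) \<Longrightarrow> f x \<in> carrier R"
  by (simp add: monoid_algebra_carrier)

lemma monoid_algebra_add_closed:
  assumes "f \<in> carrier (monoid_algebra R M)" and "g \<in> carrier (monoid_algebra R M)"
  shows "(\<lambda>x. f x \<oplus> g x) \<in> carrier (monoid_algebra R M)"
proof -
  have "{x. f x \<oplus> g x \<noteq> \<zero>} \<subseteq> {x. f x \<noteq> \<zero>} \<union> {x. g x \<noteq> \<zero>}"
    by auto
  then have "finite {x. f x \<oplus> g x \<noteq> \<zero>}"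
    by (rule finite_subset) (use assms in \<open>simp add: monoid_algebra_carrier\<close>)
  then show ?thesis
    using assms \<open>_ \<subseteq> _\<close> unfolding monoid_algebra_carrier by (metis (no_types, lifting) Un_least a_closed order_trans)
qed

lemma monoid_algebra_smult_closed:
  assumes "a \<in> carrier R" and "f \<in> carrier (monoid_algebra R M)"
  shows "(\<lambda>x. a \<otimes> f x) \<in> carrier (monoid_algebra R M)"
proof -
  have "{x. a \<otimes> f x \<noteq> \<zero>} \<subseteq> {x. f x \<noteq> \<zero>}"
    using assms by auto
  with assms show ?thesis
    unfolding monoid_algebra_carrier by (auto elim: finite_subset[rotated])
qed

lemma monoid_algebra_uminus_closed:
  assumes "f \<in> carrier (monoid_algebra R M)"
  shows "(\<lambda>x. \<ominus> f x) \<in> carrier (monoid_algebra R M)"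
proof -
  have "{x. \<ominus> f x \<noteq> \<zero>} = {x. f x \<noteq> \<zero>}"
    using assms by (auto simp: monoid_algebra_carrier)
  with assms show ?thesis
    unfolding monoid_algebra_carrier by auto
qed

lemma monoid_algebra_abelian_group: "abelian_group (monoid_algebra R M)"
proof (rule abelian_groupI)
  fix f assume f: "f \<in> carrier (monoid_algebra R M)"
  then show "\<exists>g\<in>carrier (monoid_algebra R M). g \<oplus>\<^bsub>monoid_algebra R M\<^esub> f = \<zero>\<^bsub>monoid_algebra R M\<^esub>"
    by (intro bexI[OF _ monoid_algebra_uminus_closed[OF f]])
      (simp add: monoid_algebra_simps l_neg)
qed (simp_all add: monoid_algebra_simps monoid_algebra_add_closed a_assoc,
     simp_all add: monoid_algebra_carrier a_comm)

lemma monoid_algebra_module: "module R (monoid_algebra R M)"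
  by (rule moduleI)
    (auto simp: monoid_algebra_simps l_distr r_distr m_assoc is_cring monoid_algebra_abelian_group
      intro: monoid_algebra_smult_closed)

lemma monomial_add:
  "c \<in> carrier R \<Longrightarrow> d \<in> carrier R \<Longrightarrow>
    monomial R (c \<oplus> d) x = monomial R c x \<oplus>\<^bsub>monoid_algebra R M\<^esub> monomial R d x"
  by (auto simp: monomial_def monoid_algebra_simps)

text \<open>An additive statement about a monoid ring needs a proof for monomials only. Most identities below
  are multilinear and are reduced to this case, one argument at a time.\<close>
lemma monoid_algebra_induct [consumes 1, case_names monomial add zero]:
  assumes "f \<in> carrier (monoid_algebra R M)"
    and mon: "\<And>c x. c \<in> carrier R \<Longrightarrow> x \<in> carrier M \<Longrightarrow> P (monomial R c x)"
    and add: "\<And>f g. f \<in> carrier (monoid_algebra R M) \<Longrightarrow> g \<in> carrier (monoid_algebra R M) \<Longrightarrow>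
      P f \<Longrightarrow> P g \<Longrightarrow> P (f \<oplus>\<^bsub>monoid_algebra R M\<^esub> g)"
    and zero: "P \<zero>\<^bsub>monoid_algebra R M\<^esub>"
  shows "P f"
proof -
  have "\<forall>f\<in>carrier (monoid_algebra R M). {x. f x \<noteq> \<zero>} = A \<longrightarrow> P f" if "finite A" for A
    using that
  proof (induction A)
    case empty
    have "f = \<zero>\<^bsub>monoid_algebra R M\<^esub>" if "{x. f x \<noteq> \<zero>} = {}" for f
      using that by (auto simp: monoid_algebra_simps)
    then show ?case using zero by metis
  next
    case (insert x A)
    show ?case
    proof (intro ballI impI)
      fix f assume f: "f \<in> carrier (monoid_algebra R M)" and supp: "{x. f x \<noteq> \<zero>} = insert x A"
      have suppx: "{y. (f(x := \<zero>)) y \<noteq> \<zero>} = A"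
        using supp insert.hyps by auto
      then have fx: "f(x := \<zero>) \<in> carrier (monoid_algebra R M)"
        using f supp unfolding monoid_algebra_carrier by auto
      have x: "x \<in> carrier M" using f supp unfolding monoid_algebra_carrier by auto
      have "f = monomial R (f x) x \<oplus>\<^bsub>monoid_algebra R M\<^esub> f(x := \<zero>)"
        using f by (auto simp: monomial_def monoid_algebra_simps fun_eq_iff)
      moreover have "P (monomial R (f x) x \<oplus>\<^bsub>monoid_algebra R M\<^esub> f(x := \<zero>))"
        using f x fx suppx insert.IH by (intro add mon) auto
      ultimately show "P f" by simp
    qed
  qed
  moreover have "finite {x. f x \<noteq> \<zero>}"
    using assms(1) by (simp add: monoid_algebra_carrier)
  ultimately show ?thesis
    using assms(1) by simp
qed

lemma monoid_algebra_hom_eqI: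
  assumes "abelian_group_hom (monoid_algebra R M) A h" and "abelian_group_hom (monoid_algebra R M) A k"
    and "\<And>c x. c \<in> carrier R \<Longrightarrow> x \<in> carrier M \<Longrightarrow> h (monomial R c x) = k (monomial R c x)"
    and "f \<in> carrier (monoid_algebra R M)"
  shows "h f = k f"
proof -
  interpret h: abelian_group_hom "monoid_algebra R M" A h by fact
  interpret k: abelian_group_hom "monoid_algebra R M" A k by fact
  show ?thesis
    using assms(4) by (induction rule: monoid_algebra_induct) (auto simp: assms(3))
qed

end

definition lin_ext ::
  "('k, 'l) ring_scheme \<Rightarrow> ('b, 'm) ring_scheme \<Rightarrow> ('a \<Rightarrow> 'k \<Rightarrow> 'b) \<Rightarrow> ('a \<Rightarrow> 'k) \<Rightarrow> 'b" where
  "lin_ext K A \<psi> f = finsum A (\<lambda>x. \<psi> x (f x)) {x. f x \<noteq> \<zero>\<^bsub>K\<^esub>}"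

context cring
begin

lemma
  assumes "abelian_group A" and \<psi>: "\<And>x. x \<in> carrier M \<Longrightarrow> abelian_group_hom R A (\<psi> x)"
  shows lin_ext_hom: "abelian_group_hom (monoid_algebra R M) A (lin_ext R A \<psi>)"
    and lin_ext_monomial:
      "c \<in> carrier R \<Longrightarrow> x \<in> carrier M \<Longrightarrow> lin_ext R A \<psi> (monomial R c x) = \<psi> x c"
proof -
  interpret A: abelian_group A by fact
  interpret F: abelian_group "monoid_algebra R M" by (rule monoid_algebra_abelian_group)
  have \<psi>_closed: "\<psi> x c \<in> carrier A" if "x \<in> carrier M" "c \<in> carrier R" for x c
    using abelian_group_hom.hom_closed[OF \<psi>] that by auto
  have superset: "lin_ext R A \<psi> f = finsum A (\<lambda>x. \<psi> x (f x)) B"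
    if "f \<in> carrier (monoid_algebra R M)" "finite B" "{x. f x \<noteq> \<zero>} \<subseteq> B" "B \<subseteq> carrier M" for f B
    unfolding lin_ext_def
  proof (rule A.add.finprod_mono_neutral_cong_left)
    fix x assume "x \<in> B - {x. f x \<noteq> \<zero>}"
    with that show "\<psi> x (f x) = \<zero>\<^bsub>A\<^esub>"
      using abelian_group_hom.hom_zero[OF \<psi>] by auto
  qed (use that \<psi>_closed in \<open>auto intro: coeff_closed\<close>)
  show "abelian_group_hom (monoid_algebra R M) A (lin_ext R A \<psi>)"
  proof (rule F.add_homI[OF A.abelian_group_axioms])
    fix f assume f: "f \<in> carrier (monoid_algebra R M)"
    then have "{x. f x \<noteq> \<zero>} \<subseteq> carrier M" by (simp add: monoid_algebra_carrier)
    then show "lin_ext R A \<psi> f \<in> carrier A"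
      unfolding lin_ext_def using f by (intro A.finsum_closed) (auto intro!: \<psi>_closed)
    fix g assume g: "g \<in> carrier (monoid_algebra R M)"
    define B where "B = {x. f x \<noteq> \<zero>} \<union> {x. g x \<noteq> \<zero>}"
    have B: "finite B" "B \<subseteq> carrier M" using f g unfolding B_def monoid_algebra_carrier by auto
    have fB: "{x. f x \<noteq> \<zero>} \<subseteq> B" and gB: "{x. g x \<noteq> \<zero>} \<subseteq> B" unfolding B_def by auto
    have "lin_ext R A \<psi> (f \<oplus>\<^bsub>monoid_algebra R M\<^esub> g)
        = finsum A (\<lambda>x. \<psi> x ((f \<oplus>\<^bsub>monoid_algebra R M\<^esub> g) x)) B"
      using f g B by (intro superset) (auto simp: B_def monoid_algebra_simps intro: monoid_algebra_add_closed)
    also have "\<dots> = finsum A (\<lambda>x. \<psi> x (f x) \<oplus>\<^bsub>A\<^esub> \<psi> x (g x)) B"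
      using f g B by (intro A.finsum_cong')
        (auto simp: monoid_algebra_simps abelian_group_hom.hom_add[OF \<psi>] subset_iff intro!: \<psi>_closed)
    also have "\<dots> = finsum A (\<lambda>x. \<psi> x (f x)) B \<oplus>\<^bsub>A\<^esub> finsum A (\<lambda>x. \<psi> x (g x)) B"
      using f g B by (intro A.finsum_addf) (auto intro!: \<psi>_closed)
    also have "\<dots> = lin_ext R A \<psi> f \<oplus>\<^bsub>A\<^esub> lin_ext R A \<psi> g"
      using f g B by (simp add: superset[OF f _ fB] superset[OF g _ gB])
    finally show "lin_ext R A \<psi> (f \<oplus>\<^bsub>monoid_algebra R M\<^esub> g) = lin_ext R A \<psi> f \<oplus>\<^bsub>A\<^esub> lin_ext R A \<psi> g" .
  qed
  assume c: "c \<in> carrier R" and x: "x \<in> carrier M"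
  have "lin_ext R A \<psi> (monomial R c x) = finsum A (\<lambda>y. \<psi> y (monomial R c x y)) {x}"
    using c x by (intro superset monomial_closed) (auto simp: monomial_def)
  also have "\<dots> = \<psi> x c"
    using c x \<psi>_closed by (simp add: monomial_def)
  finally show "lin_ext R A \<psi> (monomial R c x) = \<psi> x c" .
qed

text \<open>The supports of \<open>f\<close>, \<open>g\<close> and \<open>f + g\<close> differ. Enlarging the range of summation to a common finite
  set makes the three sums comparable; the same device serves for convolution below.\<close>
lemma push_forward_superset:
  assumes "f \<in> carrier (monoid_algebra R M)" and "finite B" and "{x. f x \<noteq> \<zero>} \<subseteq> B"
  shows "push_forward R h f y = finsum R f {x \<in> B. h x = y}"
  unfolding push_forward_def using assms
  by (intro add.finprod_mono_neutral_cong_left) auto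

lemma push_forward_hom:
  assumes "h \<in> carrier M \<rightarrow> carrier N"
  shows "abelian_group_hom (monoid_algebra R M) (monoid_algebra R N) (push_forward R h)"
proof -
  interpret F: abelian_group "monoid_algebra R M" by (rule monoid_algebra_abelian_group)
  show ?thesis
  proof (rule F.add_homI[OF monoid_algebra_abelian_group])
    fix f assume f: "f \<in> carrier (monoid_algebra R M)"
    have "push_forward R h f y = \<zero>" if "y \<notin> h ` {x. f x \<noteq> \<zero>}" for y
    proof -
      have "{x. f x \<noteq> \<zero> \<and> h x = y} = {}" using that by auto
      then show ?thesis unfolding push_forward_def by (simp only: finsum_empty)
    qed
    then have "{y. push_forward R h f y \<noteq> \<zero>} \<subseteq> h ` {x. f x \<noteq> \<zero>}" by auto
    moreover have "finite (h ` {x. f x \<noteq> \<zero>})" "h ` {x. f x \<noteq> \<zero>} \<subseteq> carrier N"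
      using f assms by (auto simp: monoid_algebra_carrier)
    moreover have "push_forward R h f y \<in> carrier R" for y
      unfolding push_forward_def using f by (intro finsum_closed) auto
    ultimately show "push_forward R h f \<in> carrier (monoid_algebra R N)"
      unfolding monoid_algebra_carrier by (meson finite_subset order_trans)
    fix g assume g: "g \<in> carrier (monoid_algebra R M)"
    define B where "B = {x. f x \<noteq> \<zero>} \<union> {x. g x \<noteq> \<zero>}"
    have B: "finite B" using f g unfolding B_def monoid_algebra_carrier by auto
    have fB: "{x. f x \<noteq> \<zero>} \<subseteq> B" and gB: "{x. g x \<noteq> \<zero>} \<subseteq> B" unfolding B_def by auto
    have fg: "(\<lambda>x. f x \<oplus> g x) \<in> carrier (monoid_algebra R M)"
      using f g by (rule monoid_algebra_add_closed)
    have "push_forward R h (\<lambda>x. f x \<oplus> g x) y = push_forward R h f y \<oplus> push_forward R h g y" for y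
    proof -
      have "push_forward R h (\<lambda>x. f x \<oplus> g x) y = finsum R (\<lambda>x. f x \<oplus> g x) {x \<in> B. h x = y}"
        using B by (intro push_forward_superset[OF fg]) (auto simp: B_def)
      also have "\<dots> = finsum R f {x \<in> B. h x = y} \<oplus> finsum R g {x \<in> B. h x = y}"
        using f g by (intro finsum_addf) auto
      finally show ?thesis
        using B by (simp add: push_forward_superset[OF f _ fB] push_forward_superset[OF g _ gB])
    qed
    then show "push_forward R h (f \<oplus>\<^bsub>monoid_algebra R M\<^esub> g)
        = push_forward R h f \<oplus>\<^bsub>monoid_algebra R N\<^esub> push_forward R h g"
      by (simp add: monoid_algebra_simps fun_eq_iff)
  qed
qed

lemma push_forward_monomial:
  assumes "c \<in> carrier R"
  shows "push_forward R h (monomial R c x) = monomial R c (h x)"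
proof
  fix y
  \<comment> \<open>Push-forward does not refer to the monoid of its argument, so any carrier containing \<open>x\<close> will do.\<close>
  have "monomial R c x \<in> carrier (monoid_algebra R \<lparr>carrier = UNIV, monoid.mult = \<lambda>a b. a, one = x\<rparr>)"
    using assms by (intro monomial_closed) auto
  then have "push_forward R h (monomial R c x) y = finsum R (monomial R c x) {z \<in> {x}. h z = y}"
    by (rule push_forward_superset) (auto simp: monomial_def)
  also have "{z \<in> {x}. h z = y} = (if h x = y then {x} else {})" by auto
  finally show "push_forward R h (monomial R c x) y = monomial R c (h x) y"
    using assms by (auto simp: monomial_def)
qed

lemma monoid_algebra_mult_superset:
  assumes "f \<in> carrier (monoid_algebra R M)" and "finite A" and "{x. f x \<noteq> \<zero>} \<subseteq> A"
    and "g \<in> carrier (monoid_algebra R M)" and "finite B" and "{x. g x \<noteq> \<zero>} \<subseteq> B"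
  shows "(f \<otimes>\<^bsub>monoid_algebra R M\<^esub> g) z
    = finsum R (\<lambda>(x, y). f x \<otimes> g y) {(x, y) \<in> A \<times> B. x \<otimes>\<^bsub>M\<^esub> y = z}"
proof -
  have "finite {(x, y) \<in> A \<times> B. x \<otimes>\<^bsub>M\<^esub> y = z}"
    using assms by (auto intro: finite_subset[of _ "A \<times> B"])
  moreover have "f x \<in> carrier R" "g x \<in> carrier R" for x
    using assms(1,4) by auto
  ultimately have "finsum R (\<lambda>(x, y). f x \<otimes> g y) {(x, y). f x \<noteq> \<zero> \<and> g y \<noteq> \<zero> \<and> x \<otimes>\<^bsub>M\<^esub> y = z}
    = finsum R (\<lambda>(x, y). f x \<otimes> g y) {(x, y) \<in> A \<times> B. x \<otimes>\<^bsub>M\<^esub> y = z}"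
    using assms(3,6) by (intro add.finprod_mono_neutral_cong_left) auto
  then show ?thesis
    by (simp add: monoid_algebra_def[of R M])
qed

lemma monoid_algebra_mult_closed:
  assumes "comm_monoid M"
    and f: "f \<in> carrier (monoid_algebra R M)" and g: "g \<in> carrier (monoid_algebra R M)"
  shows "f \<otimes>\<^bsub>monoid_algebra R M\<^esub> g \<in> carrier (monoid_algebra R M)"
proof -
  interpret M: comm_monoid M by fact
  let ?A = "{x. f x \<noteq> \<zero>}" and ?B = "{x. g x \<noteq> \<zero>}"
  let ?C = "(\<lambda>(x, y). x \<otimes>\<^bsub>M\<^esub> y) ` (?A \<times> ?B)"
  note AB = f[unfolded monoid_algebra_carrier] g[unfolded monoid_algebra_carrier]
  have eq: "(f \<otimes>\<^bsub>monoid_algebra R M\<^esub> g) z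
      = finsum R (\<lambda>(x, y). f x \<otimes> g y) {(x, y) \<in> ?A \<times> ?B. x \<otimes>\<^bsub>M\<^esub> y = z}" for z
    using AB by (intro monoid_algebra_mult_superset f g) auto
  have "(f \<otimes>\<^bsub>monoid_algebra R M\<^esub> g) z = \<zero>" if "z \<notin> ?C" for z
  proof -
    have "{(x, y) \<in> ?A \<times> ?B. x \<otimes>\<^bsub>M\<^esub> y = z} = {}" using that by auto
    then show ?thesis unfolding eq by (simp only: finsum_empty)
  qed
  then have "{z. (f \<otimes>\<^bsub>monoid_algebra R M\<^esub> g) z \<noteq> \<zero>} \<subseteq> ?C" by auto
  moreover have "finite ?C" "?C \<subseteq> carrier M" using AB by auto
  moreover have "(f \<otimes>\<^bsub>monoid_algebra R M\<^esub> g) z \<in> carrier R" for z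
    unfolding eq using f g by (intro finsum_closed) auto
  ultimately show ?thesis
    unfolding monoid_algebra_carrier by (meson finite_subset order_trans)
qed

lemma monoid_algebra_l_distr:
  assumes f: "f \<in> carrier (monoid_algebra R M)" and g: "g \<in> carrier (monoid_algebra R M)"
    and h: "h \<in> carrier (monoid_algebra R M)"
  shows "(f \<oplus>\<^bsub>monoid_algebra R M\<^esub> g) \<otimes>\<^bsub>monoid_algebra R M\<^esub> h
    = f \<otimes>\<^bsub>monoid_algebra R M\<^esub> h \<oplus>\<^bsub>monoid_algebra R M\<^esub> g \<otimes>\<^bsub>monoid_algebra R M\<^esub> h"
proof
  fix z
  define A where "A = {x. f x \<noteq> \<zero>} \<union> {x. g x \<noteq> \<zero>}"
  define B where "B = {x. h x \<noteq> \<zero>}"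
  have AB: "finite A" "finite B" using f g h unfolding A_def B_def monoid_algebra_carrier by auto
  have fg: "(\<lambda>x. f x \<oplus> g x) \<in> carrier (monoid_algebra R M)"
    using f g by (rule monoid_algebra_add_closed)
  let ?P = "{(x, y) \<in> A \<times> B. x \<otimes>\<^bsub>M\<^esub> y = z}"
  have "((\<lambda>x. f x \<oplus> g x) \<otimes>\<^bsub>monoid_algebra R M\<^esub> h) z = finsum R (\<lambda>(x, y). (f x \<oplus> g x) \<otimes> h y) ?P"
    using AB by (intro monoid_algebra_mult_superset[OF fg _ _ h]) (auto simp: A_def B_def)
  also have "\<dots> = finsum R (\<lambda>p. (case p of (x, y) \<Rightarrow> f x \<otimes> h y) \<oplus> (case p of (x, y) \<Rightarrow> g x \<otimes> h y)) ?P"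
    using f g h by (intro finsum_cong') (auto simp: l_distr)
  also have "\<dots> = finsum R (\<lambda>(x, y). f x \<otimes> h y) ?P \<oplus> finsum R (\<lambda>(x, y). g x \<otimes> h y) ?P"
    using f g h by (intro finsum_addf) auto
  also have "\<dots> = (f \<otimes>\<^bsub>monoid_algebra R M\<^esub> h) z \<oplus> (g \<otimes>\<^bsub>monoid_algebra R M\<^esub> h) z"
    using AB by (simp add: monoid_algebra_mult_superset[OF f _ _ h, of A B]
        monoid_algebra_mult_superset[OF g _ _ h, of A B] A_def B_def)
  finally show "((f \<oplus>\<^bsub>monoid_algebra R M\<^esub> g) \<otimes>\<^bsub>monoid_algebra R M\<^esub> h) z
    = (f \<otimes>\<^bsub>monoid_algebra R M\<^esub> h \<oplus>\<^bsub>monoid_algebra R M\<^esub> g \<otimes>\<^bsub>monoid_algebra R M\<^esub> h) z"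
    by (simp add: monoid_algebra_simps)
qed

lemma monoid_algebra_m_comm:
  assumes "comm_monoid M"
    and f: "f \<in> carrier (monoid_algebra R M)" and g: "g \<in> carrier (monoid_algebra R M)"
  shows "f \<otimes>\<^bsub>monoid_algebra R M\<^esub> g = g \<otimes>\<^bsub>monoid_algebra R M\<^esub> f"
proof
  fix z
  interpret M: comm_monoid M by fact
  let ?P = "{(x, y). f x \<noteq> \<zero> \<and> g y \<noteq> \<zero> \<and> x \<otimes>\<^bsub>M\<^esub> y = z}"
  let ?Q = "{(x, y). g x \<noteq> \<zero> \<and> f y \<noteq> \<zero> \<and> x \<otimes>\<^bsub>M\<^esub> y = z}"
  have "?Q = prod.swap ` ?P"
    using f g unfolding monoid_algebra_carrier by (force simp: image_iff M.m_comm subset_iff)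
  then have "finsum R (\<lambda>(x, y). g x \<otimes> f y) ?Q = finsum R (\<lambda>p. case prod.swap p of (x, y) \<Rightarrow> g x \<otimes> f y) ?P"
    using f g by (simp only:) (intro finsum_reindex, auto)
  also have "\<dots> = finsum R (\<lambda>(x, y). f x \<otimes> g y) ?P"
    using f g by (intro finsum_cong') (auto simp: m_comm)
  finally show "(f \<otimes>\<^bsub>monoid_algebra R M\<^esub> g) z = (g \<otimes>\<^bsub>monoid_algebra R M\<^esub> f) z"
    by (simp add: monoid_algebra_def[of R M])
qed

lemma monomial_mult:
  assumes "c \<in> carrier R" and "d \<in> carrier R" and "x \<in> carrier M" and "y \<in> carrier M"
  shows "monomial R c x \<otimes>\<^bsub>monoid_algebra R M\<^esub> monomial R d y = monomial R (c \<otimes> d) (x \<otimes>\<^bsub>M\<^esub> y)"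
proof
  fix z
  have "(monomial R c x \<otimes>\<^bsub>monoid_algebra R M\<^esub> monomial R d y) z
      = finsum R (\<lambda>(a, b). monomial R c x a \<otimes> monomial R d y b) {(a, b) \<in> {x} \<times> {y}. a \<otimes>\<^bsub>M\<^esub> b = z}"
    using assms by (intro monoid_algebra_mult_superset monomial_closed) (auto simp: monomial_def)
  also have "{(a, b) \<in> {x} \<times> {y}. a \<otimes>\<^bsub>M\<^esub> b = z} = (if x \<otimes>\<^bsub>M\<^esub> y = z then {(x, y)} else {})"
    by auto
  finally show "(monomial R c x \<otimes>\<^bsub>monoid_algebra R M\<^esub> monomial R d y) z
      = monomial R (c \<otimes> d) (x \<otimes>\<^bsub>M\<^esub> y) z"
    using assms by (auto simp: monomial_def)
qed

lemma monoid_algebra_r_distr: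
  assumes "comm_monoid M" and f: "f \<in> carrier (monoid_algebra R M)"
    and g: "g \<in> carrier (monoid_algebra R M)" and h: "h \<in> carrier (monoid_algebra R M)"
  shows "h \<otimes>\<^bsub>monoid_algebra R M\<^esub> (f \<oplus>\<^bsub>monoid_algebra R M\<^esub> g)
    = h \<otimes>\<^bsub>monoid_algebra R M\<^esub> f \<oplus>\<^bsub>monoid_algebra R M\<^esub> h \<otimes>\<^bsub>monoid_algebra R M\<^esub> g"
proof -
  interpret F: abelian_group "monoid_algebra R M" by (rule monoid_algebra_abelian_group)
  show ?thesis
    using assms by (simp add: monoid_algebra_m_comm[of M h] monoid_algebra_l_distr)
qed

text \<open>Associativity is additive in each of the three factors, so it is inherited from the monoid by way of
  monomials.\<close>
lemma monoid_algebra_cring: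
  assumes "comm_monoid M"
  shows "cring (monoid_algebra R M)"
proof -
  interpret M: comm_monoid M by fact
  interpret F: abelian_group "monoid_algebra R M" by (rule monoid_algebra_abelian_group)
  note closed = monoid_algebra_mult_closed[OF assms]
  have r_hom: "abelian_group_hom (monoid_algebra R M) (monoid_algebra R M)
      (\<lambda>g. f \<otimes>\<^bsub>monoid_algebra R M\<^esub> g)" if "f \<in> carrier (monoid_algebra R M)" for f
    using that by (intro F.add_homI monoid_algebra_abelian_group closed monoid_algebra_r_distr assms)
  have l_hom: "abelian_group_hom (monoid_algebra R M) (monoid_algebra R M)
      (\<lambda>g. g \<otimes>\<^bsub>monoid_algebra R M\<^esub> f)" if "f \<in> carrier (monoid_algebra R M)" for f
    using that by (intro F.add_homI monoid_algebra_abelian_group closed monoid_algebra_l_distr assms)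
  have id_hom: "abelian_group_hom (monoid_algebra R M) (monoid_algebra R M) (\<lambda>g. g)"
    by (intro F.add_homI monoid_algebra_abelian_group) auto
  note comp = abelian_group_hom_comp
  have assoc3: "f \<otimes>\<^bsub>monoid_algebra R M\<^esub> g \<otimes>\<^bsub>monoid_algebra R M\<^esub> h
      = f \<otimes>\<^bsub>monoid_algebra R M\<^esub> (g \<otimes>\<^bsub>monoid_algebra R M\<^esub> h)"
    if f: "f \<in> carrier (monoid_algebra R M)" and g: "g \<in> carrier (monoid_algebra R M)"
      and h: "h \<in> carrier (monoid_algebra R M)" for f g h
  proof (rule monoid_algebra_hom_eqI[OF _ _ _ f])
    fix c x assume cx: "c \<in> carrier R" "x \<in> carrier M"
    show "monomial R c x \<otimes>\<^bsub>monoid_algebra R M\<^esub> g \<otimes>\<^bsub>monoid_algebra R M\<^esub> h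
      = monomial R c x \<otimes>\<^bsub>monoid_algebra R M\<^esub> (g \<otimes>\<^bsub>monoid_algebra R M\<^esub> h)"
    proof (rule monoid_algebra_hom_eqI[OF _ _ _ g])
      fix d y assume dy: "d \<in> carrier R" "y \<in> carrier M"
      show "monomial R c x \<otimes>\<^bsub>monoid_algebra R M\<^esub> monomial R d y \<otimes>\<^bsub>monoid_algebra R M\<^esub> h
        = monomial R c x \<otimes>\<^bsub>monoid_algebra R M\<^esub> (monomial R d y \<otimes>\<^bsub>monoid_algebra R M\<^esub> h)"
      proof (rule monoid_algebra_hom_eqI[OF _ _ _ h])
        fix e z assume "e \<in> carrier R" "z \<in> carrier M"
        then show "monomial R c x \<otimes>\<^bsub>monoid_algebra R M\<^esub> monomial R d y \<otimes>\<^bsub>monoid_algebra R M\<^esub> monomial R e z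
          = monomial R c x \<otimes>\<^bsub>monoid_algebra R M\<^esub> (monomial R d y \<otimes>\<^bsub>monoid_algebra R M\<^esub> monomial R e z)"
          using cx dy by (simp add: monomial_mult m_assoc M.m_assoc)
      qed (use cx dy in \<open>auto intro!: r_hom closed comp[OF r_hom[of "monomial R d y"] r_hom[of "monomial R c x"]]\<close>)
    qed (use cx h in \<open>auto intro!: comp[OF r_hom[of "monomial R c x"] l_hom[of h]]
          comp[OF l_hom[of h] r_hom[of "monomial R c x"]]\<close>)
  qed (use g h in \<open>auto intro!: closed l_hom comp[OF l_hom[of g] l_hom[of h]]\<close>)
  have one: "\<one>\<^bsub>monoid_algebra R M\<^esub> \<otimes>\<^bsub>monoid_algebra R M\<^esub> f = f"
    if f: "f \<in> carrier (monoid_algebra R M)" for f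
    by (rule monoid_algebra_hom_eqI[OF r_hom id_hom _ f])
      (auto simp: monoid_algebra_simps monomial_mult)
  show ?thesis
  proof (rule cringI)
    show "comm_monoid (monoid_algebra R M)"
    proof (rule comm_monoidI)
      show "\<one>\<^bsub>monoid_algebra R M\<^esub> \<in> carrier (monoid_algebra R M)"
        by (simp add: monoid_algebra_simps(4))
    qed (simp_all add: assoc3 one closed, rule monoid_algebra_m_comm[OF assms])
  qed (auto intro: monoid_algebra_abelian_group monoid_algebra_l_distr)
qed

lemma monoid_algebra_ring_homI:
  assumes "comm_monoid M" and "cring A" and h: "abelian_group_hom (monoid_algebra R M) A h"
    and one: "h (monomial R \<one> \<one>\<^bsub>M\<^esub>) = \<one>\<^bsub>A\<^esub>"
    and mult: "\<And>c d x y. c \<in> carrier R \<Longrightarrow> d \<in> carrier R \<Longrightarrow> x \<in> carrier M \<Longrightarrow> y \<in> carrier M \<Longrightarrow>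
      h (monomial R (c \<otimes> d) (x \<otimes>\<^bsub>M\<^esub> y)) = h (monomial R c x) \<otimes>\<^bsub>A\<^esub> h (monomial R d y)"
  shows "h \<in> ring_hom (monoid_algebra R M) A"
proof -
  interpret F: cring "monoid_algebra R M" by (rule monoid_algebra_cring) fact
  interpret A: cring A by fact
  interpret h: abelian_group_hom "monoid_algebra R M" A h by fact
  have mono: "h (monomial R c x \<otimes>\<^bsub>monoid_algebra R M\<^esub> g) = h (monomial R c x) \<otimes>\<^bsub>A\<^esub> h g"
    if "c \<in> carrier R" "x \<in> carrier M" and g: "g \<in> carrier (monoid_algebra R M)" for c x g
    using g that
    by (induction rule: monoid_algebra_induct) (auto simp: monomial_mult mult F.r_distr A.r_distr)
  have "h (f \<otimes>\<^bsub>monoid_algebra R M\<^esub> g) = h f \<otimes>\<^bsub>A\<^esub> h g"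
    if f: "f \<in> carrier (monoid_algebra R M)" and g: "g \<in> carrier (monoid_algebra R M)" for f g
    using f g
    by (induction rule: monoid_algebra_induct) (auto simp: mono F.l_distr A.l_distr)
  then show ?thesis
    by (intro ring_hom_memI) (auto simp: monoid_algebra_simps(4) one)
qed

lemma push_forward_ring_hom:
  assumes "comm_monoid M" and "comm_monoid N" and "h \<in> monoid_hom M N"
  shows "push_forward R h \<in> ring_hom (monoid_algebra R M) (monoid_algebra R N)"
proof -
  interpret M: comm_monoid M by fact
  have h: "h \<in> carrier M \<rightarrow> carrier N" "h \<one>\<^bsub>M\<^esub> = \<one>\<^bsub>N\<^esub>"
    "\<And>x y. x \<in> carrier M \<Longrightarrow> y \<in> carrier M \<Longrightarrow> h (x \<otimes>\<^bsub>M\<^esub> y) = h x \<otimes>\<^bsub>N\<^esub> h y"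
    using assms(3) by (auto simp: monoid_hom_def hom_def)
  show ?thesis
  proof (rule monoid_algebra_ring_homI[OF assms(1) monoid_algebra_cring[OF assms(2)]])
    fix c d x y assume *: "c \<in> carrier R" "d \<in> carrier R" "x \<in> carrier M" "y \<in> carrier M"
    moreover from this have "h x \<in> carrier N" "h y \<in> carrier N" using h by auto
    ultimately show "push_forward R h (monomial R (c \<otimes> d) (x \<otimes>\<^bsub>M\<^esub> y))
      = push_forward R h (monomial R c x) \<otimes>\<^bsub>monoid_algebra R N\<^esub> push_forward R h (monomial R d y)"
      by (simp add: push_forward_monomial monomial_mult h)
  qed (auto simp: push_forward_monomial h monoid_algebra_simps intro!: push_forward_hom h(1))
qed

text \<open>The universal property of the monoid ring: a homomorphism is given by its values \<open>\<alpha>\<close> on coefficients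
  and \<open>\<beta>\<close> on monomials.\<close>
lemma
  assumes "comm_monoid M" and "cring A" and "\<alpha> \<in> ring_hom R A" and "\<beta> \<in> monoid_hom M A"
  shows lin_ext_ring_hom: "lin_ext R A (\<lambda>x c. \<alpha> c \<otimes>\<^bsub>A\<^esub> \<beta> x) \<in> ring_hom (monoid_algebra R M) A"
    and lin_ext_ring_hom_monomial: "c \<in> carrier R \<Longrightarrow> x \<in> carrier M \<Longrightarrow>
      lin_ext R A (\<lambda>x c. \<alpha> c \<otimes>\<^bsub>A\<^esub> \<beta> x) (monomial R c x) = \<alpha> c \<otimes>\<^bsub>A\<^esub> \<beta> x"
proof -
  interpret M: comm_monoid M by fact
  interpret A: cring A by fact
  interpret \<alpha>: ring_hom_cring R A \<alpha>
    using assms(3) by (simp add: ring_hom_cring_def ring_hom_cring_axioms_def A.is_cring is_cring)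
  have \<beta>: "\<And>x. x \<in> carrier M \<Longrightarrow> \<beta> x \<in> carrier A" "\<beta> \<one>\<^bsub>M\<^esub> = \<one>\<^bsub>A\<^esub>"
    "\<And>x y. x \<in> carrier M \<Longrightarrow> y \<in> carrier M \<Longrightarrow> \<beta> (x \<otimes>\<^bsub>M\<^esub> y) = \<beta> x \<otimes>\<^bsub>A\<^esub> \<beta> y"
    using assms(4) by (auto simp: monoid_hom_def hom_def)
  have hom: "abelian_group_hom R A (\<lambda>c. \<alpha> c \<otimes>\<^bsub>A\<^esub> \<beta> x)" if "x \<in> carrier M" for x
    using that by (intro add_homI A.abelian_group_axioms) (auto simp: \<beta> A.l_distr)
  note mono = lin_ext_monomial[OF A.abelian_group_axioms hom]
  show "lin_ext R A (\<lambda>x c. \<alpha> c \<otimes>\<^bsub>A\<^esub> \<beta> x) \<in> ring_hom (monoid_algebra R M) A"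
    by (rule monoid_algebra_ring_homI[OF assms(1,2) lin_ext_hom[OF A.abelian_group_axioms hom]])
      (auto simp: mono \<beta> A.m_ac)
  show "lin_ext R A (\<lambda>x c. \<alpha> c \<otimes>\<^bsub>A\<^esub> \<beta> x) (monomial R c x) = \<alpha> c \<otimes>\<^bsub>A\<^esub> \<beta> x"
    if "c \<in> carrier R" "x \<in> carrier M"
    using that by (simp add: mono)
qed

end

section \<open>Tensor products\<close>

text \<open>The tensor product is used through the cosets \<open>m \<otimes> n\<close> of the free generators, called
  \<open>pure_tensor m n\<close>. In the quotient the defining relations become bilinearity.\<close>
locale tensor_modules = M: module R M + N: module R N for R (structure) and M and N
begin

abbreviation "F \<equiv> tensor_free R M N"
abbreviation "I \<equiv> tensor_kernel R M N"
abbreviation "Ten \<equiv> tensor_prod R M N"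

definition cls where "cls f = I +>\<^bsub>F\<^esub> f"

definition pure_tensor where "pure_tensor m n = cls (basis_elem R (m, n))"

sublocale F: module R F
  unfolding tensor_free_def by (rule M.R.monoid_algebra_module)

lemma basis_elem_closed: "m \<in> carrier M \<Longrightarrow> n \<in> carrier N \<Longrightarrow> basis_elem R (m, n) \<in> carrier F"
  unfolding basis_elem_monomial tensor_free_def by (rule M.R.monomial_closed) auto

lemma bilinear_relations_closed: "bilinear_relations R M N \<subseteq> carrier F"
  unfolding bilinear_relations_def Let_def
  by (auto intro!: F.M.minus_closed F.M.add.m_closed basis_elem_closed F.smult_closed)

lemma tensor_kernel_submodule: "submodule I R F"
  unfolding tensor_kernel_def
  using F.carrier_is_submodule bilinear_relations_closed by (intro F.Inter_submodules) auto

lemma bilinear_relations_tensor_kernel: "bilinear_relations R M N \<subseteq> I"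
  unfolding tensor_kernel_def by blast

lemma tensor_kernel_least: "submodule H R F \<Longrightarrow> bilinear_relations R M N \<subseteq> H \<Longrightarrow> I \<subseteq> H"
  unfolding tensor_kernel_def by blast

sublocale I: abelian_subgroup I F
  by (rule abelian_subgroupI3)
    (auto intro: additive_subgroup.intro submodule.axioms(1)[OF tensor_kernel_submodule] F.M.abelian_group_axioms)

lemma carrier_Ten: "carrier Ten = cls ` carrier F"
  by (auto simp: tensor_prod_def Let_def A_RCOSETS_def' cls_def)

lemma cls_add: "f \<in> carrier F \<Longrightarrow> g \<in> carrier F \<Longrightarrow> cls f \<oplus>\<^bsub>Ten\<^esub> cls g = cls (f \<oplus>\<^bsub>F\<^esub> g)"
  using I.a_rcos_sum by (simp add: cls_def tensor_prod_def Let_def)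

lemma zero_Ten: "\<zero>\<^bsub>Ten\<^esub> = cls \<zero>\<^bsub>F\<^esub>"
  using F.M.a_coset_add_zero[OF I.a_subset] by (simp add: cls_def tensor_prod_def Let_def)

lemma Ten_abelian_group: "abelian_group Ten"
proof (rule abelian_groupI)
  fix X assume "X \<in> carrier Ten"
  then obtain f where f: "f \<in> carrier F" "X = cls f" by (auto simp: carrier_Ten)
  then have "cls (\<ominus>\<^bsub>F\<^esub> f) \<oplus>\<^bsub>Ten\<^esub> X = \<zero>\<^bsub>Ten\<^esub>"
    by (simp add: cls_add zero_Ten F.M.l_neg)
  then show "\<exists>Y\<in>carrier Ten. Y \<oplus>\<^bsub>Ten\<^esub> X = \<zero>\<^bsub>Ten\<^esub>"
    using f by (auto simp: carrier_Ten)
qed (auto simp: carrier_Ten cls_add zero_Ten F.M.a_ac)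

sublocale cls: abelian_group_hom F Ten cls
  by (rule F.M.add_homI[OF Ten_abelian_group]) (auto simp: carrier_Ten cls_add)

lemma cls_eq_zero_iff: "f \<in> carrier F \<Longrightarrow> cls f = \<zero>\<^bsub>Ten\<^esub> \<longleftrightarrow> f \<in> I"
  using I.a_rcos_self[of f] I.a_rcos_const[of f] by (auto simp: cls_def tensor_prod_def Let_def)

lemma cls_eqI:
  assumes "f \<ominus>\<^bsub>F\<^esub> g \<in> bilinear_relations R M N" and "f \<in> carrier F" and "g \<in> carrier F"
  shows "cls f = cls g"
proof -
  have "cls f \<ominus>\<^bsub>Ten\<^esub> cls g = cls (f \<ominus>\<^bsub>F\<^esub> g)"
    using assms(2,3) by (simp add: a_minus_def)
  also have "\<dots> = \<zero>\<^bsub>Ten\<^esub>"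
    using assms bilinear_relations_tensor_kernel by (subst cls_eq_zero_iff) auto
  finally show ?thesis
    using assms(2,3) by (simp add: cls.H.minus_eq_zero_iff)
qed

lemma smult_cls:
  assumes "r \<in> carrier R" and "f \<in> carrier F"
  shows "r \<odot>\<^bsub>Ten\<^esub> cls f = cls (r \<odot>\<^bsub>F\<^esub> f)"
proof -
  have "cls (r \<odot>\<^bsub>F\<^esub> x) = cls (r \<odot>\<^bsub>F\<^esub> f)" if x: "x \<in> cls f" for x
  proof -
    from x obtain i where i: "i \<in> I" "x = i \<oplus>\<^bsub>F\<^esub> f"
      by (auto simp: cls_def a_r_coset_def')
    have "i \<in> carrier F" using i by simp
    moreover have "r \<odot>\<^bsub>F\<^esub> i \<in> I" using i assms submodule.smult_closed[OF tensor_kernel_submodule] by simp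
    then have "cls (r \<odot>\<^bsub>F\<^esub> i) = \<zero>\<^bsub>Ten\<^esub>" by (simp add: cls_eq_zero_iff)
    ultimately show ?thesis
      using assms by (simp add: i F.smult_r_distr)
  qed
  moreover have "f \<in> cls f" unfolding cls_def using assms by (simp add: I.a_rcos_self)
  ultimately have "(\<Union>x\<in>cls f. cls (r \<odot>\<^bsub>F\<^esub> x)) = cls (r \<odot>\<^bsub>F\<^esub> f)" by blast
  then show ?thesis by (simp add: tensor_prod_def Let_def cls_def)
qed

lemma pure_closed: "m \<in> carrier M \<Longrightarrow> n \<in> carrier N \<Longrightarrow> pure_tensor m n \<in> carrier Ten"
  by (simp add: pure_tensor_def basis_elem_closed)

lemma bilinear_relationsI:
  shows "m \<in> carrier M \<Longrightarrow> m' \<in> carrier M \<Longrightarrow> n \<in> carrier N \<Longrightarrow>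
      basis_elem R (m \<oplus>\<^bsub>M\<^esub> m', n) \<ominus>\<^bsub>F\<^esub> (basis_elem R (m, n) \<oplus>\<^bsub>F\<^esub> basis_elem R (m', n)) \<in> bilinear_relations R M N"
    and "m \<in> carrier M \<Longrightarrow> n \<in> carrier N \<Longrightarrow> n' \<in> carrier N \<Longrightarrow>
      basis_elem R (m, n \<oplus>\<^bsub>N\<^esub> n') \<ominus>\<^bsub>F\<^esub> (basis_elem R (m, n) \<oplus>\<^bsub>F\<^esub> basis_elem R (m, n')) \<in> bilinear_relations R M N"
    and "r \<in> carrier R \<Longrightarrow> m \<in> carrier M \<Longrightarrow> n \<in> carrier N \<Longrightarrow>
      basis_elem R (r \<odot>\<^bsub>M\<^esub> m, n) \<ominus>\<^bsub>F\<^esub> r \<odot>\<^bsub>F\<^esub> basis_elem R (m, n) \<in> bilinear_relations R M N"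
    and "r \<in> carrier R \<Longrightarrow> m \<in> carrier M \<Longrightarrow> n \<in> carrier N \<Longrightarrow>
      basis_elem R (m, r \<odot>\<^bsub>N\<^esub> n) \<ominus>\<^bsub>F\<^esub> r \<odot>\<^bsub>F\<^esub> basis_elem R (m, n) \<in> bilinear_relations R M N"
  unfolding bilinear_relations_def Let_def by blast+

lemma pure_add_left:
  assumes "m \<in> carrier M" "m' \<in> carrier M" "n \<in> carrier N"
  shows "pure_tensor (m \<oplus>\<^bsub>M\<^esub> m') n = pure_tensor m n \<oplus>\<^bsub>Ten\<^esub> pure_tensor m' n"
proof -
  have "cls (basis_elem R (m \<oplus>\<^bsub>M\<^esub> m', n)) = cls (basis_elem R (m, n) \<oplus>\<^bsub>F\<^esub> basis_elem R (m', n))"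
    using assms by (intro cls_eqI) (auto intro!: bilinear_relationsI basis_elem_closed)
  with assms show ?thesis by (simp add: pure_tensor_def basis_elem_closed)
qed

lemma pure_add_right:
  assumes "m \<in> carrier M" "n \<in> carrier N" "n' \<in> carrier N"
  shows "pure_tensor m (n \<oplus>\<^bsub>N\<^esub> n') = pure_tensor m n \<oplus>\<^bsub>Ten\<^esub> pure_tensor m n'"
proof -
  have "cls (basis_elem R (m, n \<oplus>\<^bsub>N\<^esub> n')) = cls (basis_elem R (m, n) \<oplus>\<^bsub>F\<^esub> basis_elem R (m, n'))"
    using assms by (intro cls_eqI) (auto intro!: bilinear_relationsI basis_elem_closed)
  with assms show ?thesis by (simp add: pure_tensor_def basis_elem_closed)
qed

lemma pure_smult_left:
  assumes "r \<in> carrier R" "m \<in> carrier M" "n \<in> carrier N"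
  shows "pure_tensor (r \<odot>\<^bsub>M\<^esub> m) n = cls (r \<odot>\<^bsub>F\<^esub> basis_elem R (m, n))"
  unfolding pure_tensor_def using assms
  by (intro cls_eqI) (auto intro!: bilinear_relationsI basis_elem_closed)

lemma pure_smult_right:
  assumes "r \<in> carrier R" "m \<in> carrier M" "n \<in> carrier N"
  shows "pure_tensor m (r \<odot>\<^bsub>N\<^esub> n) = cls (r \<odot>\<^bsub>F\<^esub> basis_elem R (m, n))"
  unfolding pure_tensor_def using assms
  by (intro cls_eqI) (auto intro!: bilinear_relationsI basis_elem_closed)

lemma pure_balanced:
  assumes "r \<in> carrier R" "m \<in> carrier M" "n \<in> carrier N"
  shows "pure_tensor (r \<odot>\<^bsub>M\<^esub> m) n = pure_tensor m (r \<odot>\<^bsub>N\<^esub> n)"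
  using assms by (simp add: pure_smult_left pure_smult_right)

lemma smult_basis_elem: "r \<in> carrier R \<Longrightarrow> r \<odot>\<^bsub>F\<^esub> basis_elem R p = monomial R r p"
  by (auto simp: tensor_free_def monoid_algebra_simps basis_elem_def monomial_def)

lemma cls_monomial:
  assumes "r \<in> carrier R" "m \<in> carrier M" "n \<in> carrier N"
  shows "cls (monomial R r (m, n)) = pure_tensor (r \<odot>\<^bsub>M\<^esub> m) n"
  using assms by (simp add: pure_smult_left smult_basis_elem)

text \<open>To kill the four families of relations is to be bilinear on the free generators.\<close>
lemma hom_bilinear_relations:
  assumes "abelian_group_hom F A \<theta>"
    and add1: "\<And>m m' n. m \<in> carrier M \<Longrightarrow> m' \<in> carrier M \<Longrightarrow> n \<in> carrier N \<Longrightarrow>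
      \<theta> (basis_elem R (m \<oplus>\<^bsub>M\<^esub> m', n)) = \<theta> (basis_elem R (m, n)) \<oplus>\<^bsub>A\<^esub> \<theta> (basis_elem R (m', n))"
    and add2: "\<And>m n n'. m \<in> carrier M \<Longrightarrow> n \<in> carrier N \<Longrightarrow> n' \<in> carrier N \<Longrightarrow>
      \<theta> (basis_elem R (m, n \<oplus>\<^bsub>N\<^esub> n')) = \<theta> (basis_elem R (m, n)) \<oplus>\<^bsub>A\<^esub> \<theta> (basis_elem R (m, n'))"
    and smult1: "\<And>r m n. r \<in> carrier R \<Longrightarrow> m \<in> carrier M \<Longrightarrow> n \<in> carrier N \<Longrightarrow>
      \<theta> (basis_elem R (r \<odot>\<^bsub>M\<^esub> m, n)) = \<theta> (monomial R r (m, n))"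
    and smult2: "\<And>r m n. r \<in> carrier R \<Longrightarrow> m \<in> carrier M \<Longrightarrow> n \<in> carrier N \<Longrightarrow>
      \<theta> (basis_elem R (m, r \<odot>\<^bsub>N\<^esub> n)) = \<theta> (monomial R r (m, n))"
    and f: "f \<in> bilinear_relations R M N"
  shows "\<theta> f = \<zero>\<^bsub>A\<^esub>"
proof -
  interpret \<theta>: abelian_group_hom F A \<theta> by fact
  have zero: "\<theta> (g \<ominus>\<^bsub>F\<^esub> h) = \<zero>\<^bsub>A\<^esub>" if "g \<in> carrier F" "h \<in> carrier F" "\<theta> g = \<theta> h" for g h
    using that by (simp add: a_minus_def \<theta>.H.r_neg)
  note closed = basis_elem_closed F.M.add.m_closed F.smult_closed M.M.add.m_closed N.M.add.m_closed
    M.smult_closed N.smult_closed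
  from f show ?thesis
    unfolding bilinear_relations_def Let_def Un_iff mem_Collect_eq
  proof (elim disjE exE conjE)
    fix m m' n assume *: "m \<in> carrier M" "m' \<in> carrier M" "n \<in> carrier N"
      and f: "f = basis_elem R (m \<oplus>\<^bsub>M\<^esub> m', n) \<ominus>\<^bsub>F\<^esub> (basis_elem R (m, n) \<oplus>\<^bsub>F\<^esub> basis_elem R (m', n))"
    show ?thesis unfolding f using * by (intro zero closed) (simp_all add: add1 closed)
  next
    fix m n n' assume *: "m \<in> carrier M" "n \<in> carrier N" "n' \<in> carrier N"
      and f: "f = basis_elem R (m, n \<oplus>\<^bsub>N\<^esub> n') \<ominus>\<^bsub>F\<^esub> (basis_elem R (m, n) \<oplus>\<^bsub>F\<^esub> basis_elem R (m, n'))"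
    show ?thesis unfolding f using * by (intro zero closed) (simp_all add: add2 closed)
  next
    fix r m n assume *: "r \<in> carrier R" "m \<in> carrier M" "n \<in> carrier N"
      and f: "f = basis_elem R (r \<odot>\<^bsub>M\<^esub> m, n) \<ominus>\<^bsub>F\<^esub> r \<odot>\<^bsub>F\<^esub> basis_elem R (m, n)"
    show ?thesis unfolding f using * by (intro zero closed) (simp_all add: smult1 smult_basis_elem)
  next
    fix r m n assume *: "r \<in> carrier R" "m \<in> carrier M" "n \<in> carrier N"
      and f: "f = basis_elem R (m, r \<odot>\<^bsub>N\<^esub> n) \<ominus>\<^bsub>F\<^esub> r \<odot>\<^bsub>F\<^esub> basis_elem R (m, n)"
    show ?thesis unfolding f using * by (intro zero closed) (simp_all add: smult2 smult_basis_elem)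
  qed
qed

text \<open>To tell two pure tensors apart, a biadditive balanced map with distinct values at them is enough.
  Its target is merely an abelian group, so the kernel of the additive extension \<open>\<Phi>\<close> of \<open>\<beta>\<close> to the free module need not be a
  submodule; the argument runs with the largest submodule contained in it.\<close>
lemma balanced_map_pure_eq:
  assumes "abelian_group A"
    and closed: "\<And>m n. m \<in> carrier M \<Longrightarrow> n \<in> carrier N \<Longrightarrow> \<beta> m n \<in> carrier A"
    and add1: "\<And>m m' n. m \<in> carrier M \<Longrightarrow> m' \<in> carrier M \<Longrightarrow> n \<in> carrier N \<Longrightarrow>
      \<beta> (m \<oplus>\<^bsub>M\<^esub> m') n = \<beta> m n \<oplus>\<^bsub>A\<^esub> \<beta> m' n"
    and add2: "\<And>m n n'. m \<in> carrier M \<Longrightarrow> n \<in> carrier N \<Longrightarrow> n' \<in> carrier N \<Longrightarrow>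
      \<beta> m (n \<oplus>\<^bsub>N\<^esub> n') = \<beta> m n \<oplus>\<^bsub>A\<^esub> \<beta> m n'"
    and balanced: "\<And>r m n. r \<in> carrier R \<Longrightarrow> m \<in> carrier M \<Longrightarrow> n \<in> carrier N \<Longrightarrow>
      \<beta> (r \<odot>\<^bsub>M\<^esub> m) n = \<beta> m (r \<odot>\<^bsub>N\<^esub> n)"
    and mn: "m \<in> carrier M" "n \<in> carrier N" "m' \<in> carrier M" "n' \<in> carrier N"
    and eq: "pure_tensor m n = pure_tensor m' n'"
  shows "\<beta> m n = \<beta> m' n'"
proof -
  interpret A: abelian_group A by fact
  define \<psi> where "\<psi> = (\<lambda>(m, n) r. \<beta> (r \<odot>\<^bsub>M\<^esub> m) n)"
  define \<Phi> where "\<Phi> = lin_ext R A \<psi>"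
  have \<psi>: "abelian_group_hom R A (\<psi> p)" if "p \<in> carrier (M \<times>\<times> N)" for p
    using that by (intro M.R.add_homI A.abelian_group_axioms)
      (auto simp: \<psi>_def M.smult_l_distr closed add1)
  interpret \<Phi>: abelian_group_hom F A \<Phi>
    unfolding \<Phi>_def tensor_free_def by (intro M.R.lin_ext_hom A.abelian_group_axioms \<psi>)
  have \<Phi>_monomial: "\<Phi> (monomial R r (m, n)) = \<beta> (r \<odot>\<^bsub>M\<^esub> m) n"
    if "r \<in> carrier R" "m \<in> carrier M" "n \<in> carrier N" for r m n
    unfolding \<Phi>_def using that
    by (subst M.R.lin_ext_monomial[where M = "M \<times>\<times> N", OF A.abelian_group_axioms \<psi>]) (auto simp: \<psi>_def)
  let ?H = "{f \<in> carrier F. \<forall>r\<in>carrier R. \<Phi> (r \<odot>\<^bsub>F\<^esub> f) = \<zero>\<^bsub>A\<^esub>}"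
  have "submodule ?H R F"
    by (rule F.submoduleI)
      (auto simp: F.smult_r_minus F.smult_r_distr simp flip: F.smult_assoc1)
  moreover have "bilinear_relations R M N \<subseteq> ?H"
  proof (intro subsetI CollectI conjI ballI)
    fix f r assume f: "f \<in> bilinear_relations R M N" and r: "r \<in> carrier R"
    have hom: "abelian_group_hom F A (\<lambda>f. \<Phi> (r \<odot>\<^bsub>F\<^esub> f))"
      using r by (intro F.M.add_homI A.abelian_group_axioms) (auto simp: F.smult_r_distr)
    have mon: "r \<odot>\<^bsub>F\<^esub> monomial R r' (m, n) = monomial R (r \<otimes> r') (m, n)"
      if "r' \<in> carrier R" for r' m n
      using r that by (auto simp: tensor_free_def monoid_algebra_simps monomial_def)
    have basis: "\<Phi> (r \<odot>\<^bsub>F\<^esub> basis_elem R (m, n)) = \<beta> (r \<odot>\<^bsub>M\<^esub> m) n"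
      if "m \<in> carrier M" "n \<in> carrier N" for m n
      using r that by (simp add: basis_elem_monomial mon \<Phi>_monomial)
    show "\<Phi> (r \<odot>\<^bsub>F\<^esub> f) = \<zero>\<^bsub>A\<^esub>"
    proof (rule hom_bilinear_relations[OF hom _ _ _ _ f])
      fix r' m n assume *: "r' \<in> carrier R" "m \<in> carrier M" "n \<in> carrier N"
      have "\<Phi> (r \<odot>\<^bsub>F\<^esub> monomial R r' (m, n)) = \<beta> ((r \<otimes> r') \<odot>\<^bsub>M\<^esub> m) n"
        using r * by (simp add: mon \<Phi>_monomial)
      moreover have "(r \<otimes> r') \<odot>\<^bsub>M\<^esub> m = r \<odot>\<^bsub>M\<^esub> (r' \<odot>\<^bsub>M\<^esub> m)"
        using r * by (intro M.smult_assoc1)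
      moreover have "(r \<otimes> r') \<odot>\<^bsub>M\<^esub> m = r' \<odot>\<^bsub>M\<^esub> (r \<odot>\<^bsub>M\<^esub> m)"
        using r * by (subst M.R.m_comm) (auto intro: M.smult_assoc1)
      ultimately show
        "\<Phi> (r \<odot>\<^bsub>F\<^esub> basis_elem R (r' \<odot>\<^bsub>M\<^esub> m, n)) = \<Phi> (r \<odot>\<^bsub>F\<^esub> monomial R r' (m, n))"
        "\<Phi> (r \<odot>\<^bsub>F\<^esub> basis_elem R (m, r' \<odot>\<^bsub>N\<^esub> n)) = \<Phi> (r \<odot>\<^bsub>F\<^esub> monomial R r' (m, n))"
        using r * balanced[of r' "r \<odot>\<^bsub>M\<^esub> m" n] by (simp_all add: basis)
    qed (use r in \<open>simp_all add: basis M.smult_r_distr add1 add2\<close>)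
  qed (use bilinear_relations_closed in auto)
  ultimately have sub: "I \<subseteq> ?H" by (rule tensor_kernel_least)
  let ?f = "basis_elem R (m, n)" and ?g = "basis_elem R (m', n')"
  have fg: "?f \<in> carrier F" "?g \<in> carrier F" using mn by (auto intro: basis_elem_closed)
  have "cls (?f \<ominus>\<^bsub>F\<^esub> ?g) = \<zero>\<^bsub>Ten\<^esub>"
    using eq fg by (simp add: pure_tensor_def a_minus_def cls.H.r_neg)
  then have "?f \<ominus>\<^bsub>F\<^esub> ?g \<in> ?H"
    using fg sub by (auto simp: cls_eq_zero_iff)
  then have "\<Phi> (\<one> \<odot>\<^bsub>F\<^esub> (?f \<ominus>\<^bsub>F\<^esub> ?g)) = \<zero>\<^bsub>A\<^esub>" by blast
  then have "\<Phi> ?f \<ominus>\<^bsub>A\<^esub> \<Phi> ?g = \<zero>\<^bsub>A\<^esub>"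
    using fg by (simp add: a_minus_def)
  then have "\<Phi> ?f = \<Phi> ?g"
    using fg by (simp add: A.minus_eq_zero_iff)
  then show ?thesis using mn by (simp add: basis_elem_monomial \<Phi>_monomial)
qed

end

text \<open>A ring homomorphism \<open>\<Psi>\<close> on the free module that kills the relations descends to the tensor product.
  A map \<open>\<tau>\<close> that takes \<open>\<Psi> f\<close> back to the class of \<open>f\<close> shows that nothing more is killed, so the
  tensor kernel is the kernel of \<open>\<Psi>\<close>. In particular it is an ideal, and \<open>\<tau>\<close> inherits its compatibility
  with all operations from \<open>\<Psi>\<close>.\<close>
lemma tensor_prod_isoI:
  assumes "tensor_modules R A B" and "comm_monoid A" and "comm_monoid B"
    and C: "cring C" and \<Psi>: "\<Psi> \<in> ring_hom (tensor_free R A B) C"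
    and surj: "carrier C \<subseteq> \<Psi> ` carrier (tensor_free R A B)"
    and linear: "\<And>r f. r \<in> carrier R \<Longrightarrow> f \<in> carrier (tensor_free R A B) \<Longrightarrow>
      \<Psi> (r \<odot>\<^bsub>tensor_free R A B\<^esub> f) = r \<odot>\<^bsub>C\<^esub> \<Psi> f"
    and smult_zero: "\<And>r. r \<in> carrier R \<Longrightarrow> r \<odot>\<^bsub>C\<^esub> \<zero>\<^bsub>C\<^esub> = \<zero>\<^bsub>C\<^esub>"
    and rel: "\<And>f. f \<in> bilinear_relations R A B \<Longrightarrow> \<Psi> f = \<zero>\<^bsub>C\<^esub>"
    and \<tau>: "\<And>f. f \<in> carrier (tensor_free R A B) \<Longrightarrow> \<tau> (\<Psi> f) = tensor_modules.cls R A B f"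
  shows "is_algebra_iso R C (tensor_prod R A B)"
proof -
  interpret tensor_modules R A B by fact
  interpret C: cring C by fact
  interpret Fr: cring F
    unfolding tensor_free_def by (intro M.R.monoid_algebra_cring DirProd_comm_monoid assms)
  interpret \<Psi>: ring_hom_ring F C \<Psi>
    by (rule ring_hom_ringI2[OF Fr.ring_axioms C.ring_axioms \<Psi>])
  let ?Z = "{f \<in> carrier F. \<Psi> f = \<zero>\<^bsub>C\<^esub>}"
  have "submodule ?Z R F"
    by (rule F.submoduleI) (auto simp: linear smult_zero)
  then have I_sub: "I \<subseteq> ?Z"
    using rel bilinear_relations_closed by (intro tensor_kernel_least) auto
  have \<tau>_inj: "f \<in> I" if "f \<in> carrier F" "\<tau> (\<Psi> f) = \<zero>\<^bsub>Ten\<^esub>" for f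
    using that \<tau> cls_eq_zero_iff by simp
  have Z: "?Z \<subseteq> I"
  proof
    fix f assume f: "f \<in> ?Z"
    have "\<tau> (\<Psi> f) = \<tau> (\<Psi> \<zero>\<^bsub>F\<^esub>)" using f by simp
    also have "\<dots> = \<zero>\<^bsub>Ten\<^esub>" by (subst \<tau>) auto
    finally show "f \<in> I" using f \<tau>_inj by simp
  qed
  have IZ: "I = ?Z"
    by (rule subset_antisym[OF I_sub Z])
  have ideal: "ideal I F"
    using \<Psi>.kernel_is_ideal unfolding a_kernel_def' IZ .
  have obt: "\<exists>f\<in>carrier F. g = \<Psi> f" if "g \<in> carrier C" for g
    using that surj by auto
  have hom: "\<tau> \<in> ring_hom C Ten"
  proof (rule ring_hom_memI)
    fix g assume "g \<in> carrier C"
    then obtain f where f: "f \<in> carrier F" "g = \<Psi> f" using obt by blast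
    then show "\<tau> g \<in> carrier Ten" by (simp add: \<tau>)
    fix g' assume "g' \<in> carrier C"
    then obtain f' where f': "f' \<in> carrier F" "g' = \<Psi> f'" using obt by blast
    have "\<tau> (g \<otimes>\<^bsub>C\<^esub> g') = \<tau> (\<Psi> (f \<otimes>\<^bsub>F\<^esub> f'))" using f f' by simp
    also have "\<dots> = cls (f \<otimes>\<^bsub>F\<^esub> f')" using f f' by (intro \<tau>) simp
    also have "\<dots> = \<tau> g \<otimes>\<^bsub>Ten\<^esub> \<tau> g'"
      using f f' ideal.rcoset_mult_add[OF ideal, of f f'] by (simp add: \<tau> cls_def tensor_prod_def Let_def)
    finally show "\<tau> (g \<otimes>\<^bsub>C\<^esub> g') = \<tau> g \<otimes>\<^bsub>Ten\<^esub> \<tau> g'" .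
    have "\<tau> (g \<oplus>\<^bsub>C\<^esub> g') = \<tau> (\<Psi> (f \<oplus>\<^bsub>F\<^esub> f'))" using f f' by simp
    also have "\<dots> = \<tau> g \<oplus>\<^bsub>Ten\<^esub> \<tau> g'"
      using f f' by (subst \<tau>) (auto simp: \<tau>)
    finally show "\<tau> (g \<oplus>\<^bsub>C\<^esub> g') = \<tau> g \<oplus>\<^bsub>Ten\<^esub> \<tau> g'" .
  next
    have "\<tau> \<one>\<^bsub>C\<^esub> = \<tau> (\<Psi> \<one>\<^bsub>F\<^esub>)" by simp
    also have "\<dots> = \<one>\<^bsub>Ten\<^esub>" by (subst \<tau>) (auto simp: cls_def tensor_prod_def Let_def)
    finally show "\<tau> \<one>\<^bsub>C\<^esub> = \<one>\<^bsub>Ten\<^esub>" .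
  qed
  have "inj_on \<tau> (carrier C)"
  proof (rule inj_onI)
    fix g g' assume "g \<in> carrier C" "g' \<in> carrier C" and eq: "\<tau> g = \<tau> g'"
    then obtain f f' where f: "f \<in> carrier F" "g = \<Psi> f" "f' \<in> carrier F" "g' = \<Psi> f'"
      using obt by metis
    have "\<tau> (\<Psi> (f \<ominus>\<^bsub>F\<^esub> f')) = cls f \<ominus>\<^bsub>Ten\<^esub> cls f'"
      using f by (subst \<tau>) (auto simp: a_minus_def)
    also have "\<dots> = \<zero>\<^bsub>Ten\<^esub>"
      using f eq \<tau> by (simp add: cls.H.minus_eq_zero_iff)
    finally have "f \<ominus>\<^bsub>F\<^esub> f' \<in> I" using f by (intro \<tau>_inj) auto
    then have "\<Psi> (f \<ominus>\<^bsub>F\<^esub> f') = \<zero>\<^bsub>C\<^esub>" using I_sub by auto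
    then have "\<Psi> f \<ominus>\<^bsub>C\<^esub> \<Psi> f' = \<zero>\<^bsub>C\<^esub>" using f by (simp add: a_minus_def)
    then show "g = g'" using f by (simp add: C.minus_eq_zero_iff)
  qed
  moreover have "\<tau> ` carrier C = carrier Ten"
  proof -
    have "carrier C = \<Psi> ` carrier F" using surj by auto
    then show ?thesis unfolding carrier_Ten by (auto simp: image_image \<tau>)
  qed
  moreover have "\<tau> (r \<odot>\<^bsub>C\<^esub> g) = r \<odot>\<^bsub>Ten\<^esub> \<tau> g" if "r \<in> carrier R" "g \<in> carrier C" for r g
  proof -
    obtain f where f: "f \<in> carrier F" "g = \<Psi> f" using obt \<open>g \<in> carrier C\<close> by blast
    have "\<tau> (r \<odot>\<^bsub>C\<^esub> g) = \<tau> (\<Psi> (r \<odot>\<^bsub>F\<^esub> f))" using f that by (simp add: linear)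
    also have "\<dots> = r \<odot>\<^bsub>Ten\<^esub> \<tau> g" using f that by (subst \<tau>) (auto simp: \<tau> smult_cls)
    finally show ?thesis .
  qed
  ultimately show ?thesis
    unfolding is_algebra_iso_def ring_iso_def bij_betw_def
    using hom by (intro bexI[of _ \<tau>]) simp_all
qed

section \<open>Flatness over a monoid ring\<close>

text \<open>The test modules in the definition of flatness have the carrier type \<open>(nat \<Rightarrow> 'r) set\<close>. An element
  \<open>r\<close> of the ring is encoded as the singleton of the constant sequence \<open>r\<close>.\<close>
definition enc :: "'r \<Rightarrow> (nat \<Rightarrow> 'r) set" where "enc r = {\<lambda>_. r}"

definition dec :: "(nat \<Rightarrow> 'r) set \<Rightarrow> 'r" where "dec X = the_elem X 0"

lemma dec_enc [simp]: "dec (enc r) = r"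
  by (simp add: enc_def dec_def)

text \<open>An ideal of \<open>R\<close> as a module of this type, with the operations transported along \<open>enc\<close>.\<close>
definition enc_ideal :: "('r, 'l) ring_scheme \<Rightarrow> 'r set \<Rightarrow> ('r, (nat \<Rightarrow> 'r) set) module" where
  "enc_ideal R J = \<lparr>carrier = enc ` J, monoid.mult = (\<lambda>X Y. X), one = enc \<zero>\<^bsub>R\<^esub>, zero = enc \<zero>\<^bsub>R\<^esub>,
     add = (\<lambda>X Y. enc (dec X \<oplus>\<^bsub>R\<^esub> dec Y)), smult = (\<lambda>r X. enc (r \<otimes>\<^bsub>R\<^esub> dec X))\<rparr>"

lemma (in cring) enc_ideal_module:
  assumes "ideal J R"
  shows "module R (enc_ideal R J)"
proof -
  interpret J: ideal J R by fact
  have grp: "abelian_group (enc_ideal R J)"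
  proof (rule abelian_groupI)
    fix X assume "X \<in> carrier (enc_ideal R J)"
    then obtain x where "x \<in> J" "X = enc x" by (auto simp: enc_ideal_def)
    then show "\<exists>Y\<in>carrier (enc_ideal R J). Y \<oplus>\<^bsub>enc_ideal R J\<^esub> X = \<zero>\<^bsub>enc_ideal R J\<^esub>"
      by (intro bexI[of _ "enc (\<ominus> x)"]) (auto simp: enc_ideal_def l_neg)
  qed (auto simp: enc_ideal_def a_ac)
  show ?thesis
    by (rule moduleI[OF is_cring grp])
      (auto simp: enc_ideal_def l_distr r_distr m_assoc J.I_l_closed)
qed

text \<open>Flatness applied to the inclusion of an ideal \<open>J\<close> into the ring. The two free modules share their
  operations, so the map induced by the inclusion takes the coset of a generator to the coset of the
  same generator.\<close>
lemma (in cring) flat_ideal_pure_eq: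
  assumes flat: "flat_module R P" and "ideal J R"
    and m: "m \<in> J" "m' \<in> J" and x: "x \<in> carrier P" "x' \<in> carrier P"
    and eq: "tensor_modules.pure_tensor R (enc_ideal R (carrier R)) P (enc m) x
      = tensor_modules.pure_tensor R (enc_ideal R (carrier R)) P (enc m') x'"
  shows "tensor_modules.pure_tensor R (enc_ideal R J) P (enc m) x
      = tensor_modules.pure_tensor R (enc_ideal R J) P (enc m') x'"
proof -
  interpret J: ideal J R by fact
  let ?M = "enc_ideal R J" and ?N = "enc_ideal R (carrier R)"
  have P: "module R P" using flat by (simp add: flat_module_def)
  have MN: "module R ?M" "module R ?N"
    by (auto intro: enc_ideal_module oneideal J.is_ideal)
  interpret TM: tensor_modules R ?M P by (intro tensor_modules.intro MN P)
  interpret TN: tensor_modules R ?N P by (intro tensor_modules.intro MN P)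
  have ops: "\<zero>\<^bsub>TM.F\<^esub> = \<zero>\<^bsub>TN.F\<^esub>" "f \<oplus>\<^bsub>TM.F\<^esub> g = f \<oplus>\<^bsub>TN.F\<^esub> g" "r \<odot>\<^bsub>TM.F\<^esub> f = r \<odot>\<^bsub>TN.F\<^esub> f" for f g r
    by (simp_all add: tensor_free_def monoid_algebra_simps)
  have ops': "X \<oplus>\<^bsub>?M\<^esub> Y = X \<oplus>\<^bsub>?N\<^esub> Y" "r \<odot>\<^bsub>?M\<^esub> X = r \<odot>\<^bsub>?N\<^esub> X" for X Y r
    by (simp_all add: enc_ideal_def)
  have sub: "carrier ?M \<subseteq> carrier ?N" by (auto simp: enc_ideal_def)
  then have prod_sub: "carrier (?M \<times>\<times> P) \<subseteq> carrier (?N \<times>\<times> P)" by auto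
  have Fsub: "f \<in> carrier TN.F" if "f \<in> carrier TM.F" for f
    using that prod_sub unfolding tensor_free_def by (rule monoid_algebra_carrier_mono)
  interpret c: abelian_group_hom TM.F TN.Ten TN.cls
    using Fsub by (intro TM.F.M.add_homI TN.Ten_abelian_group) (auto simp: ops)
  have kernel_sub: "TM.I \<subseteq> {f \<in> carrier TM.F. TN.cls f = \<zero>\<^bsub>TN.Ten\<^esub>}"
  proof (rule TM.tensor_kernel_least)
    have TN_smult: "TN.cls (r \<odot>\<^bsub>TM.F\<^esub> f) = \<zero>\<^bsub>TN.Ten\<^esub>"
      if "r \<in> carrier R" "f \<in> carrier TM.F" "TN.cls f = \<zero>\<^bsub>TN.Ten\<^esub>" for r f
      using that Fsub submodule.smult_closed[OF TN.tensor_kernel_submodule]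
      by (simp add: ops TN.cls_eq_zero_iff)
    show "submodule {f \<in> carrier TM.F. TN.cls f = \<zero>\<^bsub>TN.Ten\<^esub>} R TM.F"
      by (rule TM.F.submoduleI) (auto simp: TN_smult)
    show "bilinear_relations R ?M P \<subseteq> {f \<in> carrier TM.F. TN.cls f = \<zero>\<^bsub>TN.Ten\<^esub>}"
    proof (intro subsetI CollectI conjI)
      fix f assume f: "f \<in> bilinear_relations R ?M P"
      show "TN.cls f = \<zero>\<^bsub>TN.Ten\<^esub>"
      proof (rule TM.hom_bilinear_relations[OF c.abelian_group_hom_axioms _ _ _ _ f])
      qed (use sub in \<open>simp_all add: ops' subset_iff TN.cls_monomial TN.pure_add_left TN.pure_add_right
            TN.pure_balanced flip: TN.pure_tensor_def\<close>)
    qed (use TM.bilinear_relations_closed in auto)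
  qed
  have push: "push_forward R (map_prod id id) f = f" if "f \<in> carrier TM.F" for f
  proof
    fix p
    have "{q. f q \<noteq> \<zero> \<and> map_prod id id q = p} = (if f p = \<zero> then {} else {p})" by auto
    moreover have "f p \<in> carrier R" using that unfolding tensor_free_def by (rule coeff_closed)
    ultimately show "push_forward R (map_prod id id) f p = f p"
      by (simp add: push_forward_def)
  qed
  have tensor_map: "tensor_map R ?N P id (TM.cls f) = TN.cls f" if f: "f \<in> carrier TM.F" for f
  proof -
    have eq: "TN.cls (push_forward R (map_prod id id) g) = TN.cls f" if "g \<in> TM.cls f" for g
    proof -
      from that obtain i where i: "i \<in> TM.I" "g = i \<oplus>\<^bsub>TM.F\<^esub> f"
        unfolding TM.cls_def a_r_coset_def' by blast
      then have "i \<in> carrier TM.F" "TN.cls i = \<zero>\<^bsub>TN.Ten\<^esub>" using kernel_sub by blast+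
      then show ?thesis using f by (simp add: i push)
    qed
    moreover have "f \<in> TM.cls f" unfolding TM.cls_def using f by (simp add: TM.I.a_rcos_self)
    ultimately have "(\<Union>g\<in>TM.cls f. TN.cls (push_forward R (map_prod id id) g)) = TN.cls f" by blast
    then show ?thesis by (simp add: tensor_map_def TN.cls_def)
  qed
  have "id \<in> linear_maps R ?M ?N"
    using sub by (auto simp: linear_maps_def hom_def ops')
  then have inj: "inj_on (tensor_map R ?N P id) (carrier TM.Ten)"
    using flat MN inj_on_id unfolding flat_module_def by blast
  have e: "basis_elem R (enc m, x) \<in> carrier TM.F" "basis_elem R (enc m', x') \<in> carrier TM.F"
    using m x by (simp_all add: enc_ideal_def TM.basis_elem_closed[unfolded enc_ideal_def])
  show ?thesis
    using inj_onD[OF inj, of "TM.pure_tensor (enc m) x" "TM.pure_tensor (enc m') x'"] eq e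
    by (simp add: TM.pure_tensor_def TN.pure_tensor_def tensor_map)
qed

locale flat_monoid_algebra = K: cring K + S: comm_monoid_cancel S + S2: comm_monoid_cancel S2
  for K :: "('k, 'l) ring_scheme" and S :: "('a, 'm) monoid_scheme" and S2 :: "('c, 'n) monoid_scheme" +
  fixes \<phi> :: "'a \<Rightarrow> 'c"
  assumes \<phi>: "\<phi> \<in> monoid_hom S S2"
    and nontrivial: "\<one>\<^bsub>K\<^esub> \<noteq> \<zero>\<^bsub>K\<^esub>"
    and flat: "flat_module (monoid_algebra K S) (monoid_algebra_via K \<phi> S2)"
begin

abbreviation "R \<equiv> monoid_algebra K S"
abbreviation "A2 \<equiv> monoid_algebra K S2"
abbreviation "P \<equiv> monoid_algebra_via K \<phi> S2"

lemma \<phi>_simps [simp]: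
  "s \<in> carrier S \<Longrightarrow> \<phi> s \<in> carrier S2" "\<phi> \<one>\<^bsub>S\<^esub> = \<one>\<^bsub>S2\<^esub>"
  "s \<in> carrier S \<Longrightarrow> t \<in> carrier S \<Longrightarrow> \<phi> (s \<otimes>\<^bsub>S\<^esub> t) = \<phi> s \<otimes>\<^bsub>S2\<^esub> \<phi> t"
  using \<phi> by (auto simp: monoid_hom_def hom_def)

sublocale R: cring R
  by (rule K.monoid_algebra_cring) (rule S.comm_monoid_axioms)

sublocale A2: cring A2
  by (rule K.monoid_algebra_cring) (rule S2.comm_monoid_axioms)

lemma push_ring_hom: "push_forward K \<phi> \<in> ring_hom R A2"
  by (rule K.push_forward_ring_hom) (auto intro: S.comm_monoid_axioms S2.comm_monoid_axioms \<phi>)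

sublocale push: ring_hom_ring R A2 "push_forward K \<phi>"
  by (rule ring_hom_ringI2[OF R.ring_axioms A2.ring_axioms push_ring_hom])

lemma P_simps:
  "carrier P = carrier A2" "f \<oplus>\<^bsub>P\<^esub> g = f \<oplus>\<^bsub>A2\<^esub> g" "r \<odot>\<^bsub>P\<^esub> f = push_forward K \<phi> r \<otimes>\<^bsub>A2\<^esub> f"
  by (simp_all add: monoid_algebra_via_def algebra_via_def)

text \<open>A set \<open>J\<close> that absorbs \<open>S\<close> spans a monomial ideal. Its elements are those of the monoid ring of
  \<open>S\<close> with the carrier cut down to \<open>J\<close>, which makes induction over monomials in \<open>J\<close> available although
  \<open>J\<close> is not a monoid.\<close>
lemma supported_ideal:
  assumes J: "J \<subseteq> carrier S" and "\<And>s j. s \<in> carrier S \<Longrightarrow> j \<in> J \<Longrightarrow> s \<otimes>\<^bsub>S\<^esub> j \<in> J"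
  shows "ideal (carrier (monoid_algebra K (S\<lparr>carrier := J\<rparr>))) R"
proof (rule R.ideal_of_cringI)
  let ?I = "monoid_algebra K (S\<lparr>carrier := J\<rparr>)"
  interpret I: abelian_group ?I by (rule K.monoid_algebra_abelian_group)
  have ops: "f \<oplus>\<^bsub>?I\<^esub> g = f \<oplus>\<^bsub>R\<^esub> g" "\<zero>\<^bsub>?I\<^esub> = \<zero>\<^bsub>R\<^esub>" for f g
    by (simp_all add: monoid_algebra_simps)
  show sub: "carrier ?I \<subseteq> carrier R"
    by (intro subsetI, erule monoid_algebra_carrier_mono) (simp add: J)
  show "\<zero>\<^bsub>R\<^esub> \<in> carrier ?I" using I.zero_closed by (simp add: ops)
  show I_add: "f \<oplus>\<^bsub>R\<^esub> g \<in> carrier ?I" if "f \<in> carrier ?I" "g \<in> carrier ?I" for f g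
    using I.a_closed[OF that] by (simp add: ops)
  fix r f assume r: "r \<in> carrier R" and f: "f \<in> carrier ?I"
  have mon: "monomial K a s \<otimes>\<^bsub>R\<^esub> f \<in> carrier ?I" if as: "a \<in> carrier K" "s \<in> carrier S" for a s
    using f
  proof (induction rule: K.monoid_algebra_induct)
    case (monomial c x)
    then have "monomial K (a \<otimes>\<^bsub>K\<^esub> c) (s \<otimes>\<^bsub>S\<^esub> x) \<in> carrier ?I"
      using assms as by (intro K.monomial_closed) auto
    then show ?case
      using monomial as J by (subst K.monomial_mult) auto
  next
    case (add f g)
    then have "f \<in> carrier R" "g \<in> carrier R" using sub by auto
    with as have "monomial K a s \<otimes>\<^bsub>R\<^esub> (f \<oplus>\<^bsub>R\<^esub> g) = monomial K a s \<otimes>\<^bsub>R\<^esub> f \<oplus>\<^bsub>R\<^esub> monomial K a s \<otimes>\<^bsub>R\<^esub> g"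
      by (intro R.r_distr) auto
    with add show ?case by (simp add: ops I_add)
  next
    case zero
    show ?case using as \<open>\<zero>\<^bsub>R\<^esub> \<in> carrier ?I\<close> by (simp add: ops)
  qed
  show "r \<otimes>\<^bsub>R\<^esub> f \<in> carrier ?I"
    using r
  proof (induction rule: K.monoid_algebra_induct)
    case (add r r')
    have "f \<in> carrier R" using f sub by auto
    with add have "(r \<oplus>\<^bsub>R\<^esub> r') \<otimes>\<^bsub>R\<^esub> f = r \<otimes>\<^bsub>R\<^esub> f \<oplus>\<^bsub>R\<^esub> r' \<otimes>\<^bsub>R\<^esub> f"
      by (intro R.l_distr)
    with add show ?case by (simp add: I_add)
  next
    case zero
    have "f \<in> carrier R" using f sub by auto
    then show ?case using \<open>\<zero>\<^bsub>R\<^esub> \<in> carrier ?I\<close> by simp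
  qed (rule mon)
qed

text \<open>The binomial relation \<open>u\<^bsup>s\<^esup> v\<^bsup>x\<^esup> = u\<^bsup>t\<^esup> v\<^bsup>y\<^esup>\<close> makes \<open>u\<^bsup>s\<^esup> \<otimes> v\<^bsup>x\<^esup>\<close> and \<open>u\<^bsup>t\<^esup> \<otimes> v\<^bsup>y\<^esup>\<close> equal over the whole ring, since
  both scalars can be moved to the right. By flatness they are equal already over the ideal
  of \<open>J = (s + S) \<union> (t + S)\<close>, where the scalars cannot be moved. There the form \<open>\<beta>\<close> tells them apart:
  it restricts the left factor to \<open>U = s + S\<close>, multiplies, and reads off the coefficient at \<open>w = s + x\<close>.
  The restriction commutes with multiplication by \<open>u\<^bsup>r\<^esup>\<close> except when an exponent \<open>j = t + b\<close> outside of
  \<open>U\<close> is moved into \<open>U\<close>, say \<open>r + j = s + a\<close>. Such a term contributes to the coefficient at \<open>w\<close> only if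
  \<open>r + j + z = w\<close> for some \<open>z\<close>, and then \<open>x = a + z\<close> and \<open>y = r + b + z\<close> is a common refinement. So without a
  refinement \<open>\<beta>\<close> is balanced, and its values at the two tensors are \<open>1\<close> and \<open>0\<close>.\<close>
theorem common_refinement:
  assumes s: "s \<in> carrier S" and t: "t \<in> carrier S" and x: "x \<in> carrier S2" and y: "y \<in> carrier S2"
    and eq: "\<phi> s \<otimes>\<^bsub>S2\<^esub> x = \<phi> t \<otimes>\<^bsub>S2\<^esub> y"
  shows "\<exists>z\<in>carrier S2. \<exists>a\<in>carrier S. \<exists>b\<in>carrier S.
    x = \<phi> a \<otimes>\<^bsub>S2\<^esub> z \<and> y = \<phi> b \<otimes>\<^bsub>S2\<^esub> z \<and> s \<otimes>\<^bsub>S\<^esub> a = t \<otimes>\<^bsub>S\<^esub> b"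
proof (rule ccontr)
  assume contra: "\<not> ?thesis"
  define w where "w = \<phi> s \<otimes>\<^bsub>S2\<^esub> x"
  define U where "U = (\<lambda>a. s \<otimes>\<^bsub>S\<^esub> a) ` carrier S"
  define J where "J = U \<union> (\<lambda>b. t \<otimes>\<^bsub>S\<^esub> b) ` carrier S"
  define I where "I = carrier (monoid_algebra K (S\<lparr>carrier := J\<rparr>))"
  have US: "U \<subseteq> carrier S" and JS: "J \<subseteq> carrier S"
    using s t by (auto simp: U_def J_def)
  have U_closed: "r \<otimes>\<^bsub>S\<^esub> j \<in> U" if "r \<in> carrier S" "j \<in> U" for r j
  proof -
    from that obtain a where a: "a \<in> carrier S" "j = s \<otimes>\<^bsub>S\<^esub> a" by (auto simp: U_def)
    then have "r \<otimes>\<^bsub>S\<^esub> j = s \<otimes>\<^bsub>S\<^esub> (r \<otimes>\<^bsub>S\<^esub> a)" using s that by (simp add: S.m_lcomm)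
    then show ?thesis using that a by (simp add: U_def)
  qed
  have J_closed: "r \<otimes>\<^bsub>S\<^esub> j \<in> J" if "r \<in> carrier S" "j \<in> J" for r j
  proof (cases "j \<in> U")
    case True
    then show ?thesis using U_closed that by (simp add: J_def)
  next
    case False
    with that obtain b where b: "b \<in> carrier S" "j = t \<otimes>\<^bsub>S\<^esub> b" by (auto simp: J_def)
    then have "r \<otimes>\<^bsub>S\<^esub> j = t \<otimes>\<^bsub>S\<^esub> (r \<otimes>\<^bsub>S\<^esub> b)" using t that by (simp add: S.m_lcomm)
    then show ?thesis using that b by (simp add: J_def)
  qed
  have I: "ideal I R" unfolding I_def by (rule supported_ideal[OF JS J_closed])
  \<comment> \<open>Terms moved into \<open>U\<close> by a scalar do not contribute to the coefficient at \<open>w\<close>.\<close>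
  have key: "j \<in> U" if r: "r \<in> carrier S" and j: "j \<in> J" and rj: "r \<otimes>\<^bsub>S\<^esub> j \<in> U"
    and z: "z \<in> carrier S2" and w: "\<phi> (r \<otimes>\<^bsub>S\<^esub> j) \<otimes>\<^bsub>S2\<^esub> z = w" for r j z
  proof (rule ccontr)
    assume "j \<notin> U"
    with j obtain b where b: "b \<in> carrier S" "j = t \<otimes>\<^bsub>S\<^esub> b" by (auto simp: J_def)
    from rj obtain a where a: "a \<in> carrier S" "r \<otimes>\<^bsub>S\<^esub> j = s \<otimes>\<^bsub>S\<^esub> a" by (auto simp: U_def)
    have tb: "s \<otimes>\<^bsub>S\<^esub> a = t \<otimes>\<^bsub>S\<^esub> (r \<otimes>\<^bsub>S\<^esub> b)"
      using r t b by (simp add: S.m_lcomm flip: a(2))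
    have "\<phi> s \<otimes>\<^bsub>S2\<^esub> (\<phi> a \<otimes>\<^bsub>S2\<^esub> z) = \<phi> s \<otimes>\<^bsub>S2\<^esub> x"
      using w s a(1) z unfolding a(2) w_def by (simp add: S2.m_assoc)
    then have 1: "x = \<phi> a \<otimes>\<^bsub>S2\<^esub> z"
      using S2.l_cancel s x a(1) z by (metis S2.m_closed \<phi>_simps(1))
    have "\<phi> t \<otimes>\<^bsub>S2\<^esub> (\<phi> (r \<otimes>\<^bsub>S\<^esub> b) \<otimes>\<^bsub>S2\<^esub> z) = \<phi> t \<otimes>\<^bsub>S2\<^esub> y"
      using w t r b(1) z unfolding a(2) tb w_def eq by (simp add: S2.m_assoc)
    then have 2: "y = \<phi> (r \<otimes>\<^bsub>S\<^esub> b) \<otimes>\<^bsub>S2\<^esub> z"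
      using S2.l_cancel t r y b(1) z by (metis S2.m_closed S.m_closed \<phi>_simps(1))
    show False
      using contra 1 2 tb z a(1) r b(1) S.m_closed by blast
  qed
  have sU: "s \<in> U"
    unfolding U_def using s by (intro image_eqI[of _ _ "\<one>\<^bsub>S\<^esub>"]) auto
  have tJ: "t \<in> J"
    unfolding J_def using t by (intro UnI2 image_eqI[of _ _ "\<one>\<^bsub>S\<^esub>"]) auto
  have tU: "t \<notin> U"
  proof
    assume "t \<in> U"
    then obtain a where a: "a \<in> carrier S" "t = s \<otimes>\<^bsub>S\<^esub> a" by (auto simp: U_def)
    then have "\<phi> s \<otimes>\<^bsub>S2\<^esub> x = \<phi> s \<otimes>\<^bsub>S2\<^esub> (\<phi> a \<otimes>\<^bsub>S2\<^esub> y)"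
      using eq s y by (simp add: S2.m_assoc)
    then have "x = \<phi> a \<otimes>\<^bsub>S2\<^esub> y"
      using S2.l_cancel s x a(1) y by (metis S2.m_closed \<phi>_simps(1))
    moreover have "y = \<phi> \<one>\<^bsub>S\<^esub> \<otimes>\<^bsub>S2\<^esub> y" "s \<otimes>\<^bsub>S\<^esub> a = t \<otimes>\<^bsub>S\<^esub> \<one>\<^bsub>S\<^esub>" using y a s by simp_all
    ultimately show False using contra y a(1) S.one_closed by blast
  qed
  define p where "p = (\<lambda>f j. if j \<in> U then f j else \<zero>\<^bsub>K\<^esub>)"
  define L where "L = (\<lambda>f. push_forward K \<phi> (p f))"
  define \<beta> where "\<beta> = (\<lambda>X n. (L (dec X) \<otimes>\<^bsub>A2\<^esub> n) w)"
  have p_hom: "abelian_group_hom R R p"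
  proof (rule R.add_homI[OF R.abelian_group_axioms])
    fix f assume f: "f \<in> carrier R"
    have "{j. p f j \<noteq> \<zero>\<^bsub>K\<^esub>} \<subseteq> {j. f j \<noteq> \<zero>\<^bsub>K\<^esub>}" by (auto simp: p_def)
    moreover have "p f j \<in> carrier K" for j using f by (simp add: p_def)
    ultimately show "p f \<in> carrier R"
      using f unfolding monoid_algebra_carrier by (meson finite_subset order_trans)
    fix g assume "g \<in> carrier R"
    show "p (f \<oplus>\<^bsub>R\<^esub> g) = p f \<oplus>\<^bsub>R\<^esub> p g"
      by (auto simp: p_def monoid_algebra_simps)
  qed
  interpret L: abelian_group_hom R A2 L
    unfolding L_def by (rule abelian_group_hom_comp[OF p_hom push.abelian_group_hom_axioms])
  have L_monomial: "L (monomial K c j) = (if j \<in> U then monomial K c (\<phi> j) else \<zero>\<^bsub>A2\<^esub>)"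
    if "c \<in> carrier K" for c j
  proof -
    have "p (monomial K c j) = (if j \<in> U then monomial K c j else \<zero>\<^bsub>R\<^esub>)"
      by (auto simp: p_def monomial_def monoid_algebra_simps)
    then show ?thesis
      using that by (simp add: L_def K.push_forward_monomial)
  qed
  have ev: "(f \<oplus>\<^bsub>A2\<^esub> g) w = f w \<oplus>\<^bsub>K\<^esub> g w" "\<zero>\<^bsub>A2\<^esub> w = \<zero>\<^bsub>K\<^esub>" for f g
    by (simp_all add: monoid_algebra_simps)
  have IR: "f \<in> carrier R" if "f \<in> I" for f
    using that unfolding I_def by (rule monoid_algebra_carrier_mono) (simp add: JS)
  \<comment> \<open>\<open>\<beta>\<close> is balanced: first for monomials, then by additivity in \<open>n\<close>, \<open>m\<close> and \<open>r\<close>.\<close>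
  have bal1: "(L (monomial K a r \<otimes>\<^bsub>R\<^esub> monomial K c j) \<otimes>\<^bsub>A2\<^esub> monomial K d z) w
      = (L (monomial K c j) \<otimes>\<^bsub>A2\<^esub> (push_forward K \<phi> (monomial K a r) \<otimes>\<^bsub>A2\<^esub> monomial K d z)) w"
    if *: "a \<in> carrier K" "r \<in> carrier S" "c \<in> carrier K" "j \<in> J" "d \<in> carrier K" "z \<in> carrier S2" for a r c j d z
  proof -
    have j: "j \<in> carrier S" using * JS by blast
    have rm: "monomial K a r \<otimes>\<^bsub>R\<^esub> monomial K c j = monomial K (a \<otimes>\<^bsub>K\<^esub> c) (r \<otimes>\<^bsub>S\<^esub> j)"
      using * j by (intro K.monomial_mult)
    have push: "push_forward K \<phi> (monomial K a r) \<otimes>\<^bsub>A2\<^esub> monomial K d z = monomial K (a \<otimes>\<^bsub>K\<^esub> d) (\<phi> r \<otimes>\<^bsub>S2\<^esub> z)"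
      using * by (simp add: K.push_forward_monomial K.monomial_mult)
    show ?thesis
    proof (cases "j \<in> U")
      case True
      then have "r \<otimes>\<^bsub>S\<^esub> j \<in> U" using * U_closed by blast
      moreover have "\<phi> r \<otimes>\<^bsub>S2\<^esub> \<phi> j \<otimes>\<^bsub>S2\<^esub> z = \<phi> j \<otimes>\<^bsub>S2\<^esub> (\<phi> r \<otimes>\<^bsub>S2\<^esub> z)"
        using * j by (simp add: S2.m_ac)
      moreover have "a \<otimes>\<^bsub>K\<^esub> c \<otimes>\<^bsub>K\<^esub> d = c \<otimes>\<^bsub>K\<^esub> (a \<otimes>\<^bsub>K\<^esub> d)"
        using * by (simp add: K.m_ac)
      ultimately show ?thesis
        unfolding rm push using * j True by (simp add: L_monomial K.monomial_mult)
    next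
      case False
      have "(L (monomial K (a \<otimes>\<^bsub>K\<^esub> c) (r \<otimes>\<^bsub>S\<^esub> j)) \<otimes>\<^bsub>A2\<^esub> monomial K d z) w = \<zero>\<^bsub>K\<^esub>"
      proof (cases "r \<otimes>\<^bsub>S\<^esub> j \<in> U")
        case True
        then have "\<phi> (r \<otimes>\<^bsub>S\<^esub> j) \<otimes>\<^bsub>S2\<^esub> z \<noteq> w" using key False * by blast
        then have "monomial K e (\<phi> (r \<otimes>\<^bsub>S\<^esub> j) \<otimes>\<^bsub>S2\<^esub> z) w = \<zero>\<^bsub>K\<^esub>" for e
          by (simp add: monomial_def)
        moreover have "L (monomial K (a \<otimes>\<^bsub>K\<^esub> c) (r \<otimes>\<^bsub>S\<^esub> j)) \<otimes>\<^bsub>A2\<^esub> monomial K d z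
            = monomial K (a \<otimes>\<^bsub>K\<^esub> c \<otimes>\<^bsub>K\<^esub> d) (\<phi> (r \<otimes>\<^bsub>S\<^esub> j) \<otimes>\<^bsub>S2\<^esub> z)"
          using * True US by (simp add: L_monomial K.monomial_mult subset_iff)
        ultimately show ?thesis by simp
      next
        case False
        then show ?thesis using * by (simp add: L_monomial ev)
      qed
      then show ?thesis
        unfolding rm push using * False by (simp add: L_monomial ev)
    qed
  qed
  have bal2: "(L (monomial K a r \<otimes>\<^bsub>R\<^esub> monomial K c j) \<otimes>\<^bsub>A2\<^esub> n) w
      = (L (monomial K c j) \<otimes>\<^bsub>A2\<^esub> (push_forward K \<phi> (monomial K a r) \<otimes>\<^bsub>A2\<^esub> n)) w"
    if *: "a \<in> carrier K" "r \<in> carrier S" "c \<in> carrier K" "j \<in> J" and n: "n \<in> carrier A2" for a r c j n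
    using n
  proof (induction rule: K.monoid_algebra_induct)
    case (monomial d z)
    with * show ?case by (intro bal1)
  next
    case (add n n')
    with * JS show ?case by (simp add: A2.r_distr ev subset_iff)
  next
    case zero
    with * JS show ?case by (simp add: ev subset_iff)
  qed
  have bal3: "(L (monomial K a r \<otimes>\<^bsub>R\<^esub> m) \<otimes>\<^bsub>A2\<^esub> n) w
      = (L m \<otimes>\<^bsub>A2\<^esub> (push_forward K \<phi> (monomial K a r) \<otimes>\<^bsub>A2\<^esub> n)) w"
    if *: "a \<in> carrier K" "r \<in> carrier S" and m: "m \<in> I" and n: "n \<in> carrier A2" for a r m n
    using m unfolding I_def
  proof (induction rule: K.monoid_algebra_induct)
    case (monomial c j)
    with * n show ?case by (intro bal2) auto
  next
    case (add m m')
    have "m \<oplus>\<^bsub>monoid_algebra K (S\<lparr>carrier := J\<rparr>)\<^esub> m' = m \<oplus>\<^bsub>R\<^esub> m'"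
      by (simp add: monoid_algebra_simps)
    with add * n IR[unfolded I_def] show ?case by (simp add: A2.l_distr R.r_distr ev)
  next
    case zero
    have "\<zero>\<^bsub>monoid_algebra K (S\<lparr>carrier := J\<rparr>)\<^esub> = \<zero>\<^bsub>R\<^esub>"
      by (simp add: monoid_algebra_simps)
    with * n show ?case by (simp add: ev)
  qed
  have bal: "(L (r \<otimes>\<^bsub>R\<^esub> m) \<otimes>\<^bsub>A2\<^esub> n) w = (L m \<otimes>\<^bsub>A2\<^esub> (push_forward K \<phi> r \<otimes>\<^bsub>A2\<^esub> n)) w"
    if r: "r \<in> carrier R" and m: "m \<in> I" and n: "n \<in> carrier A2" for r m n
    using r
  proof (induction rule: K.monoid_algebra_induct)
    case (monomial a r)
    with m n show ?case by (intro bal3)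
  next
    case (add r r')
    with m n IR show ?case by (simp add: A2.l_distr A2.r_distr R.l_distr ev)
  next
    case zero
    with m n IR show ?case by (simp add: ev)
  qed
  let ?M = "enc_ideal R I" and ?N = "enc_ideal R (carrier R)"
  have P: "module R P" using flat by (simp add: flat_module_def)
  interpret TM: tensor_modules R ?M P by (intro tensor_modules.intro R.enc_ideal_module I P)
  interpret TN: tensor_modules R ?N P by (intro tensor_modules.intro R.enc_ideal_module R.oneideal P)
  let ?u = "\<lambda>s. monomial K \<one>\<^bsub>K\<^esub> s"
  have uI: "?u s \<in> I" "?u t \<in> I"
    unfolding I_def using sU tJ by (auto intro!: K.monomial_closed simp: J_def)
  have TN_pure: "TN.pure_tensor (enc (?u r)) (?u v) = TN.pure_tensor (enc \<one>\<^bsub>R\<^esub>) (?u (\<phi> r \<otimes>\<^bsub>S2\<^esub> v))"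
    if "r \<in> carrier S" "v \<in> carrier S2" for r v
  proof -
    have "TN.pure_tensor (?u r \<odot>\<^bsub>?N\<^esub> enc \<one>\<^bsub>R\<^esub>) (?u v) = TN.pure_tensor (enc \<one>\<^bsub>R\<^esub>) (?u r \<odot>\<^bsub>P\<^esub> ?u v)"
      using that by (intro TN.pure_balanced) (auto simp: P_simps enc_ideal_def)
    moreover have "?u r \<odot>\<^bsub>?N\<^esub> enc \<one>\<^bsub>R\<^esub> = enc (?u r)"
      using that by (simp add: enc_ideal_def)
    moreover have "?u r \<odot>\<^bsub>P\<^esub> ?u v = ?u (\<phi> r \<otimes>\<^bsub>S2\<^esub> v)"
      using that by (simp add: P_simps K.push_forward_monomial K.monomial_mult)
    ultimately show ?thesis by simp
  qed
  have "TN.pure_tensor (enc (?u s)) (?u x) = TN.pure_tensor (enc (?u t)) (?u y)"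
    using s t x y eq by (simp add: TN_pure)
  then have pure_eq: "TM.pure_tensor (enc (?u s)) (?u x) = TM.pure_tensor (enc (?u t)) (?u y)"
    using x y by (intro R.flat_ideal_pure_eq[OF flat I uI]) (auto simp: P_simps)
  have "\<beta> (enc (?u s)) (?u x) = \<beta> (enc (?u t)) (?u y)"
  proof (rule TM.balanced_map_pure_eq[OF K.abelian_group_axioms _ _ _ _ _ _ _ _ pure_eq])
    show "\<beta> m n \<in> carrier K" if "m \<in> carrier ?M" "n \<in> carrier P" for m n
      using that IR by (auto simp: \<beta>_def enc_ideal_def P_simps intro!: K.coeff_closed[of _ S2])
    show "\<beta> (m \<oplus>\<^bsub>?M\<^esub> m') n = \<beta> m n \<oplus>\<^bsub>K\<^esub> \<beta> m' n"
      if "m \<in> carrier ?M" "m' \<in> carrier ?M" "n \<in> carrier P" for m m' n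
      using that IR by (auto simp: \<beta>_def enc_ideal_def P_simps A2.l_distr ev)
    show "\<beta> m (n \<oplus>\<^bsub>P\<^esub> n') = \<beta> m n \<oplus>\<^bsub>K\<^esub> \<beta> m n'"
      if "m \<in> carrier ?M" "n \<in> carrier P" "n' \<in> carrier P" for m n n'
      using that IR by (auto simp: \<beta>_def enc_ideal_def P_simps A2.r_distr ev)
    show "\<beta> (r \<odot>\<^bsub>?M\<^esub> m) n = \<beta> m (r \<odot>\<^bsub>P\<^esub> n)"
      if "r \<in> carrier R" "m \<in> carrier ?M" "n \<in> carrier P" for r m n
      using that by (auto simp: \<beta>_def enc_ideal_def P_simps bal)
  qed (use uI x y in \<open>auto simp: enc_ideal_def P_simps\<close>)
  moreover have "\<beta> (enc (?u s)) (?u x) = \<one>\<^bsub>K\<^esub>"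
    using s sU x by (simp add: \<beta>_def L_monomial K.monomial_mult) (simp add: monomial_def w_def)
  moreover have "\<beta> (enc (?u t)) (?u y) = \<zero>\<^bsub>K\<^esub>"
    using tU y by (simp add: \<beta>_def L_monomial ev)
  ultimately show False using nontrivial by simp
qed

end

section \<open>Groups of differences and amalgamated sums\<close>

context comm_monoid_cancel
begin

lemma diff_class_self: "s \<in> carrier G \<Longrightarrow> t \<in> carrier G \<Longrightarrow> (s, t) \<in> diff_class G s t"
  by (simp add: diff_class_def)

lemma diff_class_eq_iff:
  assumes "s \<in> carrier G" "t \<in> carrier G" "s' \<in> carrier G" "t' \<in> carrier G"
  shows "diff_class G s t = diff_class G s' t' \<longleftrightarrow> s \<otimes> t' = s' \<otimes> t"
proof
  assume "diff_class G s t = diff_class G s' t'"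
  with diff_class_self[OF assms(1,2)] have "(s, t) \<in> diff_class G s' t'"
    by simp
  then show "s \<otimes> t' = s' \<otimes> t"
    by (auto simp: diff_class_def)
next
  have sub: "diff_class G s t \<subseteq> diff_class G s' t'"
    if eq: "s \<otimes> t' = s' \<otimes> t" and "s \<in> carrier G" "t \<in> carrier G" "s' \<in> carrier G" "t' \<in> carrier G"
    for s t s' t'
  proof (clarsimp simp: diff_class_def)
    fix a b assume ab: "a \<in> carrier G" "b \<in> carrier G" "a \<otimes> t = s \<otimes> b"
    have "(a \<otimes> t') \<otimes> t = (a \<otimes> t) \<otimes> t'"
      using that(2-5) ab(1,2) by (simp add: m_ac)
    also have "\<dots> = (s \<otimes> t') \<otimes> b"
      unfolding ab(3) using that(2-5) ab(1,2) by (simp add: m_ac)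
    also have "\<dots> = (s' \<otimes> b) \<otimes> t"
      unfolding eq using that(2-5) ab(1,2) by (simp add: m_ac)
    finally show "a \<otimes> t' = s' \<otimes> b"
      using that ab by (simp add: r_cancel)
  qed
  assume "s \<otimes> t' = s' \<otimes> t"
  with assms show "diff_class G s t = diff_class G s' t'"
    by (intro equalityI sub) auto
qed

lemma diff_class_UN:
  assumes "s \<in> carrier G" "t \<in> carrier G"
    and "\<And>a b. a \<in> carrier G \<Longrightarrow> b \<in> carrier G \<Longrightarrow> a \<otimes> t = s \<otimes> b \<Longrightarrow> F (a, b) = C"
  shows "(\<Union>p\<in>diff_class G s t. F p) = C"
proof -
  have "F p = C" if "p \<in> diff_class G s t" for p
    using that assms(3) by (auto simp: diff_class_def)
  with diff_class_self[OF assms(1,2)] show ?thesis by auto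
qed

lemma Grp_mult:
  assumes "s \<in> carrier G" "t \<in> carrier G" "s' \<in> carrier G" "t' \<in> carrier G"
  shows "diff_class G s t \<otimes>\<^bsub>Grp G\<^esub> diff_class G s' t' = diff_class G (s \<otimes> s') (t \<otimes> t')"
proof -
  have eq: "diff_class G (a \<otimes> a') (b \<otimes> b') = diff_class G (s \<otimes> s') (t \<otimes> t')"
    if "a \<in> carrier G" "b \<in> carrier G" "a \<otimes> t = s \<otimes> b"
      "a' \<in> carrier G" "b' \<in> carrier G" "a' \<otimes> t' = s' \<otimes> b'" for a b a' b'
  proof (subst diff_class_eq_iff)
    have "a \<otimes> a' \<otimes> (t \<otimes> t') = (a \<otimes> t) \<otimes> (a' \<otimes> t')" using assms that(1,2,4,5) by (simp add: m_ac)
    also have "\<dots> = s \<otimes> s' \<otimes> (b \<otimes> b')" unfolding that(3,6) using assms that(1,2,4,5) by (simp add: m_ac)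
    finally show "a \<otimes> a' \<otimes> (t \<otimes> t') = s \<otimes> s' \<otimes> (b \<otimes> b')" .
  qed (use assms that in auto)
  show ?thesis
    unfolding Grp_def monoid.simps
    by (intro diff_class_UN assms, unfold fst_conv snd_conv, rule eq)
qed

lemma Grp_carrierE:
  assumes "X \<in> carrier (Grp G)"
  obtains s t where "s \<in> carrier G" "t \<in> carrier G" "X = diff_class G s t"
  using assms by (auto simp: Grp_def)

lemma diff_class_closed [simp]:
  "s \<in> carrier G \<Longrightarrow> t \<in> carrier G \<Longrightarrow> diff_class G s t \<in> carrier (Grp G)"
  by (auto simp: Grp_def)

lemma Grp_one: "\<one>\<^bsub>Grp G\<^esub> = diff_class G \<one> \<one>"
  by (simp add: Grp_def)

lemma Grp_comm_group: "comm_group (Grp G)"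
proof (rule comm_groupI)
  fix X assume "X \<in> carrier (Grp G)"
  then obtain s t where st: "s \<in> carrier G" "t \<in> carrier G" "X = diff_class G s t"
    by (rule Grp_carrierE)
  then show "\<exists>Y\<in>carrier (Grp G). Y \<otimes>\<^bsub>Grp G\<^esub> X = \<one>\<^bsub>Grp G\<^esub>"
    by (intro bexI[of _ "diff_class G t s"]) (auto simp: Grp_mult Grp_one diff_class_eq_iff m_comm)
qed (auto elim!: Grp_carrierE simp: Grp_mult Grp_one m_ac)

lemma Grp_inv:
  assumes "s \<in> carrier G" "t \<in> carrier G"
  shows "inv\<^bsub>Grp G\<^esub> (diff_class G s t) = diff_class G t s"
proof -
  interpret Grp: comm_group "Grp G" by (rule Grp_comm_group)
  show ?thesis
    using assms by (intro Grp.inv_equality) (auto simp: Grp_mult Grp_one diff_class_eq_iff m_comm)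
qed

lemma Grp_map_diff_class:
  assumes "comm_monoid_cancel N" and "f \<in> monoid_hom G N" and "s \<in> carrier G" "t \<in> carrier G"
  shows "Grp_map N f (diff_class G s t) = diff_class N (f s) (f t)"
proof -
  interpret N: comm_monoid_cancel N by fact
  have f: "\<And>x. x \<in> carrier G \<Longrightarrow> f x \<in> carrier N"
    "\<And>x y. x \<in> carrier G \<Longrightarrow> y \<in> carrier G \<Longrightarrow> f (x \<otimes> y) = f x \<otimes>\<^bsub>N\<^esub> f y"
    using assms(2) by (auto simp: monoid_hom_def hom_def)
  have eq: "diff_class N (f a) (f b) = diff_class N (f s) (f t)"
    if "a \<in> carrier G" "b \<in> carrier G" and ab: "a \<otimes> t = s \<otimes> b" for a b
  proof (subst N.diff_class_eq_iff)
    show "f a \<otimes>\<^bsub>N\<^esub> f t = f s \<otimes>\<^bsub>N\<^esub> f b"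
      using arg_cong[OF ab, of f] f(2) that(1,2) assms(3,4) by simp
  qed (use that(1,2) assms(3,4) f(1) in auto)
  show ?thesis
    unfolding Grp_map_def by (intro diff_class_UN assms, unfold fst_conv snd_conv, rule eq)
qed

lemma tor_class_eq_iff:
  assumes "x \<in> carrier G" "y \<in> carrier G"
  shows "tor_class G x = tor_class G y \<longleftrightarrow> (\<exists>n::nat. n > 0 \<and> x [^] n = y [^] n)"
proof
  assume "tor_class G x = tor_class G y"
  moreover have "y \<in> tor_class G y" using assms by (auto simp: tor_class_def intro: exI[of _ 1])
  ultimately show "\<exists>n::nat. n > 0 \<and> x [^] n = y [^] n" by (auto simp: tor_class_def)
next
  have trans: "\<exists>n::nat. n > 0 \<and> x [^] n = z [^] n"
    if "x \<in> carrier G" "y \<in> carrier G" "z \<in> carrier G" "x [^] m = y [^] m" "y [^] n = z [^] n" "m > 0" "n > 0"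
    for x y z and m n :: nat
  proof (intro exI conjI)
    show "x [^] (m * n) = z [^] (m * n)"
      using that by (metis mult.commute nat_pow_pow)
  qed (use that in simp)
  assume "\<exists>n::nat. n > 0 \<and> x [^] n = y [^] n"
  then show "tor_class G x = tor_class G y"
    using assms unfolding tor_class_def by (auto intro: trans) (metis trans)+
qed

lemma tor_quot_mult:
  assumes "x \<in> carrier G" "y \<in> carrier G"
  shows "tor_class G x \<otimes>\<^bsub>tor_quot G\<^esub> tor_class G y = tor_class G (x \<otimes> y)"
proof -
  have "tor_class G (x' \<otimes> y') = tor_class G (x \<otimes> y)"
    if x': "x' \<in> tor_class G x" and y': "y' \<in> tor_class G y" for x' y'
  proof -
    from x' obtain m :: nat where m: "x' \<in> carrier G" "m > 0" "x [^] m = x' [^] m"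
      by (auto simp: tor_class_def)
    from y' obtain n :: nat where n: "y' \<in> carrier G" "n > 0" "y [^] n = y' [^] n"
      by (auto simp: tor_class_def)
    have "x' [^] (m * n) = x [^] (m * n)" "y' [^] (m * n) = y [^] (m * n)"
      using assms m n by (metis mult.commute nat_pow_pow)+
    then have "(x' \<otimes> y') [^] (m * n) = (x \<otimes> y) [^] (m * n)"
      using assms m n by (simp add: nat_pow_distrib)
    then show ?thesis
      using assms m n by (subst tor_class_eq_iff) (auto intro!: exI[of _ "m * n"])
  qed
  moreover have "x \<in> tor_class G x" "y \<in> tor_class G y"
    using assms by (auto simp: tor_class_def intro: exI[of _ 1])
  ultimately have "(\<Union>x'\<in>tor_class G x. \<Union>y'\<in>tor_class G y. tor_class G (x' \<otimes> y')) = tor_class G (x \<otimes> y)"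
    by blast
  then show ?thesis by (simp add: tor_quot_def)
qed

lemma tor_quot_comm_monoid_cancel: "comm_monoid_cancel (tor_quot G)"
proof (rule comm_monoid_cancelI)
  have carrier: "carrier (tor_quot G) = tor_class G ` carrier G" by (simp add: tor_quot_def)
  show "comm_monoid (tor_quot G)"
  proof (rule comm_monoid_image[OF comm_monoid_axioms carrier])
    show "\<one>\<^bsub>tor_quot G\<^esub> = tor_class G \<one>" by (simp add: tor_quot_def)
  qed (rule tor_quot_mult)
  show "X = Y" if eq: "X \<otimes>\<^bsub>tor_quot G\<^esub> Z = Y \<otimes>\<^bsub>tor_quot G\<^esub> Z"
    and XYZ: "X \<in> carrier (tor_quot G)" "Y \<in> carrier (tor_quot G)" "Z \<in> carrier (tor_quot G)" for X Y Z
  proof -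
    from XYZ obtain x y z where xyz: "x \<in> carrier G" "y \<in> carrier G" "z \<in> carrier G"
      "X = tor_class G x" "Y = tor_class G y" "Z = tor_class G z"
      unfolding carrier by auto
    with eq obtain n :: nat where "n > 0" "(x \<otimes> z) [^] n = (y \<otimes> z) [^] n"
      by (auto simp: tor_quot_mult tor_class_eq_iff)
    then have "x [^] n = y [^] n"
      using xyz by (metis nat_pow_closed nat_pow_distrib r_cancel)
    with \<open>n > 0\<close> show ?thesis using xyz by (auto simp: tor_class_eq_iff)
  qed
qed

end

text \<open>A pair of homomorphisms out of \<open>S\<close>; \<open>\<mu> (x, y)\<close> is the image of \<open>x + y\<close> in the amalgamated sum.\<close>
locale monoid_span =
  S: comm_monoid_cancel S + S1: comm_monoid_cancel S1 + S2: comm_monoid_cancel S2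
  for S :: "('a, 'm) monoid_scheme" and S1 :: "('b, 'm1) monoid_scheme" and S2 :: "('c, 'm2) monoid_scheme" +
  fixes \<phi>1 :: "'a \<Rightarrow> 'b" and \<phi>2 :: "'a \<Rightarrow> 'c"
  assumes \<phi>1: "\<phi>1 \<in> monoid_hom S S1" and \<phi>2: "\<phi>2 \<in> monoid_hom S S2"
begin

lemma \<phi>1_simps [simp]:
  "s \<in> carrier S \<Longrightarrow> \<phi>1 s \<in> carrier S1" "\<phi>1 \<one>\<^bsub>S\<^esub> = \<one>\<^bsub>S1\<^esub>"
  "s \<in> carrier S \<Longrightarrow> t \<in> carrier S \<Longrightarrow> \<phi>1 (s \<otimes>\<^bsub>S\<^esub> t) = \<phi>1 s \<otimes>\<^bsub>S1\<^esub> \<phi>1 t"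
  using \<phi>1 by (auto simp: monoid_hom_def hom_def)

lemma \<phi>2_simps [simp]:
  "s \<in> carrier S \<Longrightarrow> \<phi>2 s \<in> carrier S2" "\<phi>2 \<one>\<^bsub>S\<^esub> = \<one>\<^bsub>S2\<^esub>"
  "s \<in> carrier S \<Longrightarrow> t \<in> carrier S \<Longrightarrow> \<phi>2 (s \<otimes>\<^bsub>S\<^esub> t) = \<phi>2 s \<otimes>\<^bsub>S2\<^esub> \<phi>2 t"
  using \<phi>2 by (auto simp: monoid_hom_def hom_def)

text \<open>For \<open>p = (x, y)\<close> and \<open>q = (x', y')\<close> this says \<open>(x - x', y - y') = (s - t, t - s)\<close> in
  \<open>Grp S1 \<oplus> Grp S2\<close> for some \<open>s\<close>, \<open>t\<close> in \<open>S\<close>, written without subtraction.\<close>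
definition amalg_rel :: "'b \<times> 'c \<Rightarrow> 'b \<times> 'c \<Rightarrow> bool" where
  "amalg_rel p q \<longleftrightarrow> (\<exists>s\<in>carrier S. \<exists>t\<in>carrier S.
     fst p \<otimes>\<^bsub>S1\<^esub> \<phi>1 t = fst q \<otimes>\<^bsub>S1\<^esub> \<phi>1 s \<and> snd p \<otimes>\<^bsub>S2\<^esub> \<phi>2 s = snd q \<otimes>\<^bsub>S2\<^esub> \<phi>2 t)"

abbreviation "\<mu> \<equiv> amalg_map S S1 S2 \<phi>1 \<phi>2"
abbreviation "A \<equiv> amalg_sum S S1 S2 \<phi>1 \<phi>2"
abbreviation "T \<equiv> tf_amalg_sum S S1 S2 \<phi>1 \<phi>2"
abbreviation "j1 \<equiv> tf_amalg_in1 S S1 S2 \<phi>1 \<phi>2"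
abbreviation "j2 \<equiv> tf_amalg_in2 S S1 S2 \<phi>1 \<phi>2"
abbreviation "j \<equiv> tf_amalg_in S S1 S2 \<phi>1 \<phi>2"
abbreviation "D \<equiv> antidiagonal S S1 S2 \<phi>1 \<phi>2"

lemma Grp_prod_comm_group: "comm_group (Grp S1 \<times>\<times> Grp S2)"
proof -
  interpret G1: comm_group "Grp S1" by (rule S1.Grp_comm_group)
  interpret G2: comm_group "Grp S2" by (rule S2.Grp_comm_group)
  interpret P: group "Grp S1 \<times>\<times> Grp S2" by (intro DirProd_group G1.is_group G2.is_group)
  show ?thesis
    by (rule P.group_comm_groupI) (clarsimp, intro conjI G1.m_comm G2.m_comm)
qed

lemma antidiagonal_eq:
  "D = {(diff_class S1 (\<phi>1 s) (\<phi>1 t), diff_class S2 (\<phi>2 t) (\<phi>2 s)) | s t. s \<in> carrier S \<and> t \<in> carrier S}"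
proof -
  have carrier: "carrier (Grp S) = (\<lambda>(s, t). diff_class S s t) ` (carrier S \<times> carrier S)"
    by (auto simp: Grp_def)
  have "D = (\<lambda>(s, t). (diff_class S1 (\<phi>1 s) (\<phi>1 t), diff_class S2 (\<phi>2 t) (\<phi>2 s))) ` (carrier S \<times> carrier S)"
    unfolding antidiagonal_def carrier image_image
    by (intro image_cong refl) (auto simp: S.Grp_map_diff_class[OF S1.comm_monoid_cancel_axioms \<phi>1]
      S.Grp_map_diff_class[OF S2.comm_monoid_cancel_axioms \<phi>2] S2.Grp_inv)
  then show ?thesis by auto
qed

lemma antidiagonal_subgroup: "subgroup D (Grp S1 \<times>\<times> Grp S2)"
proof -
  interpret P: comm_group "Grp S1 \<times>\<times> Grp S2" by (rule Grp_prod_comm_group)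
  interpret G1: comm_group "Grp S1" by (rule S1.Grp_comm_group)
  interpret G2: comm_group "Grp S2" by (rule S2.Grp_comm_group)
  show ?thesis
  proof (rule P.subgroupI)
    show "D \<subseteq> carrier (Grp S1 \<times>\<times> Grp S2)"
      by (auto simp: antidiagonal_eq)
    show "D \<noteq> {}"
      unfolding antidiagonal_eq by blast
  next
    fix g assume "g \<in> D"
    then obtain s t where st: "s \<in> carrier S" "t \<in> carrier S"
      and g: "g = (diff_class S1 (\<phi>1 s) (\<phi>1 t), diff_class S2 (\<phi>2 t) (\<phi>2 s))"
      by (auto simp: antidiagonal_eq)
    have "inv\<^bsub>Grp S1 \<times>\<times> Grp S2\<^esub> g = (diff_class S1 (\<phi>1 t) (\<phi>1 s), diff_class S2 (\<phi>2 s) (\<phi>2 t))"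
      unfolding g using st by (simp add: S1.Grp_inv S2.Grp_inv)
    with st show "inv\<^bsub>Grp S1 \<times>\<times> Grp S2\<^esub> g \<in> D"
      unfolding antidiagonal_eq by blast
  next
    fix g h assume "g \<in> D" "h \<in> D"
    then obtain s t s' t' where st: "s \<in> carrier S" "t \<in> carrier S" "s' \<in> carrier S" "t' \<in> carrier S"
      and gh: "g = (diff_class S1 (\<phi>1 s) (\<phi>1 t), diff_class S2 (\<phi>2 t) (\<phi>2 s))"
      "h = (diff_class S1 (\<phi>1 s') (\<phi>1 t'), diff_class S2 (\<phi>2 t') (\<phi>2 s'))"
      by (auto simp: antidiagonal_eq)
    have "g \<otimes>\<^bsub>Grp S1 \<times>\<times> Grp S2\<^esub> h = (diff_class S1 (\<phi>1 (s \<otimes>\<^bsub>S\<^esub> s')) (\<phi>1 (t \<otimes>\<^bsub>S\<^esub> t')),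
        diff_class S2 (\<phi>2 (t \<otimes>\<^bsub>S\<^esub> t')) (\<phi>2 (s \<otimes>\<^bsub>S\<^esub> s')))"
      unfolding gh using st by (simp add: S1.Grp_mult S2.Grp_mult)
    with st show "g \<otimes>\<^bsub>Grp S1 \<times>\<times> Grp S2\<^esub> h \<in> D"
      unfolding antidiagonal_eq by (metis (mono_tags, lifting) S.m_closed mem_Collect_eq)
  qed
qed

lemma to_Grp_closed:
  "p \<in> carrier (S1 \<times>\<times> S2) \<Longrightarrow> (to_Grp S1 (fst p), to_Grp S2 (snd p)) \<in> carrier (Grp S1 \<times>\<times> Grp S2)"
  by (auto simp: to_Grp_def)

lemma amalg_map_eq_iff:
  assumes p: "p \<in> carrier (S1 \<times>\<times> S2)" and q: "q \<in> carrier (S1 \<times>\<times> S2)"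
  shows "\<mu> p = \<mu> q \<longleftrightarrow> amalg_rel p q"
proof -
  interpret P: comm_group "Grp S1 \<times>\<times> Grp S2" by (rule Grp_prod_comm_group)
  have "\<mu> p = \<mu> q \<longleftrightarrow> (\<exists>d\<in>D. (to_Grp S1 (fst p), to_Grp S2 (snd p))
      = d \<otimes>\<^bsub>Grp S1 \<times>\<times> Grp S2\<^esub> (to_Grp S1 (fst q), to_Grp S2 (snd q)))"
    unfolding amalg_map_def using p q P.rcoset_eq_iff[OF antidiagonal_subgroup to_Grp_closed to_Grp_closed]
    by (simp add: case_prod_beta)
  also have "\<dots> \<longleftrightarrow> (\<exists>s\<in>carrier S. \<exists>t\<in>carrier S.
      to_Grp S1 (fst p) = diff_class S1 (\<phi>1 s) (\<phi>1 t) \<otimes>\<^bsub>Grp S1\<^esub> to_Grp S1 (fst q) \<and>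
      to_Grp S2 (snd p) = diff_class S2 (\<phi>2 t) (\<phi>2 s) \<otimes>\<^bsub>Grp S2\<^esub> to_Grp S2 (snd q))"
    unfolding antidiagonal_eq by auto
  also have "\<dots> \<longleftrightarrow> amalg_rel p q"
    unfolding amalg_rel_def
  proof (intro bex_cong refl arg_cong2[of _ _ _ _ "(\<and>)"])
    fix s t assume st: "s \<in> carrier S" "t \<in> carrier S"
    show "to_Grp S1 (fst p) = diff_class S1 (\<phi>1 s) (\<phi>1 t) \<otimes>\<^bsub>Grp S1\<^esub> to_Grp S1 (fst q) \<longleftrightarrow>
        fst p \<otimes>\<^bsub>S1\<^esub> \<phi>1 t = fst q \<otimes>\<^bsub>S1\<^esub> \<phi>1 s"
      using p q st S1.m_comm[of "fst q" "\<phi>1 s"]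
      by (simp add: mem_Times_iff to_Grp_def S1.Grp_mult S1.diff_class_eq_iff)
    show "to_Grp S2 (snd p) = diff_class S2 (\<phi>2 t) (\<phi>2 s) \<otimes>\<^bsub>Grp S2\<^esub> to_Grp S2 (snd q) \<longleftrightarrow>
        snd p \<otimes>\<^bsub>S2\<^esub> \<phi>2 s = snd q \<otimes>\<^bsub>S2\<^esub> \<phi>2 t"
      using p q st S2.m_comm[of "snd q" "\<phi>2 t"]
      by (simp add: mem_Times_iff to_Grp_def S2.Grp_mult S2.diff_class_eq_iff)
  qed
  finally show ?thesis .
qed

lemma amalg_sum_mult:
  assumes p: "p \<in> carrier (S1 \<times>\<times> S2)" and q: "q \<in> carrier (S1 \<times>\<times> S2)"
  shows "\<mu> p \<otimes>\<^bsub>A\<^esub> \<mu> q = \<mu> (p \<otimes>\<^bsub>S1 \<times>\<times> S2\<^esub> q)"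
proof -
  interpret P: comm_group "Grp S1 \<times>\<times> Grp S2" by (rule Grp_prod_comm_group)
  interpret D: normal D "Grp S1 \<times>\<times> Grp S2"
    by (rule P.normal_iff_subgroup[THEN iffD2, OF antidiagonal_subgroup])
  have "\<mu> p \<otimes>\<^bsub>A\<^esub> \<mu> q = D #>\<^bsub>Grp S1 \<times>\<times> Grp S2\<^esub> ((to_Grp S1 (fst p), to_Grp S2 (snd p))
      \<otimes>\<^bsub>Grp S1 \<times>\<times> Grp S2\<^esub> (to_Grp S1 (fst q), to_Grp S2 (snd q)))"
    unfolding amalg_sum_def amalg_map_def using D.rcos_sum[OF to_Grp_closed[OF p] to_Grp_closed[OF q]]
    by (simp add: case_prod_beta)
  also have "\<dots> = \<mu> (p \<otimes>\<^bsub>S1 \<times>\<times> S2\<^esub> q)"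
    using p q by (auto simp: amalg_map_def to_Grp_def S1.Grp_mult S2.Grp_mult)
  finally show ?thesis .
qed

lemma amalg_sum_one: "\<one>\<^bsub>A\<^esub> = \<mu> (\<one>\<^bsub>S1\<^esub>, \<one>\<^bsub>S2\<^esub>)"
proof -
  interpret P: comm_group "Grp S1 \<times>\<times> Grp S2" by (rule Grp_prod_comm_group)
  have "D #>\<^bsub>Grp S1 \<times>\<times> Grp S2\<^esub> \<one>\<^bsub>Grp S1 \<times>\<times> Grp S2\<^esub> = D"
    by (rule P.coset_mult_one) (rule subgroup.subset[OF antidiagonal_subgroup])
  then show ?thesis
    by (simp add: amalg_sum_def amalg_map_def to_Grp_def S1.Grp_one S2.Grp_one)
qed

lemma carrier_amalg_sum: "carrier A = \<mu> ` carrier (S1 \<times>\<times> S2)"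
  by (simp add: amalg_sum_def)

sublocale A: comm_monoid_cancel A
proof (rule comm_monoid_cancelI)
  show "comm_monoid A"
    by (rule comm_monoid_image[OF DirProd_comm_monoid[OF S1.comm_monoid_axioms S2.comm_monoid_axioms] carrier_amalg_sum])
      (simp_all only: amalg_sum_mult amalg_sum_one one_DirProd)
  show "X = Y" if eq: "X \<otimes>\<^bsub>A\<^esub> Z = Y \<otimes>\<^bsub>A\<^esub> Z"
    and XYZ: "X \<in> carrier A" "Y \<in> carrier A" "Z \<in> carrier A" for X Y Z
  proof -
    from XYZ obtain x x' y y' z z' where xyz: "x \<in> carrier S1" "x' \<in> carrier S2"
      "y \<in> carrier S1" "y' \<in> carrier S2" "z \<in> carrier S1" "z' \<in> carrier S2"
      "X = \<mu> (x, x')" "Y = \<mu> (y, y')" "Z = \<mu> (z, z')"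
      unfolding carrier_amalg_sum by auto
    with eq have "amalg_rel (x \<otimes>\<^bsub>S1\<^esub> z, x' \<otimes>\<^bsub>S2\<^esub> z') (y \<otimes>\<^bsub>S1\<^esub> z, y' \<otimes>\<^bsub>S2\<^esub> z')"
      by (simp add: amalg_sum_mult amalg_map_eq_iff)
    then obtain s t where st: "s \<in> carrier S" "t \<in> carrier S"
      "x \<otimes>\<^bsub>S1\<^esub> z \<otimes>\<^bsub>S1\<^esub> \<phi>1 t = y \<otimes>\<^bsub>S1\<^esub> z \<otimes>\<^bsub>S1\<^esub> \<phi>1 s"
      "x' \<otimes>\<^bsub>S2\<^esub> z' \<otimes>\<^bsub>S2\<^esub> \<phi>2 s = y' \<otimes>\<^bsub>S2\<^esub> z' \<otimes>\<^bsub>S2\<^esub> \<phi>2 t"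
      by (auto simp: amalg_rel_def)
    have "(x \<otimes>\<^bsub>S1\<^esub> \<phi>1 t) \<otimes>\<^bsub>S1\<^esub> z = (y \<otimes>\<^bsub>S1\<^esub> \<phi>1 s) \<otimes>\<^bsub>S1\<^esub> z"
      using xyz st by (metis S1.m_assoc S1.m_comm \<phi>1_simps(1))
    moreover have "(x' \<otimes>\<^bsub>S2\<^esub> \<phi>2 s) \<otimes>\<^bsub>S2\<^esub> z' = (y' \<otimes>\<^bsub>S2\<^esub> \<phi>2 t) \<otimes>\<^bsub>S2\<^esub> z'"
      using xyz st by (metis S2.m_assoc S2.m_comm \<phi>2_simps(1))
    ultimately have "x \<otimes>\<^bsub>S1\<^esub> \<phi>1 t = y \<otimes>\<^bsub>S1\<^esub> \<phi>1 s" "x' \<otimes>\<^bsub>S2\<^esub> \<phi>2 s = y' \<otimes>\<^bsub>S2\<^esub> \<phi>2 t"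
      using xyz st by (auto dest: S1.r_cancel S2.r_cancel)
    with xyz st show ?thesis
      by (auto simp: amalg_map_eq_iff amalg_rel_def)
  qed
qed

lemma amalg_map_closed: "p \<in> carrier (S1 \<times>\<times> S2) \<Longrightarrow> \<mu> p \<in> carrier A"
  by (simp add: carrier_amalg_sum)

sublocale T: comm_monoid_cancel T
  unfolding tf_amalg_sum_def by (rule A.tor_quot_comm_monoid_cancel)

lemma T_mult:
  assumes "p \<in> carrier (S1 \<times>\<times> S2)" and "q \<in> carrier (S1 \<times>\<times> S2)"
  shows "tor_class A (\<mu> p) \<otimes>\<^bsub>T\<^esub> tor_class A (\<mu> q) = tor_class A (\<mu> (p \<otimes>\<^bsub>S1 \<times>\<times> S2\<^esub> q))"
  unfolding tf_amalg_sum_def using assms by (simp only: A.tor_quot_mult amalg_map_closed amalg_sum_mult)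

lemma T_one: "\<one>\<^bsub>T\<^esub> = tor_class A (\<mu> (\<one>\<^bsub>S1\<^esub>, \<one>\<^bsub>S2\<^esub>))"
  by (simp add: tf_amalg_sum_def tor_quot_def amalg_sum_one)

lemma j1_hom: "j1 \<in> monoid_hom S1 T"
  and j2_hom: "j2 \<in> monoid_hom S2 T"
  unfolding monoid_hom_def hom_def tf_amalg_in1_def tf_amalg_in2_def
  by (auto simp: T_mult T_one) (auto simp: tf_amalg_sum_def tor_quot_def amalg_map_closed)

lemma j1_j2: "x \<in> carrier S1 \<Longrightarrow> y \<in> carrier S2 \<Longrightarrow> j1 x \<otimes>\<^bsub>T\<^esub> j2 y = tor_class A (\<mu> (x, y))"
  by (simp add: tf_amalg_in1_def tf_amalg_in2_def T_mult)

lemma carrier_T: "carrier T = (\<lambda>(x, y). j1 x \<otimes>\<^bsub>T\<^esub> j2 y) ` (carrier S1 \<times> carrier S2)"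
proof -
  have "carrier T = (\<lambda>p. tor_class A (\<mu> p)) ` (carrier S1 \<times> carrier S2)"
    by (simp add: tf_amalg_sum_def tor_quot_def carrier_amalg_sum image_image)
  also have "\<dots> = (\<lambda>(x, y). j1 x \<otimes>\<^bsub>T\<^esub> j2 y) ` (carrier S1 \<times> carrier S2)"
    by (intro image_cong refl) (auto simp: j1_j2)
  finally show ?thesis .
qed

lemma j2_\<phi>2: "s \<in> carrier S \<Longrightarrow> j2 (\<phi>2 s) = j s"
proof -
  assume s: "s \<in> carrier S"
  then have "amalg_rel (\<one>\<^bsub>S1\<^esub>, \<phi>2 s) (\<phi>1 s, \<one>\<^bsub>S2\<^esub>)"
    unfolding amalg_rel_def by (intro bexI[of _ "\<one>\<^bsub>S\<^esub>"] bexI[of _ s]) auto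
  then have "\<mu> (\<one>\<^bsub>S1\<^esub>, \<phi>2 s) = \<mu> (\<phi>1 s, \<one>\<^bsub>S2\<^esub>)"
    using s by (simp add: amalg_map_eq_iff)
  then show ?thesis
    by (simp add: tf_amalg_in_def tf_amalg_in1_def tf_amalg_in2_def)
qed

lemma j_hom: "j \<in> monoid_hom S T"
  using j1_hom unfolding monoid_hom_def hom_def tf_amalg_in_def by auto

lemma amalg_map_pow:
  "x \<in> carrier S1 \<Longrightarrow> y \<in> carrier S2 \<Longrightarrow> \<mu> (x, y) [^]\<^bsub>A\<^esub> (n::nat) = \<mu> (x [^]\<^bsub>S1\<^esub> n, y [^]\<^bsub>S2\<^esub> n)"
  by (induction n) (auto simp: amalg_sum_one amalg_sum_mult)

end

locale torsion_free_span = monoid_span S S1 S2 \<phi>1 \<phi>2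
  for S :: "('a, 'm) monoid_scheme" and S1 :: "('b, 'm1) monoid_scheme" and S2 :: "('c, 'm2) monoid_scheme"
    and \<phi>1 \<phi>2 +
  assumes tf1: "torsion_free_monoid S1" and tf2: "torsion_free_monoid S2"
    and inj1: "inj_on \<phi>1 (carrier S)" and inj2: "inj_on \<phi>2 (carrier S)"
begin

text \<open>If \<open>x\<close> and \<open>x'\<close> agree in the amalgamated sum up to torsion, then \<open>n x - n x' = s - t\<close> where \<open>s - t\<close> vanishes
  in \<open>Grp S2\<close>. Injectivity of \<open>\<phi>2\<close> gives \<open>s = t\<close>, and \<open>S1\<close> is torsion free.\<close>
lemma inj_j1: "inj_on j1 (carrier S1)"
proof (rule inj_onI)
  fix x x' assume x: "x \<in> carrier S1" "x' \<in> carrier S1" and "j1 x = j1 x'"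
  then obtain n :: nat where n: "n > 0" "amalg_rel (x [^]\<^bsub>S1\<^esub> n, \<one>\<^bsub>S2\<^esub>) (x' [^]\<^bsub>S1\<^esub> n, \<one>\<^bsub>S2\<^esub>)"
    by (auto simp: tf_amalg_in1_def A.tor_class_eq_iff amalg_map_closed amalg_map_pow amalg_map_eq_iff)
  then obtain s t where st: "s \<in> carrier S" "t \<in> carrier S" "\<phi>2 s = \<phi>2 t"
    "x [^]\<^bsub>S1\<^esub> n \<otimes>\<^bsub>S1\<^esub> \<phi>1 t = x' [^]\<^bsub>S1\<^esub> n \<otimes>\<^bsub>S1\<^esub> \<phi>1 s"
    by (auto simp: amalg_rel_def)
  then have "s = t" using inj2 by (auto dest: inj_onD)
  with st x have "x [^]\<^bsub>S1\<^esub> n = x' [^]\<^bsub>S1\<^esub> n" by (auto dest: S1.r_cancel)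
  with tf1 n x show "x = x'" by (auto simp: torsion_free_monoid_def)
qed

lemma inj_j2: "inj_on j2 (carrier S2)"
proof (rule inj_onI)
  fix y y' assume y: "y \<in> carrier S2" "y' \<in> carrier S2" and "j2 y = j2 y'"
  then obtain n :: nat where n: "n > 0" "amalg_rel (\<one>\<^bsub>S1\<^esub>, y [^]\<^bsub>S2\<^esub> n) (\<one>\<^bsub>S1\<^esub>, y' [^]\<^bsub>S2\<^esub> n)"
    by (auto simp: tf_amalg_in2_def A.tor_class_eq_iff amalg_map_closed amalg_map_pow amalg_map_eq_iff)
  then obtain s t where st: "s \<in> carrier S" "t \<in> carrier S" "\<phi>1 t = \<phi>1 s"
    "y [^]\<^bsub>S2\<^esub> n \<otimes>\<^bsub>S2\<^esub> \<phi>2 s = y' [^]\<^bsub>S2\<^esub> n \<otimes>\<^bsub>S2\<^esub> \<phi>2 t"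
    by (auto simp: amalg_rel_def)
  then have "s = t" using inj1 by (auto dest: inj_onD)
  with st y have "y [^]\<^bsub>S2\<^esub> n = y' [^]\<^bsub>S2\<^esub> n" by (auto dest: S2.r_cancel)
  with tf2 n y show "y = y'" by (auto simp: torsion_free_monoid_def)
qed

text \<open>Passing to the torsion-free quotient identifies more pairs than the amalgamated sum does, but not if
  \<open>Grp S1\<close> and \<open>Grp S2\<close> meet in \<open>Grp S\<close> only: the element \<open>x - x' = y' - y\<close> lies in both groups, so it is
  \<open>s - t\<close> with \<open>s\<close>, \<open>t\<close> in \<open>S\<close>.\<close>
lemma j_eq_imp_amalg_rel:
  assumes Grp: "Grp_map T j1 ` carrier (Grp S1) \<inter> Grp_map T j2 ` carrier (Grp S2) \<subseteq> Grp_map T j ` carrier (Grp S)"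
    and x: "x \<in> carrier S1" "x' \<in> carrier S1" and y: "y \<in> carrier S2" "y' \<in> carrier S2"
    and eq: "j1 x \<otimes>\<^bsub>T\<^esub> j2 y = j1 x' \<otimes>\<^bsub>T\<^esub> j2 y'"
  shows "amalg_rel (x, y) (x', y')"
proof -
  have j1: "\<And>x. x \<in> carrier S1 \<Longrightarrow> j1 x \<in> carrier T"
    "\<And>x y. x \<in> carrier S1 \<Longrightarrow> y \<in> carrier S1 \<Longrightarrow> j1 (x \<otimes>\<^bsub>S1\<^esub> y) = j1 x \<otimes>\<^bsub>T\<^esub> j1 y"
    using j1_hom by (auto simp: monoid_hom_def hom_def)
  have j2: "\<And>x. x \<in> carrier S2 \<Longrightarrow> j2 x \<in> carrier T"
    "\<And>x y. x \<in> carrier S2 \<Longrightarrow> y \<in> carrier S2 \<Longrightarrow> j2 (x \<otimes>\<^bsub>S2\<^esub> y) = j2 x \<otimes>\<^bsub>T\<^esub> j2 y"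
    using j2_hom by (auto simp: monoid_hom_def hom_def)
  have j: "\<And>x. x \<in> carrier S \<Longrightarrow> j x \<in> carrier T"
    using j_hom by (auto simp: monoid_hom_def hom_def)
  define X where "X = diff_class T (j1 x) (j1 x')"
  have X1: "X = Grp_map T j1 (diff_class S1 x x')"
    using x by (simp add: X_def S1.Grp_map_diff_class[OF T.comm_monoid_cancel_axioms j1_hom])
  have X2: "X = Grp_map T j2 (diff_class S2 y' y)"
    using x y eq by (simp add: X_def S2.Grp_map_diff_class[OF T.comm_monoid_cancel_axioms j2_hom]
        T.diff_class_eq_iff j1 j2 T.m_comm)
  have "X \<in> Grp_map T j1 ` carrier (Grp S1)"
    unfolding X1 by (rule imageI) (use x in simp)
  moreover have "X \<in> Grp_map T j2 ` carrier (Grp S2)"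
    unfolding X2 by (rule imageI) (use y in simp)
  ultimately have "X \<in> Grp_map T j ` carrier (Grp S)"
    using Grp by (meson IntI subsetD)
  then obtain s t where st: "s \<in> carrier S" "t \<in> carrier S" "X = diff_class T (j s) (j t)"
    by (auto elim!: S.Grp_carrierE simp: S.Grp_map_diff_class[OF T.comm_monoid_cancel_axioms j_hom])
  have "j1 x \<otimes>\<^bsub>T\<^esub> j t = j s \<otimes>\<^bsub>T\<^esub> j1 x'"
    using st x unfolding X_def by (simp add: T.diff_class_eq_iff j j1)
  then have "j1 (x \<otimes>\<^bsub>S1\<^esub> \<phi>1 t) = j1 (x' \<otimes>\<^bsub>S1\<^esub> \<phi>1 s)"
    using st x by (simp add: j1 tf_amalg_in_def T.m_comm)
  moreover have "j2 y' \<otimes>\<^bsub>T\<^esub> j t = j s \<otimes>\<^bsub>T\<^esub> j2 y"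
    using st y X2
    by (simp add: S2.Grp_map_diff_class[OF T.comm_monoid_cancel_axioms j2_hom] T.diff_class_eq_iff j j2)
  then have "j2 (y \<otimes>\<^bsub>S2\<^esub> \<phi>2 s) = j2 (y' \<otimes>\<^bsub>S2\<^esub> \<phi>2 t)"
    using st y by (simp add: j2 j2_\<phi>2 j T.m_comm)
  ultimately show ?thesis
    unfolding amalg_rel_def using st x y inj_j1 inj_j2 by (auto simp: inj_on_eq_iff)
qed

end

section \<open>The monoid ring of the amalgamated sum\<close>

text \<open>The assumption \<open>fibre\<close> says that two pairs with the same sum in \<open>T\<close> arise from each other by moving
  elements of \<open>S\<close> from one summand to the other, which can be imitated in the tensor product.\<close>
locale amalgam_algebra = monoid_span S S1 S2 \<phi>1 \<phi>2 + K: cring K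
  for K :: "('k, 'l) ring_scheme" and S :: "('a, 'm) monoid_scheme" and S1 :: "('b, 'm1) monoid_scheme"
    and S2 :: "('c, 'm2) monoid_scheme" and \<phi>1 \<phi>2 +
  assumes fibre: "\<And>x x' y y'. \<lbrakk>x \<in> carrier S1; x' \<in> carrier S1; y \<in> carrier S2; y' \<in> carrier S2;
      j1 x \<otimes>\<^bsub>T\<^esub> j2 y = j1 x' \<otimes>\<^bsub>T\<^esub> j2 y'\<rbrakk> \<Longrightarrow>
      \<exists>z\<in>carrier S2. \<exists>a\<in>carrier S. \<exists>b\<in>carrier S.
        x \<otimes>\<^bsub>S1\<^esub> \<phi>1 a = x' \<otimes>\<^bsub>S1\<^esub> \<phi>1 b \<and> y = \<phi>2 a \<otimes>\<^bsub>S2\<^esub> z \<and> y' = \<phi>2 b \<otimes>\<^bsub>S2\<^esub> z"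
begin

abbreviation "R \<equiv> monoid_algebra K S"
abbreviation "A1 \<equiv> monoid_algebra K S1"
abbreviation "A2 \<equiv> monoid_algebra K S2"
abbreviation "AT \<equiv> monoid_algebra K T"
abbreviation "R1 \<equiv> monoid_algebra_via K \<phi>1 S1"
abbreviation "R2 \<equiv> monoid_algebra_via K \<phi>2 S2"
abbreviation "p \<equiv> push_forward K j"
abbreviation "p1 \<equiv> push_forward K j1"
abbreviation "p2 \<equiv> push_forward K j2"

sublocale R: cring R
  by (rule K.monoid_algebra_cring[OF S.comm_monoid_axioms])

sublocale A1: cring A1
  by (rule K.monoid_algebra_cring[OF S1.comm_monoid_axioms])

sublocale A2: cring A2
  by (rule K.monoid_algebra_cring[OF S2.comm_monoid_axioms])

sublocale AT: cring AT
  by (rule K.monoid_algebra_cring[OF T.comm_monoid_axioms])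

sublocale p: ring_hom_ring R AT p
  by (intro ring_hom_ringI2 R.ring_axioms AT.ring_axioms K.push_forward_ring_hom
      S.comm_monoid_axioms T.comm_monoid_axioms j_hom)

sublocale p1: ring_hom_ring A1 AT p1
  by (intro ring_hom_ringI2 A1.ring_axioms AT.ring_axioms K.push_forward_ring_hom
      S1.comm_monoid_axioms T.comm_monoid_axioms j1_hom)

sublocale p2: ring_hom_ring A2 AT p2
  by (intro ring_hom_ringI2 A2.ring_axioms AT.ring_axioms K.push_forward_ring_hom
      S2.comm_monoid_axioms T.comm_monoid_axioms j2_hom)

sublocale f1: ring_hom_ring R A1 "push_forward K \<phi>1"
  by (intro ring_hom_ringI2 A1.ring_axioms R.ring_axioms K.push_forward_ring_hom
      S1.comm_monoid_axioms S.comm_monoid_axioms \<phi>1)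

sublocale f2: ring_hom_ring R A2 "push_forward K \<phi>2"
  by (intro ring_hom_ringI2 A2.ring_axioms R.ring_axioms K.push_forward_ring_hom
      S2.comm_monoid_axioms S.comm_monoid_axioms \<phi>2)

lemma p1_f1: "r \<in> carrier R \<Longrightarrow> p1 (push_forward K \<phi>1 r) = p r"
  by (rule K.monoid_algebra_hom_eqI[OF abelian_group_hom_comp p.abelian_group_hom_axioms,
        OF f1.abelian_group_hom_axioms p1.abelian_group_hom_axioms])
    (auto simp: K.push_forward_monomial tf_amalg_in_def)

lemma p2_f2: "r \<in> carrier R \<Longrightarrow> p2 (push_forward K \<phi>2 r) = p r"
  by (rule K.monoid_algebra_hom_eqI[OF abelian_group_hom_comp p.abelian_group_hom_axioms,
        OF f2.abelian_group_hom_axioms p2.abelian_group_hom_axioms])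
    (auto simp: K.push_forward_monomial j2_\<phi>2)

lemma R1_simps: "carrier R1 = carrier A1" "m \<oplus>\<^bsub>R1\<^esub> m' = m \<oplus>\<^bsub>A1\<^esub> m'" "m \<otimes>\<^bsub>R1\<^esub> m' = m \<otimes>\<^bsub>A1\<^esub> m'"
    "\<one>\<^bsub>R1\<^esub> = \<one>\<^bsub>A1\<^esub>" "r \<odot>\<^bsub>R1\<^esub> m = push_forward K \<phi>1 r \<otimes>\<^bsub>A1\<^esub> m"
  by (simp_all add: monoid_algebra_via_def algebra_via_def)

lemma R2_simps: "carrier R2 = carrier A2" "m \<oplus>\<^bsub>R2\<^esub> m' = m \<oplus>\<^bsub>A2\<^esub> m'" "m \<otimes>\<^bsub>R2\<^esub> m' = m \<otimes>\<^bsub>A2\<^esub> m'"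
    "\<one>\<^bsub>R2\<^esub> = \<one>\<^bsub>A2\<^esub>" "r \<odot>\<^bsub>R2\<^esub> m = push_forward K \<phi>2 r \<otimes>\<^bsub>A2\<^esub> m"
  by (simp_all add: monoid_algebra_via_def algebra_via_def)

lemma R1_cring: "cring R1" and R2_cring: "cring R2"
  by (simp_all add: monoid_algebra_via_def algebra_via_cring A1.is_cring A2.is_cring)

sublocale tensor_modules R R1 R2
  unfolding monoid_algebra_via_def
  by (intro tensor_modules.intro R.algebra_via_module A1.is_cring A2.is_cring f1.homh f2.homh)

definition \<Psi> where "\<Psi> = lin_ext R AT (\<lambda>q r. p r \<otimes>\<^bsub>AT\<^esub> (p1 (fst q) \<otimes>\<^bsub>AT\<^esub> p2 (snd q)))"

lemma R12_comm_monoid: "comm_monoid (R1 \<times>\<times> R2)"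
  by (intro DirProd_comm_monoid cring.axioms(2) R1_cring R2_cring)

lemma p12_hom: "(\<lambda>q. p1 (fst q) \<otimes>\<^bsub>AT\<^esub> p2 (snd q)) \<in> monoid_hom (R1 \<times>\<times> R2) AT"
  by (auto simp: monoid_hom_def hom_def R1_simps R2_simps AT.m_ac)

lemma \<Psi>_ring_hom: "\<Psi> \<in> ring_hom F AT"
  unfolding \<Psi>_def tensor_free_def
  by (rule R.lin_ext_ring_hom[OF R12_comm_monoid AT.is_cring p.homh p12_hom])

lemma \<Psi>_monomial:
  "r \<in> carrier R \<Longrightarrow> m \<in> carrier A1 \<Longrightarrow> n \<in> carrier A2 \<Longrightarrow>
    \<Psi> (monomial R r (m, n)) = p r \<otimes>\<^bsub>AT\<^esub> (p1 m \<otimes>\<^bsub>AT\<^esub> p2 n)"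
  unfolding \<Psi>_def
  by (subst R.lin_ext_ring_hom_monomial[OF R12_comm_monoid AT.is_cring p.homh p12_hom])
    (auto simp: R1_simps R2_simps)

lemma F_cring: "cring F"
  unfolding tensor_free_def by (rule R.monoid_algebra_cring[OF R12_comm_monoid])

sublocale \<Psi>: ring_hom_ring F AT \<Psi>
  by (intro ring_hom_ringI2 AT.ring_axioms cring.axioms(1)[OF F_cring] \<Psi>_ring_hom)

lemma \<Psi>_basis_elem:
  "m \<in> carrier A1 \<Longrightarrow> n \<in> carrier A2 \<Longrightarrow> \<Psi> (basis_elem R (m, n)) = p1 m \<otimes>\<^bsub>AT\<^esub> p2 n"
  by (simp add: basis_elem_monomial \<Psi>_monomial)

lemma F_induct [consumes 1, case_names monomial add zero]:
  assumes "f \<in> carrier F"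
    and "\<And>r m n. r \<in> carrier R \<Longrightarrow> m \<in> carrier A1 \<Longrightarrow> n \<in> carrier A2 \<Longrightarrow> Q (monomial R r (m, n))"
    and "\<And>f g. f \<in> carrier F \<Longrightarrow> g \<in> carrier F \<Longrightarrow> Q f \<Longrightarrow> Q g \<Longrightarrow> Q (f \<oplus>\<^bsub>F\<^esub> g)"
    and "Q \<zero>\<^bsub>F\<^esub>"
  shows "Q f"
  using assms unfolding tensor_free_def
  by (induction rule: R.monoid_algebra_induct) (auto simp: R1_simps R2_simps)

lemma \<Psi>_linear:
  assumes "r \<in> carrier R" and "f \<in> carrier F"
  shows "\<Psi> (r \<odot>\<^bsub>F\<^esub> f) = p r \<otimes>\<^bsub>AT\<^esub> \<Psi> f"
  using assms(2)
proof (induction rule: F_induct)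
  case (monomial r' m n)
  have "r \<odot>\<^bsub>F\<^esub> monomial R r' (m, n) = monomial R (r \<otimes>\<^bsub>R\<^esub> r') (m, n)"
    using assms monomial by (auto simp: tensor_free_def monoid_algebra_simps(3)[of _ "R1 \<times>\<times> R2"] monomial_def)
  with assms monomial show ?case by (simp add: \<Psi>_monomial AT.m_assoc)
next
  case (add f g)
  with assms show ?case by (simp add: F.smult_r_distr AT.r_distr)
next
  case zero
  with assms show ?case by simp
qed

lemma \<Psi>_relations:
  assumes "f \<in> bilinear_relations R R1 R2"
  shows "\<Psi> f = \<zero>\<^bsub>AT\<^esub>"
  by (rule hom_bilinear_relations[OF \<Psi>.abelian_group_hom_axioms _ _ _ _ assms])
    (simp_all add: R1_simps R2_simps \<Psi>_basis_elem \<Psi>_monomial AT.l_distr AT.r_distr p1_f1 p2_f2 AT.m_ac)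

lemma \<Psi>_surj: "g \<in> carrier AT \<Longrightarrow> g \<in> \<Psi> ` carrier F"
proof (induction rule: K.monoid_algebra_induct)
  case (monomial c t)
  then obtain x y where xy: "x \<in> carrier S1" "y \<in> carrier S2" "t = j1 x \<otimes>\<^bsub>T\<^esub> j2 y"
    by (auto simp: carrier_T)
  have j: "j1 x \<in> carrier T" "j2 y \<in> carrier T"
    using xy j1_hom j2_hom by (auto simp: monoid_hom_def hom_def)
  have "\<Psi> (basis_elem R (monomial K c x, monomial K \<one>\<^bsub>K\<^esub> y)) = monomial K c t"
    using monomial xy j by (simp add: \<Psi>_basis_elem K.push_forward_monomial K.monomial_mult)
  moreover have "basis_elem R (monomial K c x, monomial K \<one>\<^bsub>K\<^esub> y) \<in> carrier F"
    using monomial xy by (intro basis_elem_closed) (auto simp: R1_simps R2_simps)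
  ultimately show ?case by (metis imageI)
next
  case (add g h)
  then obtain f f' where "f \<in> carrier F" "f' \<in> carrier F" "g = \<Psi> f" "h = \<Psi> f'" by blast
  then have "g \<oplus>\<^bsub>AT\<^esub> h = \<Psi> (f \<oplus>\<^bsub>F\<^esub> f')" "f \<oplus>\<^bsub>F\<^esub> f' \<in> carrier F" by simp_all
  then show ?case by blast
next
  case zero
  show ?case using \<Psi>.hom_zero F.M.zero_closed by (metis imageI)
qed

text \<open>The part of the right exponent that comes from \<open>S\<close> moves to the left, together with the
  coefficient.\<close>
lemma pure_slide:
  assumes "e \<in> carrier K" "x \<in> carrier S1" "z \<in> carrier S2" "a \<in> carrier S" "d \<in> carrier K"
  shows "pure_tensor (monomial K e x) (monomial K d (\<phi>2 a \<otimes>\<^bsub>S2\<^esub> z)) = pure_tensor (monomial K (e \<otimes>\<^bsub>K\<^esub> d) (x \<otimes>\<^bsub>S1\<^esub> \<phi>1 a)) (monomial K \<one>\<^bsub>K\<^esub> z)"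
proof -
  have "pure_tensor (monomial K d a \<odot>\<^bsub>R1\<^esub> monomial K e x) (monomial K \<one>\<^bsub>K\<^esub> z)
      = pure_tensor (monomial K e x) (monomial K d a \<odot>\<^bsub>R2\<^esub> monomial K \<one>\<^bsub>K\<^esub> z)"
    using assms by (intro pure_balanced) (auto simp: R1_simps R2_simps)
  moreover have "monomial K d a \<odot>\<^bsub>R1\<^esub> monomial K e x = monomial K (e \<otimes>\<^bsub>K\<^esub> d) (x \<otimes>\<^bsub>S1\<^esub> \<phi>1 a)"
    using assms by (simp add: R1_simps K.push_forward_monomial K.monomial_mult K.m_comm[of d] S1.m_comm[of _ x])
  moreover have "monomial K d a \<odot>\<^bsub>R2\<^esub> monomial K \<one>\<^bsub>K\<^esub> z = monomial K d (\<phi>2 a \<otimes>\<^bsub>S2\<^esub> z)"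
    using assms by (simp add: R2_simps K.push_forward_monomial K.monomial_mult)
  ultimately show ?thesis by simp
qed

text \<open>The inverse \<open>\<tau>\<close> of the multiplication map sends \<open>w\<^bsup>t\<^esup>\<close> to \<open>u\<^bsup>x\<^esup> \<otimes> v\<^bsup>y\<^esup>\<close> for a chosen decomposition
  \<open>t = x + y\<close>.\<close>
definition rep where
  "rep t = (SOME q. q \<in> carrier S1 \<times> carrier S2 \<and> t = j1 (fst q) \<otimes>\<^bsub>T\<^esub> j2 (snd q))"

definition \<tau> where
  "\<tau> = lin_ext K Ten (\<lambda>t c. pure_tensor (monomial K c (fst (rep t))) (monomial K \<one>\<^bsub>K\<^esub> (snd (rep t))))"

lemma rep: "t \<in> carrier T \<Longrightarrow> fst (rep t) \<in> carrier S1 \<and> snd (rep t) \<in> carrier S2 \<and> t = j1 (fst (rep t)) \<otimes>\<^bsub>T\<^esub> j2 (snd (rep t))"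
proof -
  assume "t \<in> carrier T"
  then have "\<exists>q. q \<in> carrier S1 \<times> carrier S2 \<and> t = j1 (fst q) \<otimes>\<^bsub>T\<^esub> j2 (snd q)"
    by (auto simp: carrier_T)
  then have "rep t \<in> carrier S1 \<times> carrier S2 \<and> t = j1 (fst (rep t)) \<otimes>\<^bsub>T\<^esub> j2 (snd (rep t))"
    unfolding rep_def by (rule someI_ex)
  then show ?thesis by (simp add: mem_Times_iff)
qed

lemma \<tau>_summand: "t \<in> carrier T \<Longrightarrow>
    abelian_group_hom K Ten (\<lambda>c. pure_tensor (monomial K c (fst (rep t))) (monomial K \<one>\<^bsub>K\<^esub> (snd (rep t))))"
  using rep[of t]
  by (intro K.add_homI Ten_abelian_group)
    (simp_all add: pure_closed R1_simps R2_simps K.monomial_add[of _ _ _ S1] pure_add_left flip: R1_simps(2))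

sublocale \<tau>: abelian_group_hom AT Ten \<tau>
  unfolding \<tau>_def by (rule K.lin_ext_hom[OF Ten_abelian_group \<tau>_summand])

lemma \<tau>_monomial: "c \<in> carrier K \<Longrightarrow> t \<in> carrier T \<Longrightarrow>
    \<tau> (monomial K c t) = pure_tensor (monomial K c (fst (rep t))) (monomial K \<one>\<^bsub>K\<^esub> (snd (rep t)))"
  unfolding \<tau>_def by (subst K.lin_ext_monomial[OF Ten_abelian_group \<tau>_summand]) auto

text \<open>Independence of the choice: by \<open>fibre\<close>, both decompositions of the exponent slide to the
  same tensor.\<close>
lemma \<tau>_monomials:
  assumes "c \<in> carrier K" "x \<in> carrier S1" "d \<in> carrier K" "y \<in> carrier S2"
  shows "\<tau> (p1 (monomial K c x) \<otimes>\<^bsub>AT\<^esub> p2 (monomial K d y)) = pure_tensor (monomial K c x) (monomial K d y)"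
proof -
  let ?t = "j1 x \<otimes>\<^bsub>T\<^esub> j2 y"
  have j: "j1 x \<in> carrier T" "j2 y \<in> carrier T"
    using assms j1_hom j2_hom by (auto simp: monoid_hom_def hom_def)
  then have t: "?t \<in> carrier T" by simp
  obtain x' y' where xy': "rep ?t = (x', y')" by fastforce
  with rep[OF t] have carr: "x' \<in> carrier S1" "y' \<in> carrier S2" and "?t = j1 x' \<otimes>\<^bsub>T\<^esub> j2 y'"
    by simp_all
  with fibre[of x' x y' y] assms obtain z a b where zab: "z \<in> carrier S2" "a \<in> carrier S" "b \<in> carrier S"
    "x' \<otimes>\<^bsub>S1\<^esub> \<phi>1 a = x \<otimes>\<^bsub>S1\<^esub> \<phi>1 b" "y' = \<phi>2 a \<otimes>\<^bsub>S2\<^esub> z" "y = \<phi>2 b \<otimes>\<^bsub>S2\<^esub> z"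
    by auto
  have "\<tau> (p1 (monomial K c x) \<otimes>\<^bsub>AT\<^esub> p2 (monomial K d y)) = \<tau> (monomial K (c \<otimes>\<^bsub>K\<^esub> d) ?t)"
    using assms j by (simp add: K.push_forward_monomial K.monomial_mult)
  also have "\<dots> = pure_tensor (monomial K (c \<otimes>\<^bsub>K\<^esub> d) x') (monomial K \<one>\<^bsub>K\<^esub> y')"
    using assms t by (simp add: \<tau>_monomial xy')
  also have "\<dots> = pure_tensor (monomial K (c \<otimes>\<^bsub>K\<^esub> d) (x' \<otimes>\<^bsub>S1\<^esub> \<phi>1 a)) (monomial K \<one>\<^bsub>K\<^esub> z)"
    unfolding zab(5) using assms carr zab(1-3) by (subst pure_slide) auto
  also have "\<dots> = pure_tensor (monomial K c x) (monomial K d y)"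
    unfolding zab(4) zab(6) using assms zab(1-3) by (intro pure_slide[symmetric])
  finally show ?thesis .
qed

lemma \<tau>_pure:
  assumes m: "m \<in> carrier A1" and n: "n \<in> carrier A2"
  shows "\<tau> (p1 m \<otimes>\<^bsub>AT\<^esub> p2 n) = pure_tensor m n"
proof -
  have hom2: "abelian_group_hom A2 Ten (\<lambda>n. pure_tensor m n)" if "m \<in> carrier A1" for m
    using that
    by (intro A2.add_homI Ten_abelian_group)
      (simp_all add: pure_closed pure_add_right R1_simps R2_simps flip: R2_simps(2))
  have hom1: "abelian_group_hom A1 Ten (\<lambda>m. pure_tensor m n)" if "n \<in> carrier A2" for n
    using that
    by (intro A1.add_homI Ten_abelian_group)
      (simp_all add: pure_closed pure_add_left R1_simps R2_simps flip: R1_simps(2))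
  have hom2': "abelian_group_hom A2 Ten (\<lambda>n. \<tau> (p1 m \<otimes>\<^bsub>AT\<^esub> p2 n))" if "m \<in> carrier A1" for m
    using that by (intro A2.add_homI Ten_abelian_group) (simp_all add: AT.r_distr)
  have hom1': "abelian_group_hom A1 Ten (\<lambda>m. \<tau> (p1 m \<otimes>\<^bsub>AT\<^esub> p2 n))" if "n \<in> carrier A2" for n
    using that by (intro A1.add_homI Ten_abelian_group) (simp_all add: AT.l_distr)
  show ?thesis
  proof (rule K.monoid_algebra_hom_eqI[OF hom1'[OF n] hom1[OF n] _ m])
    fix c x assume cx: "c \<in> carrier K" "x \<in> carrier S1"
    then have mx: "monomial K c x \<in> carrier A1" by simp
    show "\<tau> (p1 (monomial K c x) \<otimes>\<^bsub>AT\<^esub> p2 n) = pure_tensor (monomial K c x) n"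
      by (rule K.monoid_algebra_hom_eqI[OF hom2'[OF mx] hom2[OF mx] _ n]) (rule \<tau>_monomials[OF cx])
  qed
qed

lemma \<tau>_\<Psi>: "f \<in> carrier F \<Longrightarrow> \<tau> (\<Psi> f) = cls f"
proof (induction rule: F_induct)
  case (monomial r m n)
  then have m: "push_forward K \<phi>1 r \<otimes>\<^bsub>A1\<^esub> m \<in> carrier A1" by simp
  have "\<tau> (\<Psi> (monomial R r (m, n))) = \<tau> (p1 (push_forward K \<phi>1 r \<otimes>\<^bsub>A1\<^esub> m) \<otimes>\<^bsub>AT\<^esub> p2 n)"
    using monomial by (simp add: \<Psi>_monomial p1_f1 AT.m_assoc)
  also have "\<dots> = pure_tensor (push_forward K \<phi>1 r \<otimes>\<^bsub>A1\<^esub> m) n"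
    by (rule \<tau>_pure[OF m monomial(3)])
  also have "\<dots> = cls (monomial R r (m, n))"
    using monomial by (simp add: cls_monomial R1_simps R2_simps)
  finally show ?case .
qed simp_all

theorem amalgam_algebra_iso: "is_algebra_iso R (monoid_algebra_via K j T) Ten"
proof (rule tensor_prod_isoI[where \<Psi> = \<Psi> and \<tau> = \<tau>])
  let ?C = "monoid_algebra_via K j T"
  have C: "carrier ?C = carrier AT" "\<zero>\<^bsub>?C\<^esub> = \<zero>\<^bsub>AT\<^esub>" "r \<odot>\<^bsub>?C\<^esub> f = p r \<otimes>\<^bsub>AT\<^esub> f" for r f
    by (simp_all add: monoid_algebra_via_def algebra_via_def)
  show "tensor_modules R R1 R2" by (rule tensor_modules_axioms)
  show "comm_monoid R1" "comm_monoid R2" by (intro cring.axioms(2) R1_cring R2_cring)+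
  show "cring ?C" by (simp add: monoid_algebra_via_def algebra_via_cring AT.is_cring)
  show "\<Psi> \<in> ring_hom F ?C"
    using \<Psi>_ring_hom by (simp add: ring_hom_def monoid_algebra_via_def algebra_via_def)
  show "carrier ?C \<subseteq> \<Psi> ` carrier F" using \<Psi>_surj by (auto simp: C)
  show "\<Psi> (r \<odot>\<^bsub>F\<^esub> f) = r \<odot>\<^bsub>?C\<^esub> \<Psi> f" if "r \<in> carrier R" "f \<in> carrier F" for r f
    using that by (simp add: C \<Psi>_linear)
  show "r \<odot>\<^bsub>?C\<^esub> \<zero>\<^bsub>?C\<^esub> = \<zero>\<^bsub>?C\<^esub>" if "r \<in> carrier R" for r using that by (simp add: C)
  show "\<Psi> f = \<zero>\<^bsub>?C\<^esub>" if "f \<in> bilinear_relations R R1 R2" for f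
    using \<Psi>_relations[OF that] by (simp add: C)
  show "\<tau> (\<Psi> f) = cls f" if "f \<in> carrier F" for f by (rule \<tau>_\<Psi>[OF that])
qed

end

theorem theorem4p6:
  fixes K :: "('k, 'l) ring_scheme"
    and S :: "('a, 'm) monoid_scheme"
    and S1 :: "('b, 'm1) monoid_scheme"
    and S2 :: "('c, 'm2) monoid_scheme"
    and \<phi>1 :: "'a \<Rightarrow> 'b"
    and \<phi>2 :: "'a \<Rightarrow> 'c"
  defines "R \<equiv> monoid_algebra K S"
    and "R1 \<equiv> monoid_algebra_via K \<phi>1 S1"
    and "R2 \<equiv> monoid_algebra_via K \<phi>2 S2"
    and "T \<equiv> tf_amalg_sum S S1 S2 \<phi>1 \<phi>2"
    and "j1 \<equiv> tf_amalg_in1 S S1 S2 \<phi>1 \<phi>2"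
    and "j2 \<equiv> tf_amalg_in2 S S1 S2 \<phi>1 \<phi>2"
    and "j \<equiv> tf_amalg_in S S1 S2 \<phi>1 \<phi>2"
  assumes "field K"
    and "affine_semigroup S" and "affine_semigroup S1" and "affine_semigroup S2"
    and "\<phi>1 \<in> monoid_hom S S1" and "inj_on \<phi>1 (carrier S)"
    and "\<phi>2 \<in> monoid_hom S S2" and "inj_on \<phi>2 (carrier S)"
    and "positive_monoid S2"
    and "flat_module R R2"
    and "Grp_map T j1 ` carrier (Grp S1) \<inter> Grp_map T j2 ` carrier (Grp S2)
           = Grp_map T j ` carrier (Grp S)"
  shows "is_algebra_iso R (monoid_algebra_via K j T) (tensor_prod R R1 R2)"
proof -
  interpret K: field K by fact
  interpret S: comm_monoid_cancel S using \<open>affine_semigroup S\<close> by (simp add: affine_semigroup_def)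
  interpret S1: comm_monoid_cancel S1 using \<open>affine_semigroup S1\<close> by (simp add: affine_semigroup_def)
  interpret S2: comm_monoid_cancel S2 using \<open>affine_semigroup S2\<close> by (simp add: affine_semigroup_def)
  interpret span: torsion_free_span S S1 S2 \<phi>1 \<phi>2
    using assms(9-15)
    by unfold_locales (simp_all add: affine_semigroup_def)
  interpret flat: flat_monoid_algebra K S S2 \<phi>2
    using assms unfolding R_def R2_def by unfold_locales simp_all
  have "\<exists>z\<in>carrier S2. \<exists>a\<in>carrier S. \<exists>b\<in>carrier S.
      x \<otimes>\<^bsub>S1\<^esub> \<phi>1 a = x' \<otimes>\<^bsub>S1\<^esub> \<phi>1 b \<and> y = \<phi>2 a \<otimes>\<^bsub>S2\<^esub> z \<and> y' = \<phi>2 b \<otimes>\<^bsub>S2\<^esub> z"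
    if carr: "x \<in> carrier S1" "x' \<in> carrier S1" "y \<in> carrier S2" "y' \<in> carrier S2"
      and eq: "j1 x \<otimes>\<^bsub>T\<^esub> j2 y = j1 x' \<otimes>\<^bsub>T\<^esub> j2 y'" for x x' y y'
  proof -
    have "span.amalg_rel (x, y) (x', y')"
      using span.j_eq_imp_amalg_rel[OF _ carr] eq assms(18) unfolding T_def j1_def j2_def j_def by simp
    then obtain s t where st: "s \<in> carrier S" "t \<in> carrier S"
      and x: "x \<otimes>\<^bsub>S1\<^esub> \<phi>1 t = x' \<otimes>\<^bsub>S1\<^esub> \<phi>1 s" and y: "y \<otimes>\<^bsub>S2\<^esub> \<phi>2 s = y' \<otimes>\<^bsub>S2\<^esub> \<phi>2 t"
      by (auto simp: span.amalg_rel_def)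
    have "\<phi>2 s \<otimes>\<^bsub>S2\<^esub> y = \<phi>2 t \<otimes>\<^bsub>S2\<^esub> y'"
      using y st carr by (simp add: S2.m_comm)
    then obtain z a b where zab: "z \<in> carrier S2" "a \<in> carrier S" "b \<in> carrier S"
      "y = \<phi>2 a \<otimes>\<^bsub>S2\<^esub> z" "y' = \<phi>2 b \<otimes>\<^bsub>S2\<^esub> z" and ab: "s \<otimes>\<^bsub>S\<^esub> a = t \<otimes>\<^bsub>S\<^esub> b"
      using flat.common_refinement[OF st carr(3,4)] by blast
    \<comment> \<open>\<open>x + a + s = x + t + b = x' + s + b\<close>, then cancel \<open>s\<close>.\<close>
    have "(x \<otimes>\<^bsub>S1\<^esub> \<phi>1 a) \<otimes>\<^bsub>S1\<^esub> \<phi>1 s = x \<otimes>\<^bsub>S1\<^esub> \<phi>1 (s \<otimes>\<^bsub>S\<^esub> a)"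
      using st carr zab(1-3) by (simp add: S1.m_ac)
    also have "\<dots> = (x \<otimes>\<^bsub>S1\<^esub> \<phi>1 t) \<otimes>\<^bsub>S1\<^esub> \<phi>1 b"
      unfolding ab using st carr zab(1-3) by (simp add: S1.m_ac)
    also have "\<dots> = (x' \<otimes>\<^bsub>S1\<^esub> \<phi>1 b) \<otimes>\<^bsub>S1\<^esub> \<phi>1 s"
      unfolding x using st carr zab(1-3) by (simp add: S1.m_ac)
    finally have "x \<otimes>\<^bsub>S1\<^esub> \<phi>1 a = x' \<otimes>\<^bsub>S1\<^esub> \<phi>1 b"
      using st carr zab(1-3) by (auto dest: S1.r_cancel)
    with zab show ?thesis by blast
  qed
  then interpret amalgam: amalgam_algebra K S S1 S2 \<phi>1 \<phi>2
    unfolding T_def j1_def j2_def by unfold_locales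
  show ?thesis
    unfolding R_def R1_def R2_def T_def j_def by (rule amalgam.amalgam_algebra_iso)
qed

end
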